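(* The restriction functor $\mathbf{Res}:\widehat{\mathbf{CHaus}}\to\widehat{\beta\mathbf{Sets}}$, $\mathcal F\mapsto\mathcal F|_{\beta\mathbf{Sets}}$, gives an equivalence of categories between the category $\mathbf{CSets}$ of condensed sets and the category $\mathbf{NCSets}$ of naive condensed sets.
   Context: $\mathbf{Sets}$ denotes a fixed essentially small, nonempty, full category of sets, closed under bijections and subsets, such that the power set $\mathcal P(S)$ is in $\mathbf{Sets}$ whenever $S$ is (for example, the category of sets of cardinality $<\kappa$ for an uncountable strong limit cardinal $\kappa$). $\mathbf{CHaus}$ is the category of compact Hausdorff spaces with underlying set in $\mathbf{Sets}$ and continuous maps; its epimorphisms are the continuous surjections. For a set $S$, $\beta S$ is the compact Hausdorff space of ultrafilters on $S$, i.e. the Stone-Čech compactification of the discrete space $S$. $\beta\mathbf{Sets}$ is the full subcategory of $\mathbf{CHaus}$ formed by the objects $\beta S$, $S\in\mathbf{Sets}$. It has finite coproducts, which are the coproducts in $\mathbf{CHaus}$. $\widehat{\mathbf{CHaus}}$ and $\widehat{\beta\mathbf{Sets}}$ are the categories of contravariant functors $\mathbf{CHaus}\to\mathbf{Sets}$ and $\beta\mathbf{Sets}\to\mathbf{Sets}$, respectively, with natural transformations as morphisms. $\mathbf{CSets}$ is the full subcategory of $\widehat{\mathbf{CHaus}}$ of functors $\mathcal F$ that send finite coproducts to finite products and such that for every epimorphism $f:Y\to X$ in $\mathbf{CHaus}$ the natural map $\mathcal F(X)\to \mathrm{eq}\big(\mathcal F(Y)\rightrightarrows\mathcal F(Y\times_X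 Y)\big)$ is a bijection. $\mathbf{NCSets}$ is the full subcategory of $\widehat{\beta\mathbf{Sets}}$ of functors $\mathcal F$ that send finite coproducts to finite products, i.e. $\mathcal F(\emptyset)$ is a one-element set and the natural map $\mathcal F(\beta S\sqcup\beta T)\to\mathcal F(\beta S)\times\mathcal F(\beta T)$ is a bijection for all sets $S,T$. *)

theory Defs
  imports "HOL-Analysis.Analysis"
begin

section \<open>Categories, functors, equivalences\<close>

text \<open>
  Arrow-based categories: an arrow determines its domain and codomain. \<open>Cmp C g f\<close> is
  \<open>g\<close> after \<open>f\<close>. In the concrete categories below an arrow is a triple (domain, data, codomain).
\<close>

record ('o, 'a) cat =
  Obj :: "'o set"
  Arr :: "'a set"
  Dom :: "'a \<Rightarrow> 'o"
  Cod :: "'a \<Rightarrow> 'o"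
  Ide :: "'o \<Rightarrow> 'a"
  Cmp :: "'a \<Rightarrow> 'a \<Rightarrow> 'a"

locale is_category =
  fixes C :: "('o, 'a) cat"
  assumes Dom_Obj: "f \<in> Arr C \<Longrightarrow> Dom C f \<in> Obj C"
    and Cod_Obj: "f \<in> Arr C \<Longrightarrow> Cod C f \<in> Obj C"
    and Ide_Arr: "X \<in> Obj C \<Longrightarrow> Ide C X \<in> Arr C"
    and Dom_Ide: "X \<in> Obj C \<Longrightarrow> Dom C (Ide C X) = X"
    and Cod_Ide: "X \<in> Obj C \<Longrightarrow> Cod C (Ide C X) = X"
    and Cmp_Arr: "\<lbrakk>f \<in> Arr C; g \<in> Arr C; Cod C f = Dom C g\<rbrakk> \<Longrightarrow> Cmp C g f \<in> Arr C"
    and Dom_Cmp: "\<lbrakk>f \<in> Arr C; g \<in> Arr C; Cod C f = Dom C g\<rbrakk> \<Longrightarrow> Dom C (Cmp C g f) = Dom C f"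
    and Cod_Cmp: "\<lbrakk>f \<in> Arr C; g \<in> Arr C; Cod C f = Dom C g\<rbrakk> \<Longrightarrow> Cod C (Cmp C g f) = Cod C g"
    and Cmp_Ide_right: "f \<in> Arr C \<Longrightarrow> Cmp C f (Ide C (Dom C f)) = f"
    and Cmp_Ide_left: "f \<in> Arr C \<Longrightarrow> Cmp C (Ide C (Cod C f)) f = f"
    and Cmp_assoc: "\<lbrakk>f \<in> Arr C; g \<in> Arr C; h \<in> Arr C; Cod C f = Dom C g; Cod C g = Dom C h\<rbrakk>
      \<Longrightarrow> Cmp C h (Cmp C g f) = Cmp C (Cmp C h g) f"

definition op_cat :: "('o, 'a) cat \<Rightarrow> ('o, 'a) cat" where
  "op_cat C = C\<lparr>Dom := Cod C, Cod := Dom C, Cmp := (\<lambda>g f. Cmp C f g)\<rparr>"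

definition full_subcat :: "('o, 'a) cat \<Rightarrow> 'o set \<Rightarrow> ('o, 'a) cat" where
  "full_subcat C P = C\<lparr>Obj := Obj C \<inter> P, Arr := {f \<in> Arr C. Dom C f \<in> P \<and> Cod C f \<in> P}\<rparr>"

definition isomorphic :: "('o, 'a) cat \<Rightarrow> 'o \<Rightarrow> 'o \<Rightarrow> bool" where
  "isomorphic C X Y \<longleftrightarrow> X \<in> Obj C \<and> Y \<in> Obj C \<and> (\<exists>f\<in>Arr C. \<exists>g\<in>Arr C.
     Dom C f = X \<and> Cod C f = Y \<and> Dom C g = Y \<and> Cod C g = X \<and>
     Cmp C g f = Ide C X \<and> Cmp C f g = Ide C Y)"

definition epi :: "('o, 'a) cat \<Rightarrow> 'a \<Rightarrow> bool" where
  "epi C f \<longleftrightarrow> f \<in> Arr C \<and> (\<forall>g\<in>Arr C. \<forall>h\<in>Arr C.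
     Dom C g = Cod C f \<and> Dom C h = Cod C f \<and> Cod C g = Cod C h \<and> Cmp C g f = Cmp C h f
     \<longrightarrow> g = h)"

definition initial :: "('o, 'a) cat \<Rightarrow> 'o \<Rightarrow> bool" where
  "initial C X \<longleftrightarrow> X \<in> Obj C \<and> (\<forall>Y\<in>Obj C. \<exists>!f. f \<in> Arr C \<and> Dom C f = X \<and> Cod C f = Y)"

definition coproduct :: "('o, 'a) cat \<Rightarrow> 'a \<Rightarrow> 'a \<Rightarrow> bool" where
  "coproduct C i j \<longleftrightarrow> i \<in> Arr C \<and> j \<in> Arr C \<and> Cod C i = Cod C j \<and>
     (\<forall>f\<in>Arr C. \<forall>g\<in>Arr C. Dom C f = Dom C i \<and> Dom C g = Dom C j \<and> Cod C f = Cod C g \<longrightarrow>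
       (\<exists>!h. h \<in> Arr C \<and> Dom C h = Cod C i \<and> Cod C h = Cod C f \<and>
             Cmp C h i = f \<and> Cmp C h j = g))"

definition pullback :: "('o, 'a) cat \<Rightarrow> 'a \<Rightarrow> 'a \<Rightarrow> 'a \<Rightarrow> 'a \<Rightarrow> bool" where
  "pullback C f g p q \<longleftrightarrow> f \<in> Arr C \<and> g \<in> Arr C \<and> p \<in> Arr C \<and> q \<in> Arr C \<and>
     Cod C f = Cod C g \<and> Dom C p = Dom C q \<and> Cod C p = Dom C f \<and> Cod C q = Dom C g \<and>
     Cmp C f p = Cmp C g q \<and>
     (\<forall>s\<in>Arr C. \<forall>t\<in>Arr C. Dom C s = Dom C t \<and> Cod C s = Dom C f \<and> Cod C t = Dom C g \<and>
         Cmp C f s = Cmp C g t \<longrightarrow>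
       (\<exists>!h. h \<in> Arr C \<and> Dom C h = Dom C s \<and> Cod C h = Dom C p \<and>
             Cmp C p h = s \<and> Cmp C q h = t))"

text \<open>
  Functors and natural transformations are required to be \<^const>\<open>undefined\<close> outside their domain,
  so that equality of them in HOL is the mathematical equality.
\<close>

record ('o, 'a, 'p, 'b) fctr =
  FO :: "'o \<Rightarrow> 'p"
  FA :: "'a \<Rightarrow> 'b"

locale is_functor = C: is_category C + D: is_category D
  for C :: "('o, 'a) cat" and D :: "('p, 'b) cat" +
  fixes F :: "('o, 'a, 'p, 'b) fctr"
  assumes FO_PiE: "FO F \<in> Obj C \<rightarrow>\<^sub>E Obj D"
    and FA_PiE: "FA F \<in> Arr C \<rightarrow>\<^sub>E Arr D"
    and Dom_FA: "f \<in> Arr C \<Longrightarrow> Dom D (FA F f) = FO F (Dom C f)"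
    and Cod_FA: "f \<in> Arr C \<Longrightarrow> Cod D (FA F f) = FO F (Cod C f)"
    and FA_Ide: "X \<in> Obj C \<Longrightarrow> FA F (Ide C X) = Ide D (FO F X)"
    and FA_Cmp: "\<lbrakk>f \<in> Arr C; g \<in> Arr C; Cod C f = Dom C g\<rbrakk>
      \<Longrightarrow> FA F (Cmp C g f) = Cmp D (FA F g) (FA F f)"

definition id_fctr :: "('o, 'a) cat \<Rightarrow> ('o, 'a, 'o, 'a) fctr" where
  "id_fctr C = \<lparr>FO = (\<lambda>X\<in>Obj C. X), FA = (\<lambda>f\<in>Arr C. f)\<rparr>"

definition comp_fctr ::
  "('o, 'a) cat \<Rightarrow> ('p, 'b, 'q, 'c) fctr \<Rightarrow> ('o, 'a, 'p, 'b) fctr \<Rightarrow> ('o, 'a, 'q, 'c) fctr" where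
  "comp_fctr C G F = \<lparr>FO = compose (Obj C) (FO G) (FO F), FA = compose (Arr C) (FA G) (FA F)\<rparr>"

definition restrict_fctr ::
  "('o, 'a) cat \<Rightarrow> ('o, 'a, 'p, 'b) fctr \<Rightarrow> ('o, 'a, 'p, 'b) fctr" where
  "restrict_fctr B F = \<lparr>FO = restrict (FO F) (Obj B), FA = restrict (FA F) (Arr B)\<rparr>"

locale is_nat_trans = F: is_functor C D F + G: is_functor C D G
  for C :: "('o, 'a) cat" and D :: "('p, 'b) cat"
    and F G :: "('o, 'a, 'p, 'b) fctr" +
  fixes \<eta> :: "'o \<Rightarrow> 'b"
  assumes component_PiE: "\<eta> \<in> Obj C \<rightarrow>\<^sub>E Arr D"
    and Dom_component: "X \<in> Obj C \<Longrightarrow> Dom D (\<eta> X) = FO F X"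
    and Cod_component: "X \<in> Obj C \<Longrightarrow> Cod D (\<eta> X) = FO G X"
    and natural: "f \<in> Arr C
      \<Longrightarrow> Cmp D (FA G f) (\<eta> (Dom C f)) = Cmp D (\<eta> (Cod C f)) (FA F f)"

type_synonym ('o, 'a, 'p, 'b) ntrans =
  "('o, 'a, 'p, 'b) fctr \<times> ('o \<Rightarrow> 'b) \<times> ('o, 'a, 'p, 'b) fctr"

definition functor_cat ::
  "('o, 'a) cat \<Rightarrow> ('p, 'b) cat \<Rightarrow> (('o, 'a, 'p, 'b) fctr, ('o, 'a, 'p, 'b) ntrans) cat" where
  "functor_cat C D =
    \<lparr>Obj = {F. is_functor C D F},
     Arr = {(F, \<eta>, G). is_nat_trans C D F G \<eta>},
     Dom = (\<lambda>(F, \<eta>, G). F),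
     Cod = (\<lambda>(F, \<eta>, G). G),
     Ide = (\<lambda>F. (F, \<lambda>X\<in>Obj C. Ide D (FO F X), F)),
     Cmp = (\<lambda>(_, \<theta>, H) (F, \<eta>, _). (F, \<lambda>X\<in>Obj C. Cmp D (\<theta> X) (\<eta> X), H))\<rparr>"

definition equivalence ::
  "('o, 'a) cat \<Rightarrow> ('p, 'b) cat \<Rightarrow> ('o, 'a, 'p, 'b) fctr \<Rightarrow> bool" where
  "equivalence C D F \<longleftrightarrow> is_functor C D F \<and>
     (\<exists>G. is_functor D C G \<and>
        isomorphic (functor_cat C C) (comp_fctr C G F) (id_fctr C) \<and>
        isomorphic (functor_cat D D) (comp_fctr D F G) (id_fctr D))"

section \<open>The category of sets\<close>

text \<open>
  The essentially small category of sets is given by a collection \<open>\<S>\<close> of subsets of an arbitrary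
  type \<open>'u\<close>: an essentially small category of sets closed under bijections is determined by
  its members lying in a sufficiently large fixed set, here the universe of \<open>'u\<close>.
  As \<open>Pow A\<close> does not itself consist of elements of \<open>'u\<close>, closure under power
  sets means that \<open>\<S>\<close> contains a set in bijection with it.
\<close>

locale set_universe =
  fixes \<S> :: "'u set set"
  assumes universe_nonempty: "\<S> \<noteq> {}"
    and bij_closed: "\<lbrakk>A \<in> \<S>; bij_betw f A B\<rbrakk> \<Longrightarrow> B \<in> \<S>"
    and subset_closed: "\<lbrakk>A \<in> \<S>; B \<subseteq> A\<rbrakk> \<Longrightarrow> B \<in> \<S>"
    and Pow_closed: "A \<in> \<S> \<Longrightarrow> \<exists>B\<in>\<S>. \<exists>f. bij_betw f (Pow A) B"

type_synonym 'u set_arr = "'u set \<times> ('u \<Rightarrow> 'u) \<times> 'u set"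

definition Sets :: "'u set set \<Rightarrow> ('u set, 'u set_arr) cat" where
  "Sets \<S> =
    \<lparr>Obj = \<S>,
     Arr = {(A, f, B). A \<in> \<S> \<and> B \<in> \<S> \<and> f \<in> A \<rightarrow>\<^sub>E B},
     Dom = (\<lambda>(A, f, B). A),
     Cod = (\<lambda>(A, f, B). B),
     Ide = (\<lambda>A. (A, \<lambda>x\<in>A. x, A)),
     Cmp = (\<lambda>(_, g, C) (A, f, _). (A, compose A g f, C))\<rparr>"

definition arr_fun :: "'u set_arr \<Rightarrow> 'u \<Rightarrow> 'u" where
  "arr_fun = (\<lambda>(A, f, B). f)"

section \<open>Compact Hausdorff spaces and Stone-Cech compactifications of discrete spaces\<close>

type_synonym 'u top_arr = "'u topology \<times> ('u \<Rightarrow> 'u) \<times> 'u topology"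

definition CHaus_obj :: "'u set set \<Rightarrow> 'u topology set" where
  "CHaus_obj \<S> = {X. compact_space X \<and> Hausdorff_space X \<and> topspace X \<in> \<S>}"

definition CHaus :: "'u set set \<Rightarrow> ('u topology, 'u top_arr) cat" where
  "CHaus \<S> =
    \<lparr>Obj = CHaus_obj \<S>,
     Arr = {(X, f, Y). X \<in> CHaus_obj \<S> \<and> Y \<in> CHaus_obj \<S> \<and>
                       continuous_map X Y f \<and> f \<in> extensional (topspace X)},
     Dom = (\<lambda>(X, f, Y). X),
     Cod = (\<lambda>(X, f, Y). Y),
     Ide = (\<lambda>X. (X, \<lambda>x\<in>topspace X. x, X)),
     Cmp = (\<lambda>(_, g, Z) (X, f, _). (X, compose (topspace X) g f, Z))\<rparr>"

definition ultrafilters :: "'u set \<Rightarrow> 'u set set set" where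
  "ultrafilters S = {U. U \<subseteq> Pow S \<and> S \<in> U \<and> {} \<notin> U \<and>
     (\<forall>A\<in>U. \<forall>B\<in>U. A \<inter> B \<in> U) \<and>
     (\<forall>A\<in>U. \<forall>B. A \<subseteq> B \<and> B \<subseteq> S \<longrightarrow> B \<in> U) \<and>
     (\<forall>A. A \<subseteq> S \<longrightarrow> A \<in> U \<or> S - A \<in> U)}"

definition ultrafilter_space :: "'u set \<Rightarrow> 'u set set topology" where
  "ultrafilter_space S = topology_generated_by {{U \<in> ultrafilters S. A \<in> U} |A. A \<subseteq> S}"

text \<open>
  \<open>\<beta>S\<close> has to be carried by a member of \<open>\<S>\<close>, so the ultrafilters are
  renamed by elements of \<open>'u\<close> along an arbitrarily chosen injection. One exists when
  \<open>S \<in> \<S>\<close>, since \<open>ultrafilters S \<subseteq> Pow (Pow S)\<close>.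
\<close>

definition ultrafilter_code :: "'u set set \<Rightarrow> 'u set \<Rightarrow> 'u set set \<Rightarrow> 'u" where
  "ultrafilter_code \<S> S = (SOME e. inj_on e (ultrafilters S) \<and> e ` ultrafilters S \<in> \<S>)"

definition beta :: "'u set set \<Rightarrow> 'u set \<Rightarrow> 'u topology" where
  "beta \<S> S =
    pullback_topology (ultrafilter_code \<S> S ` ultrafilters S)
      (the_inv_into (ultrafilters S) (ultrafilter_code \<S> S)) (ultrafilter_space S)"

definition betaSets :: "'u set set \<Rightarrow> ('u topology, 'u top_arr) cat" where
  "betaSets \<S> = full_subcat (CHaus \<S>) (beta \<S> ` \<S>)"

section \<open>Condensed sets and naive condensed sets\<close>

type_synonym ('o, 'a, 'u) psh = "('o, 'a, 'u set, 'u set_arr) fctr"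

definition PSh :: "'u set set \<Rightarrow> ('o, 'a) cat
    \<Rightarrow> (('o, 'a, 'u) psh, ('o, 'a, 'u set, 'u set_arr) ntrans) cat" where
  "PSh \<S> C = functor_cat (op_cat C) (Sets \<S>)"

text \<open>
  Coproducts and fibre products are only determined up to isomorphism, so the two conditions
  below range over all universal (co)cones.
\<close>

definition coproducts_to_products :: "('o, 'a) cat \<Rightarrow> ('o, 'a, 'u) psh \<Rightarrow> bool" where
  "coproducts_to_products C F \<longleftrightarrow>
     (\<forall>X. initial C X \<longrightarrow> is_singleton (FO F X)) \<and>
     (\<forall>i j. coproduct C i j \<longrightarrow>
        bij_betw (\<lambda>x. (arr_fun (FA F i) x, arr_fun (FA F j) x))
          (FO F (Cod C i)) (FO F (Dom C i) \<times> FO F (Dom C j)))"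

definition epi_descent :: "('o, 'a) cat \<Rightarrow> ('o, 'a, 'u) psh \<Rightarrow> bool" where
  "epi_descent C F \<longleftrightarrow> (\<forall>f p q. epi C f \<and> pullback C f f p q \<longrightarrow>
     bij_betw (arr_fun (FA F f)) (FO F (Cod C f))
       {y \<in> FO F (Dom C f). arr_fun (FA F p) y = arr_fun (FA F q) y})"

definition CSets :: "'u set set \<Rightarrow>
    (('u topology, 'u top_arr, 'u) psh, ('u topology, 'u top_arr, 'u set, 'u set_arr) ntrans) cat"
  where
  "CSets \<S> = full_subcat (PSh \<S> (CHaus \<S>))
     {F. coproducts_to_products (CHaus \<S>) F \<and> epi_descent (CHaus \<S>) F}"

definition NCSets :: "'u set set \<Rightarrow>
    (('u topology, 'u top_arr, 'u) psh, ('u topology, 'u top_arr, 'u set, 'u set_arr) ntrans) cat"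
  where
  "NCSets \<S> = full_subcat (PSh \<S> (betaSets \<S>)) {F. coproducts_to_products (betaSets \<S>) F}"

definition Res :: "'u set set \<Rightarrow>
    (('u topology, 'u top_arr, 'u) psh, ('u topology, 'u top_arr, 'u set, 'u set_arr) ntrans,
     ('u topology, 'u top_arr, 'u) psh, ('u topology, 'u top_arr, 'u set, 'u set_arr) ntrans) fctr"
  where
  "Res \<S> =
    \<lparr>FO = (\<lambda>F\<in>Obj (PSh \<S> (CHaus \<S>)). restrict_fctr (betaSets \<S>) F),
     FA = (\<lambda>t\<in>Arr (PSh \<S> (CHaus \<S>)).
       (case t of (F, \<eta>, G) \<Rightarrow>
         (restrict_fctr (betaSets \<S>) F, restrict \<eta> (Obj (betaSets \<S>)),
          restrict_fctr (betaSets \<S>) G)))\<rparr>"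

end

theory Submission
  imports Defs
begin

text \<open>
  Every compact Hausdorff space \<open>X\<close> is a quotient of \<open>\<beta>S\<close> for its underlying set \<open>S\<close>, and the spaces
  \<open>\<beta>S\<close> are projective with respect to the epimorphisms, which are the continuous surjections.
  Descent along such covers makes restriction fully faithful: a natural transformation on the
  spaces \<open>\<beta>S\<close> extends uniquely. Conversely, a naive condensed set \<open>F\<close> is extended to \<open>X\<close> by the
  right Kan extension, the set of natural transformations from \<open>Hom(-, X)\<close> to \<open>F\<close> on the spaces
  \<open>\<beta>S\<close>. Projectivity yields descent for the extension. It preserves finite products because a map
  from \<open>\<beta>S\<close> to \<open>X \<squnion> Y\<close> splits \<open>S\<close>, and with it \<open>\<beta>S\<close>, into the parts over \<open>X\<close> and over \<open>Y\<close>.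
\<close>

section \<open>Functor categories and equivalences\<close>

text \<open>The spaces beta S are not closed under fibre products, so descent cannot be phrased
  inside their category. Where a fibre product of \<open>Y\<close> with itself over \<open>X\<close>
  would occur, the extension tests it by pairs of arrows out of a projective object: arrows that
  become equal over \<open>X\<close> must act equally. In the same spirit the preimage of a summand
  under an arrow from beta S is asked to be a weak pullback only, tested on projective objects.
  These requirements are collected in the locale \<open>projective_site\<close>, which separates the
  categorical argument from the topology. A second constraint is size. The members of
  \<open>\<S>\<close> are subsets of one type, with closure given only for bijections, subsets and
  power sets. Sums, squares, spaces of ultrafilters and collapsed spaces are therefore built on
  other types and then moved into the universe. For the same reason the natural transformations that
  make up the Kan extension are coded by single values instead of being collected as
  functions.\<close>

lemma op_cat_simps [simp]:
  "Obj (op_cat C) = Obj C" "Arr (op_cat C) = Arr C" "Dom (op_cat C) = Cod C"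
  "Cod (op_cat C) = Dom C" "Ide (op_cat C) = Ide C" "Cmp (op_cat C) g f = Cmp C f g"
  by (simp_all add: op_cat_def)

lemma full_subcat_simps [simp]:
  "Obj (full_subcat C P) = Obj C \<inter> P"
  "Arr (full_subcat C P) = {f \<in> Arr C. Dom C f \<in> P \<and> Cod C f \<in> P}"
  "Dom (full_subcat C P) = Dom C" "Cod (full_subcat C P) = Cod C"
  "Ide (full_subcat C P) = Ide C" "Cmp (full_subcat C P) = Cmp C"
  by (simp_all add: full_subcat_def)

lemma functor_cat_simps [simp]:
  "Obj (functor_cat C D) = {F. is_functor C D F}"
  "Arr (functor_cat C D) = {(F, \<eta>, G). is_nat_trans C D F G \<eta>}"
  "Dom (functor_cat C D) (F, \<eta>, G) = F"
  "Cod (functor_cat C D) (F, \<eta>, G) = G"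
  "Ide (functor_cat C D) F = (F, \<lambda>X\<in>Obj C. Ide D (FO F X), F)"
  "Cmp (functor_cat C D) (G', \<theta>, H) (F, \<eta>, G) = (F, \<lambda>X\<in>Obj C. Cmp D (\<theta> X) (\<eta> X), H)"
  by (simp_all add: functor_cat_def)

lemma is_category_op_cat:
  assumes "is_category C" shows "is_category (op_cat C)"
proof -
  interpret is_category C by fact
  show ?thesis
    by unfold_locales
      (simp_all add: Dom_Obj Cod_Obj Ide_Arr Dom_Ide Cod_Ide Cmp_Arr Dom_Cmp Cod_Cmp
        Cmp_Ide_left Cmp_Ide_right Cmp_assoc)
qed

lemma is_category_full_subcat:
  assumes "is_category C" shows "is_category (full_subcat C P)"
proof -
  interpret is_category C by fact
  show ?thesis
    by unfold_locales
      (auto simp: Dom_Obj Cod_Obj Ide_Arr Dom_Ide Cod_Ide Cmp_Arr Dom_Cmp Cod_Cmp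
        Cmp_Ide_left Cmp_Ide_right Cmp_assoc)
qed

context is_functor
begin

lemma FO_Obj: "X \<in> Obj C \<Longrightarrow> FO F X \<in> Obj D"
  using FO_PiE by auto

lemma FA_Arr: "f \<in> Arr C \<Longrightarrow> FA F f \<in> Arr D"
  using FA_PiE by auto

end

context is_nat_trans
begin

lemma component_Arr: "X \<in> Obj C \<Longrightarrow> \<eta> X \<in> Arr D"
  using component_PiE by auto

end

lemma is_nat_trans_Ide:
  assumes "is_functor C D F"
  shows "is_nat_trans C D F F (\<lambda>X\<in>Obj C. Ide D (FO F X))"
proof -
  interpret is_functor C D F by fact
  show ?thesis
  proof unfold_locales
    fix f assume f: "f \<in> Arr C"
    have "Cmp D (FA F f) (Ide D (FO F (Dom C f))) = FA F f"
      using D.Cmp_Ide_right[OF FA_Arr[OF f]] Dom_FA[OF f] by simp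
    moreover have "Cmp D (Ide D (FO F (Cod C f))) (FA F f) = FA F f"
      using D.Cmp_Ide_left[OF FA_Arr[OF f]] Cod_FA[OF f] by simp
    ultimately show "Cmp D (FA F f) ((\<lambda>X\<in>Obj C. Ide D (FO F X)) (Dom C f)) =
        Cmp D ((\<lambda>X\<in>Obj C. Ide D (FO F X)) (Cod C f)) (FA F f)"
      using f by (simp add: C.Dom_Obj C.Cod_Obj)
  qed (auto simp: FO_Obj D.Ide_Arr D.Dom_Ide D.Cod_Ide)
qed

lemma is_nat_trans_Cmp:
  assumes "is_nat_trans C D F G \<eta>" "is_nat_trans C D G H \<theta>"
  shows "is_nat_trans C D F H (\<lambda>X\<in>Obj C. Cmp D (\<theta> X) (\<eta> X))"
proof -
  interpret e: is_nat_trans C D F G \<eta> by fact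
  interpret t: is_nat_trans C D G H \<theta> by fact
  show ?thesis
  proof unfold_locales
    fix f assume f: "f \<in> Arr C"
    let ?X = "Dom C f" and ?Y = "Cod C f"
    note ob = e.F.C.Dom_Obj[OF f] e.F.C.Cod_Obj[OF f]
    note ar = e.component_Arr t.component_Arr e.F.FA_Arr e.G.FA_Arr t.G.FA_Arr
      e.Dom_component e.Cod_component t.Dom_component t.Cod_component
      e.F.Dom_FA e.F.Cod_FA e.G.Dom_FA e.G.Cod_FA t.G.Dom_FA t.G.Cod_FA
    have "Cmp D (FA H f) (Cmp D (\<theta> ?X) (\<eta> ?X)) = Cmp D (Cmp D (FA H f) (\<theta> ?X)) (\<eta> ?X)"
      using f ob by (simp add: e.F.D.Cmp_assoc ar)
    also have "\<dots> = Cmp D (Cmp D (\<theta> ?Y) (FA G f)) (\<eta> ?X)"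
      by (simp add: t.natural f)
    also have "\<dots> = Cmp D (\<theta> ?Y) (Cmp D (FA G f) (\<eta> ?X))"
      using f ob by (simp add: e.F.D.Cmp_assoc ar)
    also have "\<dots> = Cmp D (\<theta> ?Y) (Cmp D (\<eta> ?Y) (FA F f))"
      by (simp add: e.natural f)
    also have "\<dots> = Cmp D (Cmp D (\<theta> ?Y) (\<eta> ?Y)) (FA F f)"
      using f ob by (simp add: e.F.D.Cmp_assoc ar)
    finally show "Cmp D (FA H f) ((\<lambda>X\<in>Obj C. Cmp D (\<theta> X) (\<eta> X)) ?X) =
        Cmp D ((\<lambda>X\<in>Obj C. Cmp D (\<theta> X) (\<eta> X)) ?Y) (FA F f)"
      using ob by simp
  qed (auto simp: e.component_Arr t.component_Arr e.Dom_component e.Cod_component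
      t.Dom_component t.Cod_component e.F.D.Cmp_Arr e.F.D.Dom_Cmp e.F.D.Cod_Cmp)
qed

lemma is_category_functor_cat: "is_category (functor_cat C D)"
proof unfold_locales
  fix t assume "t \<in> Arr (functor_cat C D)"
  then obtain F \<eta> G where t: "t = (F, \<eta>, G)" and n: "is_nat_trans C D F G \<eta>"
    by auto
  interpret is_nat_trans C D F G \<eta> by fact
  show "Dom (functor_cat C D) t \<in> Obj (functor_cat C D)"
    "Cod (functor_cat C D) t \<in> Obj (functor_cat C D)"
    using t F.is_functor_axioms G.is_functor_axioms by simp_all
  have "\<eta> \<in> extensional (Obj C)"
    using component_PiE by (auto simp: PiE_def)
  then have "(\<lambda>X\<in>Obj C. \<eta> X) = \<eta>"
    by (rule extensional_restrict)
  moreover have "Cmp D (\<eta> X) (Ide D (FO F X)) = \<eta> X" "Cmp D (Ide D (FO G X)) (\<eta> X) = \<eta> X"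
    if "X \<in> Obj C" for X
    using F.D.Cmp_Ide_right[OF component_Arr[OF that]] F.D.Cmp_Ide_left[OF component_Arr[OF that]]
    by (simp_all add: Dom_component Cod_component that)
  ultimately show
    "Cmp (functor_cat C D) t (Ide (functor_cat C D) (Dom (functor_cat C D) t)) = t"
    "Cmp (functor_cat C D) (Ide (functor_cat C D) (Cod (functor_cat C D) t)) t = t"
    unfolding t by (auto cong: restrict_cong)
next
  fix t u v
  assume "t \<in> Arr (functor_cat C D)" "u \<in> Arr (functor_cat C D)" "v \<in> Arr (functor_cat C D)"
    "Cod (functor_cat C D) t = Dom (functor_cat C D) u"
    "Cod (functor_cat C D) u = Dom (functor_cat C D) v"
  then obtain F \<eta> G \<theta> H \<kappa> K where *: "t = (F, \<eta>, G)" "u = (G, \<theta>, H)" "v = (H, \<kappa>, K)"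
    and n: "is_nat_trans C D F G \<eta>" "is_nat_trans C D G H \<theta>" "is_nat_trans C D H K \<kappa>"
    by auto
  interpret e: is_nat_trans C D F G \<eta> by fact
  interpret t: is_nat_trans C D G H \<theta> by fact
  interpret k: is_nat_trans C D H K \<kappa> by fact
  show "Cmp (functor_cat C D) v (Cmp (functor_cat C D) u t) =
      Cmp (functor_cat C D) (Cmp (functor_cat C D) v u) t"
    unfolding * by (auto intro!: restrict_ext e.F.D.Cmp_assoc
        simp: e.component_Arr t.component_Arr k.component_Arr e.Cod_component t.Dom_component
          t.Cod_component k.Dom_component)
qed (auto simp: is_nat_trans_Ide intro: is_nat_trans_Cmp)

text \<open>Componentwise inverses are automatically natural: compose the naturality square of
  \<open>\<eta>\<close> with the inverse components on both sides and cancel.\<close>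

lemma isomorphic_functor_catI:
  assumes "is_nat_trans C D F G \<eta>"
    and inv: "\<And>X. X \<in> Obj C \<Longrightarrow> \<exists>g\<in>Arr D. Dom D g = FO G X \<and> Cod D g = FO F X \<and>
      Cmp D g (\<eta> X) = Ide D (FO F X) \<and> Cmp D (\<eta> X) g = Ide D (FO G X)"
  shows "isomorphic (functor_cat C D) F G"
proof -
  interpret is_nat_trans C D F G \<eta> by fact
  obtain b where b: "\<And>X. X \<in> Obj C \<Longrightarrow> b X \<in> Arr D \<and> Dom D (b X) = FO G X \<and> Cod D (b X) = FO F X \<and>
      Cmp D (b X) (\<eta> X) = Ide D (FO F X) \<and> Cmp D (\<eta> X) (b X) = Ide D (FO G X)"
    using inv by metis
  have nat: "Cmp D (FA F f) (b (Dom C f)) = Cmp D (b (Cod C f)) (FA G f)" if f: "f \<in> Arr C" for f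
  proof -
    let ?X = "Dom C f" and ?Y = "Cod C f"
    have X: "?X \<in> Obj C" and Y: "?Y \<in> Obj C"
      using f by (simp_all add: F.C.Dom_Obj F.C.Cod_Obj)
    note ar = F.D.Cmp_Arr F.D.Dom_Cmp F.D.Cod_Cmp component_Arr F.FA_Arr G.FA_Arr
      Dom_component Cod_component F.Dom_FA F.Cod_FA G.Dom_FA G.Cod_FA b[OF X] b[OF Y] X Y f
    have "Cmp D (b ?Y) (FA G f) = Cmp D (b ?Y) (Cmp D (FA G f) (Cmp D (\<eta> ?X) (b ?X)))"
      using F.D.Cmp_Ide_right[OF G.FA_Arr[OF f]] by (simp add: ar)
    also have "\<dots> = Cmp D (b ?Y) (Cmp D (Cmp D (FA G f) (\<eta> ?X)) (b ?X))"
      by (subst F.D.Cmp_assoc[of "b ?X"]) (simp_all add: ar)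
    also have "\<dots> = Cmp D (b ?Y) (Cmp D (Cmp D (\<eta> ?Y) (FA F f)) (b ?X))"
      using natural[OF f] by simp
    also have "\<dots> = Cmp D (b ?Y) (Cmp D (\<eta> ?Y) (Cmp D (FA F f) (b ?X)))"
      by (subst F.D.Cmp_assoc[of "b ?X"]) (simp_all add: ar)
    also have "\<dots> = Cmp D (Cmp D (b ?Y) (\<eta> ?Y)) (Cmp D (FA F f) (b ?X))"
      by (subst F.D.Cmp_assoc) (simp_all add: ar)
    also have "\<dots> = Cmp D (FA F f) (b ?X)"
      using F.D.Cmp_Ide_left[of "Cmp D (FA F f) (b ?X)"] by (simp add: ar)
    finally show ?thesis by simp
  qed
  have "is_nat_trans C D G F (restrict b (Obj C))"
    by unfold_locales (auto simp: b nat F.C.Dom_Obj F.C.Cod_Obj)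
  moreover have "(\<lambda>X\<in>Obj C. Cmp D (restrict b (Obj C) X) (\<eta> X)) = (\<lambda>X\<in>Obj C. Ide D (FO F X))"
    "(\<lambda>X\<in>Obj C. Cmp D (\<eta> X) (restrict b (Obj C) X)) = (\<lambda>X\<in>Obj C. Ide D (FO G X))"
    by (auto simp: b)
  ultimately show ?thesis
    unfolding isomorphic_def
    using assms(1) F.is_functor_axioms G.is_functor_axioms
    by (intro conjI bexI[of _ "(F, \<eta>, G)"] bexI[of _ "(G, restrict b (Obj C), F)"]) auto
qed

section \<open>Equivalences from fully faithful, essentially surjective functors\<close>

lemma is_functor_id_fctr: "is_category C \<Longrightarrow> is_functor C C (id_fctr C)"
  by (simp add: is_functor_def is_functor_axioms_def id_fctr_def is_category.Dom_Obj
      is_category.Cod_Obj is_category.Ide_Arr is_category.Cmp_Arr)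

lemma is_functor_comp_fctr:
  assumes "is_functor C D F" "is_functor D E G"
  shows "is_functor C E (comp_fctr C G F)"
proof -
  interpret F: is_functor C D F by fact
  interpret G: is_functor D E G by fact
  show ?thesis
    by unfold_locales
      (auto simp: comp_fctr_def compose_def F.FO_Obj F.FA_Arr G.FO_Obj G.FA_Arr
        F.Dom_FA F.Cod_FA F.FA_Ide F.FA_Cmp G.Dom_FA G.Cod_FA G.FA_Ide G.FA_Cmp
        F.C.Dom_Obj F.C.Cod_Obj F.C.Ide_Arr F.C.Cmp_Arr)
qed

text \<open>Choosing for each object of \<open>D\<close> a preimage up to isomorphism defines
  \<open>G\<close> on objects; on arrows it is the unique preimage under \<open>F\<close> of the
  conjugated arrow. Equations between arrows of \<open>C\<close> are then checked after applying the
  faithful \<open>F\<close>.\<close>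

theorem equivalenceI:
  assumes "is_functor C D F"
    and full: "\<And>X Y g. \<lbrakk>X \<in> Obj C; Y \<in> Obj C; g \<in> Arr D; Dom D g = FO F X; Cod D g = FO F Y\<rbrakk>
      \<Longrightarrow> \<exists>f\<in>Arr C. Dom C f = X \<and> Cod C f = Y \<and> FA F f = g"
    and faithful: "\<And>f f'. \<lbrakk>f \<in> Arr C; f' \<in> Arr C; Dom C f = Dom C f'; Cod C f = Cod C f';
      FA F f = FA F f'\<rbrakk> \<Longrightarrow> f = f'"
    and ess_surj: "\<And>Y. Y \<in> Obj D \<Longrightarrow> \<exists>X\<in>Obj C. isomorphic D (FO F X) Y"
  shows "equivalence C D F"
proof -
  interpret is_functor C D F by fact
  \<comment> \<open>The triple bundles a preimage with both halves of the isomorphism, so that a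
    single choice delivers all three consistently.\<close>
  define iso where "iso Y t \<longleftrightarrow> fst t \<in> Obj C \<and>
      fst (snd t) \<in> Arr D \<and> Dom D (fst (snd t)) = FO F (fst t) \<and> Cod D (fst (snd t)) = Y \<and>
      snd (snd t) \<in> Arr D \<and> Cod D (snd (snd t)) = FO F (fst t) \<and> Dom D (snd (snd t)) = Y \<and>
      Cmp D (snd (snd t)) (fst (snd t)) = Ide D (FO F (fst t)) \<and>
      Cmp D (fst (snd t)) (snd (snd t)) = Ide D Y" for Y t
  have "\<exists>t. iso Y t" if Y: "Y \<in> Obj D" for Y
  proof -
    obtain X f g where "X \<in> Obj C" "f \<in> Arr D" "g \<in> Arr D" "Dom D f = FO F X" "Cod D f = Y"
      "Dom D g = Y" "Cod D g = FO F X" "Cmp D g f = Ide D (FO F X)" "Cmp D f g = Ide D Y"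
      using ess_surj[OF Y] unfolding isomorphic_def by blast
    then show ?thesis
      by (intro exI[of _ "(X, f, g)"]) (simp add: iso_def)
  qed
  then obtain t where t: "\<And>Y. Y \<in> Obj D \<Longrightarrow> iso Y (t Y)"
    by metis
  define g0 a b where "g0 Y = fst (t Y)" and "a Y = fst (snd (t Y))" and "b Y = snd (snd (t Y))" for Y
  have g0: "\<And>Y. Y \<in> Obj D \<Longrightarrow> g0 Y \<in> Obj C"
    and a: "\<And>Y. Y \<in> Obj D \<Longrightarrow> a Y \<in> Arr D" "\<And>Y. Y \<in> Obj D \<Longrightarrow> Dom D (a Y) = FO F (g0 Y)"
      "\<And>Y. Y \<in> Obj D \<Longrightarrow> Cod D (a Y) = Y"
    and b: "\<And>Y. Y \<in> Obj D \<Longrightarrow> b Y \<in> Arr D" "\<And>Y. Y \<in> Obj D \<Longrightarrow> Cod D (b Y) = FO F (g0 Y)"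
      "\<And>Y. Y \<in> Obj D \<Longrightarrow> Dom D (b Y) = Y"
    and ba: "\<And>Y. Y \<in> Obj D \<Longrightarrow> Cmp D (b Y) (a Y) = Ide D (FO F (g0 Y))"
    and ab: "\<And>Y. Y \<in> Obj D \<Longrightarrow> Cmp D (a Y) (b Y) = Ide D Y"
    using t unfolding iso_def g0_def a_def b_def by blast+
  define conj where "conj h = Cmp D (b (Cod D h)) (Cmp D h (a (Dom D h)))" for h
  note ar = FO_Obj FA_Arr Dom_FA Cod_FA g0 a b D.Cmp_Arr D.Dom_Cmp D.Cod_Cmp D.Dom_Obj D.Cod_Obj
    C.Dom_Obj C.Cod_Obj C.Cmp_Arr C.Dom_Cmp C.Cod_Cmp
  have conj: "conj h \<in> Arr D" "Dom D (conj h) = FO F (g0 (Dom D h))"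
    "Cod D (conj h) = FO F (g0 (Cod D h))" if "h \<in> Arr D" for h
    unfolding conj_def using that by (simp_all add: ar)
  have "\<exists>f\<in>Arr C. Dom C f = g0 (Dom D h) \<and> Cod C f = g0 (Cod D h) \<and> FA F f = conj h"
    if "h \<in> Arr D" for h
    using full conj[OF that] g0 that by (simp add: ar)
  then obtain ga where ga: "\<And>h. h \<in> Arr D \<Longrightarrow> ga h \<in> Arr C"
      "\<And>h. h \<in> Arr D \<Longrightarrow> Dom C (ga h) = g0 (Dom D h)"
      "\<And>h. h \<in> Arr D \<Longrightarrow> Cod C (ga h) = g0 (Cod D h)"
      "\<And>h. h \<in> Arr D \<Longrightarrow> FA F (ga h) = conj h"
    by metis
  define G where "G = \<lparr>FO = restrict g0 (Obj D), FA = restrict ga (Arr D)\<rparr>"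
  \<comment> \<open>This is naturality of \<open>a\<close>, from \<open>F\<close> after
    \<open>G\<close> to the identity of \<open>D\<close>.\<close>
  have a_ga: "Cmp D (a (Cod D h)) (FA F (ga h)) = Cmp D h (a (Dom D h))" if h: "h \<in> Arr D" for h
  proof -
    have "Cmp D (a (Cod D h)) (FA F (ga h)) =
        Cmp D (Cmp D (a (Cod D h)) (b (Cod D h))) (Cmp D h (a (Dom D h)))"
      using h unfolding ga(4)[OF h] conj_def by (subst D.Cmp_assoc) (simp_all add: ar)
    also have "\<dots> = Cmp D h (a (Dom D h))"
      using h D.Cmp_Ide_left[of "Cmp D h (a (Dom D h))"] by (simp add: ar ab)
    finally show ?thesis .
  qed
  \<comment> \<open>Left cancellation by the isomorphism \<open>a Y\<close>. Together with
    \<open>a_ga\<close> it determines \<open>FA F (ga h)\<close>, which is how the functor laws for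
    \<open>G\<close> are obtained.\<close>
  have a_cancel: "f = f'" if "Y \<in> Obj D" "f \<in> Arr D" "f' \<in> Arr D" "Cod D f = FO F (g0 Y)"
    "Cod D f' = FO F (g0 Y)" "Cmp D (a Y) f = Cmp D (a Y) f'" for Y f f'
  proof -
    have "Cmp D (b Y) (Cmp D (a Y) k) = k" if "k \<in> Arr D" "Cod D k = FO F (g0 Y)" for k
    proof -
      have "Cmp D (b Y) (Cmp D (a Y) k) = Cmp D (Cmp D (b Y) (a Y)) k"
        using that \<open>Y \<in> Obj D\<close> by (subst D.Cmp_assoc) (simp_all add: a b)
      also have "\<dots> = k"
        using that \<open>Y \<in> Obj D\<close> D.Cmp_Ide_left[of k] by (simp add: ba)
      finally show ?thesis .
    qed
    then show ?thesis
      using that by metis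
  qed
  have ga_Ide: "ga (Ide D Y) = Ide C (g0 Y)" if Y: "Y \<in> Obj D" for Y
  proof (rule faithful)
    have "Cmp D (a Y) (FA F (ga (Ide D Y))) = Cmp D (Ide D Y) (a Y)"
      using a_ga[of "Ide D Y"] Y by (simp add: D.Ide_Arr D.Dom_Ide D.Cod_Ide)
    also have "\<dots> = Cmp D (a Y) (Ide D (FO F (g0 Y)))"
      using D.Cmp_Ide_left[of "a Y"] D.Cmp_Ide_right[of "a Y"] Y by (simp add: a)
    finally have eq: "Cmp D (a Y) (FA F (ga (Ide D Y))) = Cmp D (a Y) (Ide D (FO F (g0 Y)))" .
    show "FA F (ga (Ide D Y)) = FA F (Ide C (g0 Y))"
      by (rule a_cancel[OF Y])
        (use Y eq in \<open>simp_all add: FA_Ide g0 FA_Arr ga(1-3) D.Ide_Arr Cod_FA D.Cod_Ide FO_Obj\<close>)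
  qed (use Y in \<open>simp_all add: ga(1-3) D.Ide_Arr D.Dom_Ide D.Cod_Ide C.Ide_Arr C.Dom_Ide C.Cod_Ide g0\<close>)
  have ga_Cmp: "ga (Cmp D k h) = Cmp C (ga k) (ga h)"
    if h: "h \<in> Arr D" and k: "k \<in> Arr D" and hk: "Cod D h = Dom D k" for h k
  proof (rule faithful)
    let ?a = "a (Cod D k)"
    have "Cmp D ?a (FA F (ga (Cmp D k h))) = Cmp D (Cmp D k h) (a (Dom D h))"
      using a_ga[of "Cmp D k h"] h k hk by (simp add: ar)
    also have "\<dots> = Cmp D k (Cmp D h (a (Dom D h)))"
      using h k hk by (subst D.Cmp_assoc) (simp_all add: ar)
    also have "\<dots> = Cmp D k (Cmp D (a (Dom D k)) (FA F (ga h)))"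
      using a_ga[OF h] hk by simp
    also have "\<dots> = Cmp D (Cmp D k (a (Dom D k))) (FA F (ga h))"
      using h k hk by (subst D.Cmp_assoc) (simp_all add: ar ga(1-3))
    also have "\<dots> = Cmp D (Cmp D ?a (FA F (ga k))) (FA F (ga h))"
      using a_ga[OF k] by simp
    also have "\<dots> = Cmp D ?a (Cmp D (FA F (ga k)) (FA F (ga h)))"
      using h k hk by (subst D.Cmp_assoc) (simp_all add: ar ga(1-3))
    also have "Cmp D (FA F (ga k)) (FA F (ga h)) = FA F (Cmp C (ga k) (ga h))"
      using h k hk by (simp add: FA_Cmp ga(1-3))
    finally have eq: "Cmp D ?a (FA F (ga (Cmp D k h))) = Cmp D ?a (FA F (Cmp C (ga k) (ga h)))" .
    show "FA F (ga (Cmp D k h)) = FA F (Cmp C (ga k) (ga h))"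
      by (rule a_cancel[of "Cod D k"])
        (use h k hk eq in \<open>simp_all add: ar ga(1-3)\<close>)
  qed (use h k hk in \<open>simp_all add: ar ga(1-3)\<close>)
  have G: "is_functor D C G"
    unfolding G_def by unfold_locales
      (auto simp: g0 ga(1-3) ga_Ide ga_Cmp ar D.Ide_Arr)
  interpret G: is_functor D C G by (rule G)
  have eps: "isomorphic (functor_cat D D) (comp_fctr D F G) (id_fctr D)"
  proof (rule isomorphic_functor_catI)
    show "is_nat_trans D D (comp_fctr D F G) (id_fctr D) (restrict a (Obj D))"
      unfolding is_nat_trans_def is_nat_trans_axioms_def
      by (intro conjI is_functor_comp_fctr[OF G assms(1)] is_functor_id_fctr D.is_category_axioms)
        (auto simp: comp_fctr_def id_fctr_def G_def compose_def a a_ga D.Dom_Obj D.Cod_Obj)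
    fix Y assume "Y \<in> Obj D"
    then show "\<exists>g\<in>Arr D. Dom D g = FO (id_fctr D) Y \<and> Cod D g = FO (comp_fctr D F G) Y \<and>
        Cmp D g (restrict a (Obj D) Y) = Ide D (FO (comp_fctr D F G) Y) \<and>
        Cmp D (restrict a (Obj D) Y) g = Ide D (FO (id_fctr D) Y)"
      by (intro bexI[of _ "b Y"]) (simp_all add: comp_fctr_def id_fctr_def G_def compose_def b ab ba)
  qed
  \<comment> \<open>The isomorphism \<open>a\<close> at \<open>FO F X\<close> runs between objects
    in the image of \<open>F\<close>, so fullness pulls it back to an arrow \<open>u X\<close> of
    \<open>C\<close>; its inverse \<open>b\<close> is pulled back likewise to
    \<open>v X\<close>.\<close>
  have "\<exists>f\<in>Arr C. Dom C f = g0 (FO F X) \<and> Cod C f = X \<and> FA F f = a (FO F X)"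
    if "X \<in> Obj C" for X
    using that full[of "g0 (FO F X)" X "a (FO F X)"] by (simp add: ar)
  then obtain u where u: "\<And>X. X \<in> Obj C \<Longrightarrow> u X \<in> Arr C"
    "\<And>X. X \<in> Obj C \<Longrightarrow> Dom C (u X) = g0 (FO F X)" "\<And>X. X \<in> Obj C \<Longrightarrow> Cod C (u X) = X"
    "\<And>X. X \<in> Obj C \<Longrightarrow> FA F (u X) = a (FO F X)"
    by metis
  have "\<exists>f\<in>Arr C. Dom C f = X \<and> Cod C f = g0 (FO F X) \<and> FA F f = b (FO F X)"
    if "X \<in> Obj C" for X
    using that full[of X "g0 (FO F X)" "b (FO F X)"] by (simp add: ar)
  then obtain v where v: "\<And>X. X \<in> Obj C \<Longrightarrow> v X \<in> Arr C"
    "\<And>X. X \<in> Obj C \<Longrightarrow> Cod C (v X) = g0 (FO F X)" "\<And>X. X \<in> Obj C \<Longrightarrow> Dom C (v X) = X"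
    "\<And>X. X \<in> Obj C \<Longrightarrow> FA F (v X) = b (FO F X)"
    by metis
  have u_nat: "Cmp C f (u (Dom C f)) = Cmp C (u (Cod C f)) (ga (FA F f))" if f: "f \<in> Arr C" for f
  proof (rule faithful)
    have "FA F (Cmp C f (u (Dom C f))) = Cmp D (FA F f) (a (FO F (Dom C f)))"
      using f by (simp add: FA_Cmp u ar)
    also have "\<dots> = Cmp D (a (FO F (Cod C f))) (FA F (ga (FA F f)))"
      using a_ga[of "FA F f"] f by (simp add: ar)
    also have "\<dots> = FA F (Cmp C (u (Cod C f)) (ga (FA F f)))"
      using f by (simp add: FA_Cmp u ga(1-3) ar)
    finally show "FA F (Cmp C f (u (Dom C f))) = FA F (Cmp C (u (Cod C f)) (ga (FA F f)))" .
  qed (use f in \<open>simp_all add: ar ga(1-3) u(1-3)\<close>)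
  have uv: "Cmp C (v X) (u X) = Ide C (g0 (FO F X))" "Cmp C (u X) (v X) = Ide C X"
    if X: "X \<in> Obj C" for X
  proof -
    show "Cmp C (v X) (u X) = Ide C (g0 (FO F X))"
      by (rule faithful)
        (use X in \<open>simp_all add: u v ar C.Ide_Arr C.Dom_Ide C.Cod_Ide FA_Cmp FA_Ide ba\<close>)
    show "Cmp C (u X) (v X) = Ide C X"
      by (rule faithful)
        (use X in \<open>simp_all add: u v ar C.Ide_Arr C.Dom_Ide C.Cod_Ide FA_Cmp FA_Ide ab\<close>)
  qed
  have "isomorphic (functor_cat C C) (comp_fctr C G F) (id_fctr C)"
  proof (rule isomorphic_functor_catI)
    show "is_nat_trans C C (comp_fctr C G F) (id_fctr C) (restrict u (Obj C))"
      unfolding is_nat_trans_def is_nat_trans_axioms_def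
      by (intro conjI is_functor_comp_fctr[OF assms(1) G] is_functor_id_fctr C.is_category_axioms)
        (auto simp: comp_fctr_def id_fctr_def G_def compose_def u u_nat C.Dom_Obj C.Cod_Obj ar)
    fix X assume "X \<in> Obj C"
    then show "\<exists>g\<in>Arr C. Dom C g = FO (id_fctr C) X \<and> Cod C g = FO (comp_fctr C G F) X \<and>
        Cmp C g (restrict u (Obj C) X) = Ide C (FO (comp_fctr C G F) X) \<and>
        Cmp C (restrict u (Obj C) X) g = Ide C (FO (id_fctr C) X)"
      by (intro bexI[of _ "v X"])
        (simp_all add: comp_fctr_def id_fctr_def G_def compose_def u v uv ar)
  qed
  with eps G assms(1) show ?thesis
    unfolding equivalence_def by blast
qed

section \<open>Presheaves\<close>

lemma Sets_simps [simp]: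
  "Obj (Sets \<S>) = \<S>"
  "Arr (Sets \<S>) = {(A, f, B). A \<in> \<S> \<and> B \<in> \<S> \<and> f \<in> A \<rightarrow>\<^sub>E B}"
  "Dom (Sets \<S>) (A, f, B) = A" "Cod (Sets \<S>) (A, f, B) = B"
  "Ide (Sets \<S>) A = (A, \<lambda>x\<in>A. x, A)"
  "Cmp (Sets \<S>) (B', g, C) (A, f, B) = (A, compose A g f, C)"
  by (simp_all add: Sets_def)

lemma is_category_Sets: "is_category (Sets \<S>)"
proof unfold_locales
  fix f g h assume "f \<in> Arr (Sets \<S>)" "g \<in> Arr (Sets \<S>)" "h \<in> Arr (Sets \<S>)"
    "Cod (Sets \<S>) f = Dom (Sets \<S>) g" "Cod (Sets \<S>) g = Dom (Sets \<S>) h"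
  then obtain A u B v C w D where "f = (A, u, B)" "g = (B, v, C)" "h = (C, w, D)" "u \<in> A \<rightarrow> B"
    by (auto simp: PiE_iff)
  then show "Cmp (Sets \<S>) h (Cmp (Sets \<S>) g f) = Cmp (Sets \<S>) (Cmp (Sets \<S>) h g) f"
    by (simp add: compose_assoc)
next
  fix f assume "f \<in> Arr (Sets \<S>)"
  then obtain A u B where "f = (A, u, B)" "u \<in> A \<rightarrow> B" "u \<in> extensional A"
    by (auto simp: PiE_iff)
  then show "Cmp (Sets \<S>) f (Ide (Sets \<S>) (Dom (Sets \<S>) f)) = f"
    "Cmp (Sets \<S>) (Ide (Sets \<S>) (Cod (Sets \<S>) f)) f = f"
    by (simp_all add: compose_Id Id_compose)
next
  fix f g assume "f \<in> Arr (Sets \<S>)" "g \<in> Arr (Sets \<S>)" "Cod (Sets \<S>) f = Dom (Sets \<S>) g"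
  then obtain A u B v C where "f = (A, u, B)" "g = (B, v, C)" "A \<in> \<S>" "C \<in> \<S>"
    "u \<in> A \<rightarrow> B" "v \<in> B \<rightarrow> C"
    by (auto simp: PiE_iff)
  then show "Cmp (Sets \<S>) g f \<in> Arr (Sets \<S>)"
    "Dom (Sets \<S>) (Cmp (Sets \<S>) g f) = Dom (Sets \<S>) f"
    "Cod (Sets \<S>) (Cmp (Sets \<S>) g f) = Cod (Sets \<S>) g"
    by (auto simp: compose_def PiE_iff)
qed auto

lemma arr_fun_simp [simp]: "arr_fun (A, f, B) = f"
  by (simp add: arr_fun_def)

lemma op_cat_full_subcat: "op_cat (full_subcat C P) = full_subcat (op_cat C) P"
  by (cases C) (auto simp: op_cat_def full_subcat_def)

text \<open>Both sides may be cut down: with \<open>Q = UNIV\<close> this restricts a presheaf, with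
  \<open>Q\<close> given by the sheaf conditions it restricts a functor between presheaf
  categories.\<close>

lemma is_functor_restrict_fctr:
  assumes "is_functor C D F"
    and PQ: "\<And>X. \<lbrakk>X \<in> Obj C; X \<in> P\<rbrakk> \<Longrightarrow> FO F X \<in> Q"
  shows "is_functor (full_subcat C P) (full_subcat D Q) (restrict_fctr (full_subcat C P) F)"
proof -
  interpret is_functor C D F by fact
  interpret C': is_category "full_subcat C P"
    by (rule is_category_full_subcat) (rule C.is_category_axioms)
  interpret D': is_category "full_subcat D Q"
    by (rule is_category_full_subcat) (rule D.is_category_axioms)
  show ?thesis
    by unfold_locales
      (auto simp: restrict_fctr_def FO_Obj FA_Arr Dom_FA Cod_FA FA_Ide FA_Cmp PQ
        C.Dom_Obj C.Cod_Obj C.Ide_Arr C.Dom_Ide C.Cod_Ide C.Cmp_Arr C.Dom_Cmp C.Cod_Cmp)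
qed

lemma full_subcat_UNIV: "full_subcat C UNIV = C"
  by (simp add: full_subcat_def)

lemma is_functor_restrict_fctr_op:
  assumes "is_functor (op_cat C) D F"
  shows "is_functor (op_cat (full_subcat C P)) D (restrict_fctr (full_subcat C P) F)"
proof -
  have "restrict_fctr (full_subcat C P) F = restrict_fctr (full_subcat (op_cat C) P) F"
    unfolding op_cat_full_subcat[symmetric] by (simp add: restrict_fctr_def)
  then show ?thesis
    using is_functor_restrict_fctr[OF assms, of P UNIV]
    by (simp add: full_subcat_UNIV op_cat_full_subcat)
qed

section \<open>Presheaves through their pointwise action\<close>

abbreviation psh :: "'u set set \<Rightarrow> ('o, 'a) cat \<Rightarrow> ('o, 'a, 'u) psh \<Rightarrow> bool" where
  "psh \<S> C F \<equiv> is_functor (op_cat C) (Sets \<S>) F"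

text \<open>Contravariant, since presheaves are functors on \<open>op_cat C\<close>: along
  \<open>f\<close> it maps the value at \<open>Cod C f\<close> to the value at
  \<open>Dom C f\<close>.\<close>

abbreviation act :: "('o, 'a, 'u) psh \<Rightarrow> 'a \<Rightarrow> 'u \<Rightarrow> 'u" where
  "act F f \<equiv> arr_fun (FA F f)"

lemma psh_FO: "\<lbrakk>psh \<S> C F; X \<in> Obj C\<rbrakk> \<Longrightarrow> FO F X \<in> \<S>"
  using is_functor.FO_Obj[of "op_cat C" "Sets \<S>" F X] by simp

text \<open>An arrow of \<open>Sets\<close> carries its domain and codomain, and functoriality fixes
  these, so only \<open>act F f\<close> is left to compare.\<close>

lemma psh_FA:
  assumes "psh \<S> C F" "f \<in> Arr C"
  shows "FA F f = (FO F (Cod C f), act F f, FO F (Dom C f))"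
    and "act F f \<in> FO F (Cod C f) \<rightarrow>\<^sub>E FO F (Dom C f)"
proof -
  interpret is_functor "op_cat C" "Sets \<S>" F by fact
  obtain A h B where *: "FA F f = (A, h, B)"
    by (cases "FA F f")
  then have "A = FO F (Cod C f)" "B = FO F (Dom C f)" "h \<in> A \<rightarrow>\<^sub>E B"
    using Dom_FA[of f] Cod_FA[of f] FA_Arr[of f] assms(2) by simp_all
  with * show "FA F f = (FO F (Cod C f), act F f, FO F (Dom C f))"
    "act F f \<in> FO F (Cod C f) \<rightarrow>\<^sub>E FO F (Dom C f)"
    by simp_all
qed

lemma psh_FA_cases:
  assumes "psh \<S> C F" "f \<in> Arr C"
  obtains h where "FA F f = (FO F (Cod C f), h, FO F (Dom C f))" "act F f = h"
  by (rule that[OF psh_FA(1)[OF assms] refl])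

lemma act_in: "\<lbrakk>psh \<S> C F; f \<in> Arr C; x \<in> FO F (Cod C f)\<rbrakk> \<Longrightarrow> act F f x \<in> FO F (Dom C f)"
  by (rule PiE_mem[OF psh_FA(2)])

lemma act_Ide:
  assumes "psh \<S> C F" "X \<in> Obj C" "x \<in> FO F X"
  shows "act F (Ide C X) x = x"
  using is_functor.FA_Ide[OF assms(1), of X] assms by simp

lemma act_Cmp:
  assumes "psh \<S> C F" "f \<in> Arr C" "g \<in> Arr C" "Cod C f = Dom C g" "x \<in> FO F (Cod C g)"
  shows "act F (Cmp C g f) x = act F f (act F g x)"
proof -
  obtain h where h: "FA F f = (FO F (Cod C f), h, FO F (Dom C f))" "act F f = h"
    using assms(1,2) by (rule psh_FA_cases)
  obtain k where k: "FA F g = (FO F (Cod C g), k, FO F (Dom C g))" "act F g = k"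
    using assms(1,3) by (rule psh_FA_cases)
  have "FA F (Cmp C g f) = Cmp (Sets \<S>) (FA F f) (FA F g)"
    using is_functor.FA_Cmp[OF assms(1), of g f] assms by simp
  then show ?thesis
    using assms(5) by (simp add: h k compose_def)
qed

definition mk_psh :: "('o, 'a) cat \<Rightarrow> ('o \<Rightarrow> 'u set) \<Rightarrow> ('a \<Rightarrow> 'u \<Rightarrow> 'u) \<Rightarrow> ('o, 'a, 'u) psh" where
  "mk_psh C O' a = \<lparr>FO = restrict O' (Obj C),
     FA = (\<lambda>f\<in>Arr C. (O' (Cod C f), restrict (a f) (O' (Cod C f)), O' (Dom C f)))\<rparr>"

lemma mk_psh_FO [simp]: "X \<in> Obj C \<Longrightarrow> FO (mk_psh C O' a) X = O' X"
  by (simp add: mk_psh_def)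

lemma mk_psh_act [simp]: "\<lbrakk>f \<in> Arr C; x \<in> O' (Cod C f)\<rbrakk> \<Longrightarrow> act (mk_psh C O' a) f x = a f x"
  by (simp add: mk_psh_def)

lemma psh_mk_psh:
  assumes "is_category C" and "\<And>X. X \<in> Obj C \<Longrightarrow> O' X \<in> \<S>"
    and "\<And>f x. \<lbrakk>f \<in> Arr C; x \<in> O' (Cod C f)\<rbrakk> \<Longrightarrow> a f x \<in> O' (Dom C f)"
    and "\<And>X x. \<lbrakk>X \<in> Obj C; x \<in> O' X\<rbrakk> \<Longrightarrow> a (Ide C X) x = x"
    and "\<And>f g x. \<lbrakk>f \<in> Arr C; g \<in> Arr C; Cod C f = Dom C g; x \<in> O' (Cod C g)\<rbrakk>
      \<Longrightarrow> a (Cmp C g f) x = a f (a g x)"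
  shows "psh \<S> C (mk_psh C O' a)"
proof -
  interpret is_category C by fact
  interpret op: is_category "op_cat C"
    by (rule is_category_op_cat) fact
  interpret S: is_category "Sets \<S>"
    by (rule is_category_Sets)
  have a: "restrict (a f) (O' (Cod C f)) \<in> O' (Cod C f) \<rightarrow>\<^sub>E O' (Dom C f)" if "f \<in> Arr C" for f
    using assms(3) that by auto
  have a_Ide: "restrict (a (Ide C X)) (O' X) = (\<lambda>x\<in>O' X. x)" if "X \<in> Obj C" for X
    using assms(4) that by auto
  have a_Cmp: "restrict (a (Cmp C g f)) (O' (Cod C g)) =
      compose (O' (Cod C g)) (restrict (a f) (O' (Dom C g))) (restrict (a g) (O' (Cod C g)))"
    if "f \<in> Arr C" "g \<in> Arr C" "Cod C f = Dom C g" for f g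
    using assms(3)[of g] assms(5)[of f g] that by (auto simp: compose_def)
  show ?thesis
    by unfold_locales
      (use a a_Ide a_Cmp assms(2) in \<open>simp_all add: mk_psh_def Dom_Obj Cod_Obj Ide_Arr Dom_Ide Cod_Ide
        Cmp_Arr Dom_Cmp Cod_Cmp PiE_iff\<close>)
qed

definition mk_nat :: "('o, 'a) cat \<Rightarrow> ('o, 'a, 'u) psh \<Rightarrow> ('o, 'a, 'u) psh \<Rightarrow> ('o \<Rightarrow> 'u \<Rightarrow> 'u)
    \<Rightarrow> 'o \<Rightarrow> 'u set_arr" where
  "mk_nat C F G a = (\<lambda>X\<in>Obj C. (FO F X, restrict (a X) (FO F X), FO G X))"

lemma is_nat_trans_mk_nat:
  assumes F: "psh \<S> C F" and G: "psh \<S> C G" and C: "is_category C"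
    and a: "\<And>X x. \<lbrakk>X \<in> Obj C; x \<in> FO F X\<rbrakk> \<Longrightarrow> a X x \<in> FO G X"
    and nat: "\<And>f x. \<lbrakk>f \<in> Arr C; x \<in> FO F (Cod C f)\<rbrakk>
      \<Longrightarrow> act G f (a (Cod C f) x) = a (Dom C f) (act F f x)"
  shows "is_nat_trans (op_cat C) (Sets \<S>) F G (mk_nat C F G a)"
proof -
  interpret is_category C by fact
  have "Cmp (Sets \<S>) (FA G f) (mk_nat C F G a (Cod C f)) =
      Cmp (Sets \<S>) (mk_nat C F G a (Dom C f)) (FA F f)" if f: "f \<in> Arr C" for f
  proof -
    obtain h where h: "FA F f = (FO F (Cod C f), h, FO F (Dom C f))" "act F f = h"
      using F f by (rule psh_FA_cases)
    obtain k where k: "FA G f = (FO G (Cod C f), k, FO G (Dom C f))" "act G f = k"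
      using G f by (rule psh_FA_cases)
    have "compose (FO F (Cod C f)) k (restrict (a (Cod C f)) (FO F (Cod C f))) =
        compose (FO F (Cod C f)) (restrict (a (Dom C f)) (FO F (Dom C f))) h"
      using nat[OF f] act_in[OF F f] by (auto simp: compose_def h(2) k(2))
    then show ?thesis
      using f by (simp add: h(1) k(1) mk_nat_def Dom_Obj Cod_Obj)
  qed
  then show ?thesis
    using assms by (auto simp: is_nat_trans_def is_nat_trans_axioms_def mk_nat_def psh_FO)
qed

lemma is_nat_transD:
  assumes "is_nat_trans (op_cat C) (Sets \<S>) F G \<eta>"
  shows "X \<in> Obj C \<Longrightarrow> \<eta> X = (FO F X, arr_fun (\<eta> X), FO G X)"
    and "X \<in> Obj C \<Longrightarrow> arr_fun (\<eta> X) \<in> FO F X \<rightarrow>\<^sub>E FO G X"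
    and "\<lbrakk>X \<in> Obj C; x \<in> FO F X\<rbrakk> \<Longrightarrow> arr_fun (\<eta> X) x \<in> FO G X"
    and "\<lbrakk>f \<in> Arr C; x \<in> FO F (Cod C f)\<rbrakk>
      \<Longrightarrow> act G f (arr_fun (\<eta> (Cod C f)) x) = arr_fun (\<eta> (Dom C f)) (act F f x)"
proof -
  interpret is_nat_trans "op_cat C" "Sets \<S>" F G \<eta> by fact
  have *: "\<eta> X = (FO F X, arr_fun (\<eta> X), FO G X) \<and> arr_fun (\<eta> X) \<in> FO F X \<rightarrow>\<^sub>E FO G X"
    if "X \<in> Obj C" for X
    using component_Arr[of X] Dom_component[of X] Cod_component[of X] that
    by (cases "\<eta> X") simp
  then show "X \<in> Obj C \<Longrightarrow> \<eta> X = (FO F X, arr_fun (\<eta> X), FO G X)"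
    "X \<in> Obj C \<Longrightarrow> arr_fun (\<eta> X) \<in> FO F X \<rightarrow>\<^sub>E FO G X"
    by simp_all
  then show "\<lbrakk>X \<in> Obj C; x \<in> FO F X\<rbrakk> \<Longrightarrow> arr_fun (\<eta> X) x \<in> FO G X"
    by blast
  assume f: "f \<in> Arr C" and x: "x \<in> FO F (Cod C f)"
  have ob: "Cod C f \<in> Obj C" "Dom C f \<in> Obj C"
    using F.C.Dom_Obj[of f] F.C.Cod_Obj[of f] f by simp_all
  have "Cmp (Sets \<S>) (FA G f) (\<eta> (Cod C f)) = Cmp (Sets \<S>) (\<eta> (Dom C f)) (FA F f)"
    using natural[of f] f by simp
  moreover obtain h where h: "FA F f = (FO F (Cod C f), h, FO F (Dom C f))" "act F f = h"
    using F.is_functor_axioms f by (rule psh_FA_cases)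
  moreover obtain k where k: "FA G f = (FO G (Cod C f), k, FO G (Dom C f))" "act G f = k"
    using G.is_functor_axioms f by (rule psh_FA_cases)
  moreover obtain l where l: "\<eta> (Cod C f) = (FO F (Cod C f), l, FO G (Cod C f))"
    using *[OF ob(1)] by blast
  moreover obtain m where m: "\<eta> (Dom C f) = (FO F (Dom C f), m, FO G (Dom C f))"
    using *[OF ob(2)] by blast
  ultimately have "compose (FO F (Cod C f)) k l x = compose (FO F (Cod C f)) m h x"
    by simp
  then show "act G f (arr_fun (\<eta> (Cod C f)) x) = arr_fun (\<eta> (Dom C f)) (act F f x)"
    using x by (simp add: compose_def h k l m)
qed

lemma nat_trans_eqI:
  assumes "is_nat_trans (op_cat C) (Sets \<S>) F G \<eta>" "is_nat_trans (op_cat C) (Sets \<S>) F G \<theta>"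
    and "\<And>X x. \<lbrakk>X \<in> Obj C; x \<in> FO F X\<rbrakk> \<Longrightarrow> arr_fun (\<eta> X) x = arr_fun (\<theta> X) x"
  shows "\<eta> = \<theta>"
proof (rule PiE_ext)
  show "\<eta> \<in> Obj C \<rightarrow>\<^sub>E Arr (Sets \<S>)" "\<theta> \<in> Obj C \<rightarrow>\<^sub>E Arr (Sets \<S>)"
    using assms(1,2)[THEN is_nat_trans.component_PiE] by simp_all
  fix X assume X: "X \<in> Obj C"
  have "arr_fun (\<eta> X) = arr_fun (\<theta> X)"
    by (rule PiE_ext[OF is_nat_transD(2)[OF assms(1) X] is_nat_transD(2)[OF assms(2) X]])
      (rule assms(3)[OF X])
  then show "\<eta> X = \<theta> X"
    using is_nat_transD(1)[OF assms(1) X] is_nat_transD(1)[OF assms(2) X] by simp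
qed

lemma isomorphic_pshI:
  assumes F: "psh \<S> C F" and G: "psh \<S> C G" and C: "is_category C"
    and bij: "\<And>X. X \<in> Obj C \<Longrightarrow> bij_betw (a X) (FO F X) (FO G X)"
    and nat: "\<And>f x. \<lbrakk>f \<in> Arr C; x \<in> FO F (Cod C f)\<rbrakk>
      \<Longrightarrow> act G f (a (Cod C f) x) = a (Dom C f) (act F f x)"
  shows "isomorphic (PSh \<S> C) F G"
  unfolding PSh_def
proof (rule isomorphic_functor_catI)
  show "is_nat_trans (op_cat C) (Sets \<S>) F G (mk_nat C F G a)"
    by (rule is_nat_trans_mk_nat[OF F G C _ nat]) (use bij in \<open>auto dest: bij_betwE\<close>)
  fix X assume "X \<in> Obj (op_cat C)"
  then have X: "X \<in> Obj C" by simp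
  define b where "b = restrict (inv_into (FO F X) (a X)) (FO G X)"
  have "b \<in> FO G X \<rightarrow>\<^sub>E FO F X" and ba: "\<And>x. x \<in> FO F X \<Longrightarrow> b (a X x) = x"
    and ab: "\<And>y. y \<in> FO G X \<Longrightarrow> a X (b y) = y" and a: "\<And>x. x \<in> FO F X \<Longrightarrow> a X x \<in> FO G X"
    using bij[OF X] by (auto simp: b_def bij_betw_def inv_into_into f_inv_into_f)
  then show "\<exists>g\<in>Arr (Sets \<S>). Dom (Sets \<S>) g = FO G X \<and> Cod (Sets \<S>) g = FO F X \<and>
      Cmp (Sets \<S>) g (mk_nat C F G a X) = Ide (Sets \<S>) (FO F X) \<and>
      Cmp (Sets \<S>) (mk_nat C F G a X) g = Ide (Sets \<S>) (FO G X)"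
    using X F G
    by (intro bexI[of _ "(FO G X, b, FO F X)"])
      (auto simp: mk_nat_def psh_FO compose_def fun_eq_iff PiE_iff)
qed

lemma isomorphic_full_subcat:
  assumes "isomorphic C X Y" "X \<in> P" "Y \<in> P"
  shows "isomorphic (full_subcat C P) X Y"
proof -
  obtain f g where "X \<in> Obj C" "Y \<in> Obj C" "f \<in> Arr C" "g \<in> Arr C" "Dom C f = X" "Cod C f = Y"
    "Dom C g = Y" "Cod C g = X" "Cmp C g f = Ide C X" "Cmp C f g = Ide C Y"
    using assms(1) unfolding isomorphic_def by blast
  with assms(2,3) show ?thesis
    unfolding isomorphic_def by (intro conjI bexI[of _ f] bexI[of _ g]) simp_all
qed

lemma psh_restrict_simps [simp]:
  "X \<in> Obj B \<Longrightarrow> FO (restrict_fctr B F) X = FO F X"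
  "f \<in> Arr B \<Longrightarrow> FA (restrict_fctr B F) f = FA F f"
  by (simp_all add: restrict_fctr_def)

lemma coproduct_sym: "coproduct C i j \<Longrightarrow> coproduct C j i"
  unfolding coproduct_def by (smt (verit))

section \<open>Extending presheaves from projective objects\<close>

lemma bij_betw_ex1: "\<lbrakk>bij_betw f A B; b \<in> B\<rbrakk> \<Longrightarrow> \<exists>!a. a \<in> A \<and> f a = b"
  unfolding bij_betw_def inj_on_def by blast

text \<open>\<open>u\<close> and \<open>k\<close> form the corner of a pullback of \<open>g\<close>
  along \<open>i\<close> as seen by test objects in \<open>P\<close>, with existence of the
  factorization \<open>c\<close> but no uniqueness. An equation between values that holds at the
  corner passes to every test pair by acting with \<open>c\<close>.\<close>

definition weak_pullback_on ::
  "('o, 'a) cat \<Rightarrow> 'o set \<Rightarrow> 'a \<Rightarrow> 'a \<Rightarrow> 'a \<Rightarrow> 'a \<Rightarrow> bool" where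
  "weak_pullback_on C P i g u k \<longleftrightarrow> u \<in> Arr C \<and> k \<in> Arr C \<and> Dom C u \<in> P \<and> Dom C k = Dom C u \<and>
     Cod C u = Dom C g \<and> Cod C k = Dom C i \<and> Cmp C g u = Cmp C i k \<and>
     (\<forall>r\<in>Arr C. \<forall>s\<in>Arr C. Dom C r \<in> P \<and> Dom C s = Dom C r \<and> Cod C r = Dom C g \<and>
        Cod C s = Dom C i \<and> Cmp C g r = Cmp C i s \<longrightarrow>
        (\<exists>c\<in>Arr C. Dom C c = Dom C r \<and> Cod C c = Dom C u \<and> Cmp C u c = r \<and> Cmp C k c = s))"

text \<open>What the comparison takes from compact Hausdorff spaces, with \<open>P\<close> the
  objects beta S. The last four assumptions tie coproducts in the subcategory to those of
  \<open>C\<close> in both directions: universal cocones over \<open>P\<close> stay universal, and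
  arrows from \<open>P\<close> into an initial object or a coproduct decompose within
  \<open>P\<close>.\<close>

locale projective_site = is_category C for C :: "('o, 'a) cat" +
  fixes P :: "'o set"
  assumes P_Obj: "X \<in> P \<Longrightarrow> X \<in> Obj C"
    and enough_projectives: "X \<in> Obj C \<Longrightarrow> \<exists>e. epi C e \<and> Dom C e \<in> P \<and> Cod C e = X"
    and projective: "\<lbrakk>epi C f; g \<in> Arr C; Dom C g \<in> P; Cod C g = Cod C f\<rbrakk>
      \<Longrightarrow> \<exists>l\<in>Arr C. Dom C l = Dom C g \<and> Cod C l = Dom C f \<and> Cmp C f l = g"
    and kernel_pair: "epi C f \<Longrightarrow> \<exists>p q. pullback C f f p q"
    and initial_from_P: "initial (full_subcat C P) X \<Longrightarrow> initial C X"
    and coproduct_from_P: "coproduct (full_subcat C P) i j \<Longrightarrow> coproduct C i j"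
    and initial_strict: "\<lbrakk>initial C X; f \<in> Arr C; Dom C f \<in> P; Cod C f = X\<rbrakk>
      \<Longrightarrow> initial (full_subcat C P) (Dom C f)"
    and coproduct_decompose: "\<lbrakk>coproduct C i j; g \<in> Arr C; Dom C g \<in> P; Cod C g = Cod C i\<rbrakk>
      \<Longrightarrow> \<exists>u v k l. coproduct (full_subcat C P) u v \<and> Cod C u = Dom C g \<and>
        weak_pullback_on C P i g u k \<and> weak_pullback_on C P j g v l"
begin

abbreviation B :: "('o, 'a) cat" where
  "B \<equiv> full_subcat C P"

lemmas arrow_simps = Cmp_Arr Dom_Cmp Cod_Cmp Dom_Obj Cod_Obj Ide_Arr Dom_Ide Cod_Ide P_Obj

lemma is_category_B: "is_category B"
  by (rule is_category_full_subcat) (rule is_category_axioms)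

lemma epi_Arr: "epi C f \<Longrightarrow> f \<in> Arr C"
  by (simp add: epi_def)

section \<open>Descent along covers by projective objects\<close>

definition cover :: "'o \<Rightarrow> 'a" where
  "cover X = (SOME e. epi C e \<and> Dom C e \<in> P \<and> Cod C e = X)"

lemma cover:
  assumes "X \<in> Obj C"
  shows "epi C (cover X)" "cover X \<in> Arr C" "Dom C (cover X) \<in> P" "Cod C (cover X) = X"
  using someI_ex[OF enough_projectives[OF assms]] by (simp_all add: cover_def epi_Arr)

text \<open>\<open>epi_descent\<close> says something about \<open>f\<close> only in the presence of
  a kernel pair, hence the appeal to \<open>kernel_pair\<close>.\<close>

lemma descent_inj:
  assumes "epi_descent C F" "epi C f" "x \<in> FO F (Cod C f)" "y \<in> FO F (Cod C f)"
    "act F f x = act F f y"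
  shows "x = y"
proof -
  obtain p q where "pullback C f f p q"
    using kernel_pair[OF assms(2)] by blast
  then have "inj_on (act F f) (FO F (Cod C f))"
    using assms(1,2) unfolding epi_descent_def bij_betw_def by blast
  then show ?thesis
    using assms(5,3,4) by (rule inj_onD)
qed

lemma descent_surj:
  assumes "epi_descent C F" "epi C f" "y \<in> FO F (Dom C f)" "pullback C f f p q"
    "act F p y = act F q y"
  obtains x where "x \<in> FO F (Cod C f)" "act F f x = y"
proof -
  have "act F f ` FO F (Cod C f) = {y \<in> FO F (Dom C f). act F p y = act F q y}"
    using assms(1,2,4) unfolding epi_descent_def bij_betw_def by blast
  then have "y \<in> act F f ` FO F (Cod C f)"
    using assms(3,5) by simp
  then show ?thesis
    using that by blast
qed

text \<open>The value at \<open>X\<close> is forced: along the cover of \<open>X\<close> it must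
  become \<open>a\<close> applied to the pulled back element. Descent for \<open>G\<close> turns
  this requirement into an element of \<open>FO G X\<close>.\<close>

lemma extend_nat:
  assumes F: "psh \<S> C F" and G: "psh \<S> C G" and desc: "epi_descent C G"
    and a: "\<And>X x. \<lbrakk>X \<in> P; x \<in> FO F X\<rbrakk> \<Longrightarrow> a X x \<in> FO G X"
    and nat: "\<And>f x. \<lbrakk>f \<in> Arr C; Dom C f \<in> P; Cod C f \<in> P; x \<in> FO F (Cod C f)\<rbrakk>
      \<Longrightarrow> act G f (a (Cod C f) x) = a (Dom C f) (act F f x)"
  obtains b where "\<And>X x. \<lbrakk>X \<in> Obj C; x \<in> FO F X\<rbrakk> \<Longrightarrow> b X x \<in> FO G X"
    and "\<And>f x. \<lbrakk>f \<in> Arr C; x \<in> FO F (Cod C f)\<rbrakk>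
      \<Longrightarrow> act G f (b (Cod C f) x) = b (Dom C f) (act F f x)"
    and "\<And>X x. \<lbrakk>X \<in> P; x \<in> FO F X\<rbrakk> \<Longrightarrow> b X x = a X x"
proof -
  note act_F = act_in[OF F] and act_G = act_in[OF G]
  have "\<exists>y. y \<in> FO G X \<and> act G (cover X) y = a (Dom C (cover X)) (act F (cover X) x)"
    if X: "X \<in> Obj C" and x: "x \<in> FO F X" for X x
  proof -
    define e where "e = cover X"
    have e: "epi C e" "e \<in> Arr C" "Dom C e \<in> P" "Cod C e = X"
      using cover[OF X] by (simp_all add: e_def)
    obtain p q where pq: "pullback C e e p q"
      using kernel_pair[OF e(1)] by blast
    then have p: "p \<in> Arr C" "Cod C p = Dom C e" and q: "q \<in> Arr C" "Cod C q = Dom C e"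
      and pq_eq: "Dom C p = Dom C q" "Cmp C e p = Cmp C e q"
      by (simp_all add: pullback_def)
    \<comment> \<open>The domain of the kernel pair need not lie in \<open>P\<close>, where
      \<open>a\<close> is natural. Covering it once more by \<open>k\<close> brings the comparison
      into \<open>P\<close>, and \<open>act G k\<close> is injective by descent.\<close>
    define k where "k = cover (Dom C p)"
    have k: "epi C k" "k \<in> Arr C" "Dom C k \<in> P" "Cod C k = Dom C p"
      using cover[of "Dom C p"] p by (simp_all add: k_def Dom_Obj)
    let ?t = "a (Dom C e) (act F e x)"
    have ex: "act F e x \<in> FO F (Dom C e)"
      using act_F e x by simp
    then have t: "?t \<in> FO G (Dom C e)"
      using a e by simp
    have *: "act G k (act G r ?t) = a (Dom C k) (act F (Cmp C e (Cmp C r k)) x)"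
      if "r \<in> Arr C" "Cod C r = Dom C e" "Dom C r = Dom C p" for r
    proof -
      have "act G k (act G r ?t) = act G (Cmp C r k) ?t"
        using that k t by (simp add: act_Cmp[OF G])
      also have "\<dots> = a (Dom C k) (act F (Cmp C r k) (act F e x))"
        using nat[of "Cmp C r k" "act F e x"] that k e ex by (simp add: arrow_simps)
      also have "act F (Cmp C r k) (act F e x) = act F (Cmp C e (Cmp C r k)) x"
        using that k e x by (simp add: act_Cmp[OF F] arrow_simps)
      finally show ?thesis .
    qed
    have "Cmp C e (Cmp C p k) = Cmp C e (Cmp C q k)"
      using p q e k pq_eq by (simp add: Cmp_assoc)
    then have "act G k (act G p ?t) = act G k (act G q ?t)"
      using *[of p] *[of q] p q pq_eq by simp
    then have "act G p ?t = act G q ?t"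
      using descent_inj[OF desc k(1)] act_G[OF p(1)] act_G[OF q(1)] t k p q pq_eq by simp
    then obtain y where "y \<in> FO G (Cod C e)" "act G e y = ?t"
      using descent_surj[OF desc e(1) t pq] by blast
    then show ?thesis
      using e by (auto simp: e_def)
  qed
  then obtain b where b: "\<And>X x. \<lbrakk>X \<in> Obj C; x \<in> FO F X\<rbrakk> \<Longrightarrow> b X x \<in> FO G X"
    "\<And>X x. \<lbrakk>X \<in> Obj C; x \<in> FO F X\<rbrakk>
      \<Longrightarrow> act G (cover X) (b X x) = a (Dom C (cover X)) (act F (cover X) x)"
    by metis
  \<comment> \<open>Any arrow from \<open>P\<close> into \<open>X\<close> factors through the cover
    of \<open>X\<close> by projectivity, so the equation that defines \<open>b\<close> at the cover
    holds along every such arrow.\<close>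
  have b_slice: "act G f (b (Cod C f) x) = a (Dom C f) (act F f x)"
    if f: "f \<in> Arr C" "Dom C f \<in> P" and x: "x \<in> FO F (Cod C f)" for f x
  proof -
    let ?X = "Cod C f"
    define e where "e = cover ?X"
    have e: "epi C e" "e \<in> Arr C" "Dom C e \<in> P" "Cod C e = ?X"
      using cover[of ?X] f by (simp_all add: e_def Cod_Obj)
    obtain l where l: "l \<in> Arr C" "Dom C l = Dom C f" "Cod C l = Dom C e" "Cmp C e l = f"
      using projective[OF e(1) f] e(4) by auto
    have bX: "b ?X x \<in> FO G ?X" "act G e (b ?X x) = a (Dom C e) (act F e x)"
      using b[of ?X x] f x by (simp_all add: Cod_Obj e_def)
    have "act G f (b ?X x) = act G l (act G e (b ?X x))"
      using act_Cmp[OF G l(1) e(2), of "b ?X x"] l e bX by simp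
    also have "\<dots> = a (Dom C l) (act F l (act F e x))"
      using nat[of l "act F e x"] bX l e f act_F[OF e(2), of x] x by simp
    also have "act F l (act F e x) = act F f x"
      using act_Cmp[OF F l(1) e(2), of x] l e x by simp
    finally show ?thesis
      using l by simp
  qed
  show ?thesis
  proof
    show "b X x \<in> FO G X" if "X \<in> Obj C" "x \<in> FO F X" for X x
      using b that by blast
    \<comment> \<open>On an object of \<open>P\<close> the identity is itself an admissible arrow in
      \<open>b_slice\<close>.\<close>
    show "b X x = a X x" if "X \<in> P" "x \<in> FO F X" for X x
      using b_slice[of "Ide C X" x] b(1)[of X x] that
      by (simp add: arrow_simps act_Ide[OF F] act_Ide[OF G])
    fix f x assume f: "f \<in> Arr C" and x: "x \<in> FO F (Cod C f)"
    define e where "e = cover (Dom C f)"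
    have e: "epi C e" "e \<in> Arr C" "Dom C e \<in> P" "Cod C e = Dom C f"
      using cover[of "Dom C f"] f by (simp_all add: e_def Dom_Obj)
    have fx: "act F f x \<in> FO F (Dom C f)"
      using act_F f x by blast
    have bx: "b (Cod C f) x \<in> FO G (Cod C f)" "b (Dom C f) (act F f x) \<in> FO G (Dom C f)"
      using b(1) f x fx by (simp_all add: arrow_simps)
    \<comment> \<open>Naturality is tested after the cover of \<open>Dom C f\<close>: there both
      sides are instances of \<open>b_slice\<close>, and descent removes the cover.\<close>
    have "act G e (act G f (b (Cod C f) x)) = act G (Cmp C f e) (b (Cod C f) x)"
      using f e bx by (simp add: act_Cmp[OF G])
    also have "\<dots> = a (Dom C e) (act F (Cmp C f e) x)"
      using b_slice[of "Cmp C f e" x] f e x by (simp add: arrow_simps)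
    also have "act F (Cmp C f e) x = act F e (act F f x)"
      using f e x by (simp add: act_Cmp[OF F])
    also have "a (Dom C e) (act F e (act F f x)) = act G e (b (Dom C f) (act F f x))"
      using b_slice[of e "act F f x"] e fx by simp
    finally show "act G f (b (Cod C f) x) = b (Dom C f) (act F f x)"
      using descent_inj[OF desc e(1)] act_G[OF f bx(1)] bx(2) e(4) by simp
  qed
qed

text \<open>A component at \<open>X\<close> is visible after acting along the cover of
  \<open>X\<close>, whose domain lies in \<open>P\<close>, and descent for the target makes that
  action injective.\<close>

lemma nat_eq_if_eq_on_P:
  assumes F: "psh \<S> C F" and G: "psh \<S> C G" and desc: "epi_descent C G"
    and \<eta>: "is_nat_trans (op_cat C) (Sets \<S>) F G \<eta>"
    and \<theta>: "is_nat_trans (op_cat C) (Sets \<S>) F G \<theta>"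
    and eq: "\<And>X. X \<in> P \<Longrightarrow> \<eta> X = \<theta> X"
  shows "\<eta> = \<theta>"
proof (rule nat_trans_eqI[OF \<eta> \<theta>])
  fix X x assume X: "X \<in> Obj C" and x: "x \<in> FO F X"
  note e = cover[OF X]
  have "act G (cover X) (arr_fun (\<eta> X) x) = act G (cover X) (arr_fun (\<theta> X) x)"
    using is_nat_transD(4)[OF \<eta> e(2), of x] is_nat_transD(4)[OF \<theta> e(2), of x] e eq x by simp
  then show "arr_fun (\<eta> X) x = arr_fun (\<theta> X) x"
    using descent_inj[OF desc e(1)] e(4) is_nat_transD(3)[OF \<eta> X x] is_nat_transD(3)[OF \<theta> X x]
    by simp
qed

section \<open>Right Kan extension from the projective objects\<close>

definition lift :: "'a \<Rightarrow> 'a" where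
  "lift f = (SOME l. l \<in> Arr C \<and> Dom C l = Dom C f \<and> Cod C l = Dom C (cover (Cod C f)) \<and>
     Cmp C (cover (Cod C f)) l = f)"

lemma lift:
  assumes "f \<in> Arr C" "Dom C f \<in> P"
  shows "lift f \<in> Arr C" "Dom C (lift f) = Dom C f" "Cod C (lift f) = Dom C (cover (Cod C f))"
    "Cmp C (cover (Cod C f)) (lift f) = f"
proof -
  have "\<exists>l. l \<in> Arr C \<and> Dom C l = Dom C f \<and> Cod C l = Dom C (cover (Cod C f)) \<and>
      Cmp C (cover (Cod C f)) l = f"
    using projective[of "cover (Cod C f)" f] cover[of "Cod C f"] assms by (auto simp: Cod_Obj)
  from someI_ex[OF this] show "lift f \<in> Arr C" "Dom C (lift f) = Dom C f"
    "Cod C (lift f) = Dom C (cover (Cod C f))" "Cmp C (cover (Cod C f)) (lift f) = f"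
    by (simp_all add: lift_def)
qed

text \<open>
  \<open>ext_obj F X\<close> is a copy, inside \<open>FO F\<close> of the chosen cover of \<open>X\<close>, of the set of natural
  transformations from the representable presheaf of \<open>X\<close>, restricted to \<open>P\<close>, to \<open>F\<close>; such a
  transformation is determined by its value at the cover. \<open>ev F f s\<close> is the value at \<open>f\<close> of the
  transformation represented by \<open>s\<close>.
\<close>

definition ext_obj :: "('o, 'a, 'u) psh \<Rightarrow> 'o \<Rightarrow> 'u set" where
  "ext_obj F X = {s \<in> FO F (Dom C (cover X)). \<forall>p\<in>Arr C. \<forall>q\<in>Arr C.
     Dom C p \<in> P \<and> Dom C q = Dom C p \<and> Cod C p = Dom C (cover X) \<and> Cod C q = Dom C (cover X) \<and>
     Cmp C (cover X) p = Cmp C (cover X) q \<longrightarrow> act F p s = act F q s}"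

definition ev :: "('o, 'a, 'u) psh \<Rightarrow> 'a \<Rightarrow> 'u \<Rightarrow> 'u" where
  "ev F f s = act F (lift f) s"

text \<open>Precomposition with \<open>h\<close> of the transformation coded by \<open>s\<close>,
  coded again by its value at the cover of \<open>Dom C h\<close>.\<close>

definition ext_act :: "('o, 'a, 'u) psh \<Rightarrow> 'a \<Rightarrow> 'u \<Rightarrow> 'u" where
  "ext_act F h s = ev F (Cmp C h (cover (Dom C h))) s"

definition ext :: "('o, 'a, 'u) psh \<Rightarrow> ('o, 'a, 'u) psh" where
  "ext F = mk_psh C (ext_obj F) (ext_act F)"

context
  fixes \<S> :: "'u set set" and F :: "('o, 'a, 'u) psh"
  assumes F: "psh \<S> B F"
begin

lemma F_act_in: "\<lbrakk>f \<in> Arr C; Dom C f \<in> P; Cod C f \<in> P; x \<in> FO F (Cod C f)\<rbrakk>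
    \<Longrightarrow> act F f x \<in> FO F (Dom C f)"
  using act_in[OF F, of f x] by simp

lemma F_act_Cmp: "\<lbrakk>f \<in> Arr C; g \<in> Arr C; Cod C f = Dom C g; Dom C f \<in> P; Dom C g \<in> P; Cod C g \<in> P;
    x \<in> FO F (Cod C g)\<rbrakk> \<Longrightarrow> act F (Cmp C g f) x = act F f (act F g x)"
  using act_Cmp[OF F, of f g x] by simp

lemma F_act_Ide: "\<lbrakk>X \<in> P; x \<in> FO F X\<rbrakk> \<Longrightarrow> act F (Ide C X) x = x"
  using act_Ide[OF F, of X x] by (simp add: P_Obj)

lemma ext_objD:
  assumes "s \<in> ext_obj F X"
  shows "s \<in> FO F (Dom C (cover X))"
    and "\<lbrakk>p \<in> Arr C; q \<in> Arr C; Dom C p \<in> P; Dom C q = Dom C p; Cod C p = Dom C (cover X);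
      Cod C q = Dom C (cover X); Cmp C (cover X) p = Cmp C (cover X) q\<rbrakk>
      \<Longrightarrow> act F p s = act F q s"
  using assms unfolding ext_obj_def by blast+

text \<open>The choice made in \<open>lift\<close> is harmless: two lifts of the same arrow agree
  over \<open>X\<close>, and membership in \<open>ext_obj F X\<close> says that such arrows act
  equally on \<open>s\<close>.\<close>

lemma ev_lift:
  assumes "l \<in> Arr C" "Dom C l \<in> P" "Cod C l = Dom C (cover X)" "X \<in> Obj C" "s \<in> ext_obj F X"
  shows "ev F (Cmp C (cover X) l) s = act F l s"
proof -
  note e = cover[OF assms(4)]
  let ?f = "Cmp C (cover X) l"
  have f: "?f \<in> Arr C" "Dom C ?f = Dom C l" "Cod C ?f = X"
    using assms e by (simp_all add: arrow_simps)
  then have "lift ?f \<in> Arr C" "Dom C (lift ?f) = Dom C l" "Cod C (lift ?f) = Dom C (cover X)"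
      "Cmp C (cover X) (lift ?f) = ?f"
    using lift[of ?f] assms(2) by simp_all
  then show ?thesis
    unfolding ev_def using assms by (intro ext_objD(2)) simp_all
qed

lemma ev_in:
  assumes "f \<in> Arr C" "Dom C f \<in> P" "s \<in> ext_obj F (Cod C f)"
  shows "ev F f s \<in> FO F (Dom C f)"
  using F_act_in[of "lift f" s] lift[OF assms(1,2)] cover[of "Cod C f"] assms ext_objD(1)[OF assms(3)]
  by (simp add: ev_def Cod_Obj)

text \<open>Naturality of the coded transformation: \<open>Cmp C (lift f) b\<close> is a lift of
  \<open>Cmp C f b\<close>, so \<open>ev_lift\<close> applies to it.\<close>

lemma ev_Cmp:
  assumes f: "f \<in> Arr C" "Dom C f \<in> P" "s \<in> ext_obj F (Cod C f)"
    and b: "b \<in> Arr C" "Dom C b \<in> P" "Cod C b = Dom C f"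
  shows "ev F (Cmp C f b) s = act F b (ev F f s)"
proof -
  note l = lift[OF f(1,2)]
  have X: "Cod C f \<in> Obj C"
    using f by (simp add: Cod_Obj)
  note e = cover[OF X]
  have "Cmp C f b = Cmp C (Cmp C (cover (Cod C f)) (lift f)) b"
    using l by simp
  also have "\<dots> = Cmp C (cover (Cod C f)) (Cmp C (lift f) b)"
    using l e b by (simp add: Cmp_assoc)
  finally have "ev F (Cmp C f b) s = act F (Cmp C (lift f) b) s"
    using ev_lift[of "Cmp C (lift f) b" "Cod C f" s] l b f X by (simp add: arrow_simps)
  also have "\<dots> = act F b (act F (lift f) s)"
    using l b f e ext_objD(1)[OF f(3)] by (intro F_act_Cmp) simp_all
  finally show ?thesis
    by (simp add: ev_def)
qed

lemma ev_cover:
  assumes "X \<in> Obj C" "s \<in> ext_obj F X"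
  shows "ev F (cover X) s = s"
proof -
  note e = cover[OF assms(1)]
  have "ev F (Cmp C (cover X) (Ide C (Dom C (cover X)))) s = act F (Ide C (Dom C (cover X))) s"
    using assms e by (intro ev_lift) (simp_all add: arrow_simps)
  then show ?thesis
    using e assms ext_objD(1)[OF assms(2)] by (simp add: Cmp_Ide_right F_act_Ide)
qed

text \<open>The code is recovered as the value at the cover, so the values along all arrows from
  \<open>P\<close> determine it.\<close>

lemma ext_obj_eqI:
  assumes "X \<in> Obj C" "s \<in> ext_obj F X" "t \<in> ext_obj F X"
    and "\<And>f. \<lbrakk>f \<in> Arr C; Dom C f \<in> P; Cod C f = X\<rbrakk> \<Longrightarrow> ev F f s = ev F f t"
  shows "s = t"
  using assms(4)[of "cover X"] cover[OF assms(1)] ev_cover assms(1-3) by simp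

text \<open>The converse of \<open>ext_obj_eqI\<close>, in the style of Yoneda: a compatible family
  is coded by its member at the cover. From here on elements are built from families and compared
  through \<open>ev\<close>.\<close>

lemma ext_obj_family:
  assumes X: "X \<in> Obj C"
    and w: "\<And>f. \<lbrakk>f \<in> Arr C; Dom C f \<in> P; Cod C f = X\<rbrakk> \<Longrightarrow> w f \<in> FO F (Dom C f)"
    and w_Cmp: "\<And>f b. \<lbrakk>f \<in> Arr C; Dom C f \<in> P; Cod C f = X; b \<in> Arr C; Dom C b \<in> P; Cod C b = Dom C f\<rbrakk>
      \<Longrightarrow> w (Cmp C f b) = act F b (w f)"
  obtains s where "s \<in> ext_obj F X"
    "\<And>f. \<lbrakk>f \<in> Arr C; Dom C f \<in> P; Cod C f = X\<rbrakk> \<Longrightarrow> ev F f s = w f"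
proof
  note e = cover[OF X]
  show "w (cover X) \<in> ext_obj F X"
    unfolding ext_obj_def
  proof (intro CollectI conjI ballI impI)
    show "w (cover X) \<in> FO F (Dom C (cover X))"
      using w e by blast
    fix p q assume "p \<in> Arr C" "q \<in> Arr C" and "Dom C p \<in> P \<and> Dom C q = Dom C p \<and>
      Cod C p = Dom C (cover X) \<and> Cod C q = Dom C (cover X) \<and> Cmp C (cover X) p = Cmp C (cover X) q"
    then show "act F p (w (cover X)) = act F q (w (cover X))"
      using w_Cmp[of "cover X" p] w_Cmp[of "cover X" q] e by simp
  qed
  fix f assume f: "f \<in> Arr C" "Dom C f \<in> P" "Cod C f = X"
  then show "ev F f (w (cover X)) = w f"
    using w_Cmp[of "cover X" "lift f"] lift[OF f(1,2)] e by (simp add: ev_def)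
qed

text \<open>The family that sends \<open>f\<close> to the value of \<open>s\<close> at
  \<open>Cmp C h f\<close> is natural, hence coded by some \<open>t\<close>; evaluating
  \<open>t\<close> at the cover shows that \<open>t\<close> is \<open>ext_act F h s\<close>.\<close>

lemma ext_act:
  assumes h: "h \<in> Arr C" and s: "s \<in> ext_obj F (Cod C h)"
  shows ext_act_in: "ext_act F h s \<in> ext_obj F (Dom C h)"
    and ev_ext_act: "\<And>f. \<lbrakk>f \<in> Arr C; Dom C f \<in> P; Cod C f = Dom C h\<rbrakk>
      \<Longrightarrow> ev F f (ext_act F h s) = ev F (Cmp C h f) s"
proof -
  have X: "Dom C h \<in> Obj C"
    using h by (simp add: Dom_Obj)
  note e = cover[OF X]
  obtain t where t: "t \<in> ext_obj F (Dom C h)"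
    "\<And>f. \<lbrakk>f \<in> Arr C; Dom C f \<in> P; Cod C f = Dom C h\<rbrakk> \<Longrightarrow> ev F f t = ev F (Cmp C h f) s"
  proof (rule ext_obj_family[OF X, of "\<lambda>f. ev F (Cmp C h f) s"])
    fix f assume f: "f \<in> Arr C" "Dom C f \<in> P" "Cod C f = Dom C h"
    show "ev F (Cmp C h f) s \<in> FO F (Dom C f)"
      using ev_in[of "Cmp C h f" s] f h s by (simp add: arrow_simps)
    fix b assume b: "b \<in> Arr C" "Dom C b \<in> P" "Cod C b = Dom C f"
    show "ev F (Cmp C h (Cmp C f b)) s = act F b (ev F (Cmp C h f) s)"
      using ev_Cmp[of "Cmp C h f" s b] f h s b by (simp add: arrow_simps Cmp_assoc)
  qed blast
  have "ext_act F h s = t"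
    using t(2)[of "cover (Dom C h)"] e ev_cover[OF X t(1)] by (simp add: ext_act_def)
  with t show "ext_act F h s \<in> ext_obj F (Dom C h)"
    "\<And>f. \<lbrakk>f \<in> Arr C; Dom C f \<in> P; Cod C f = Dom C h\<rbrakk>
      \<Longrightarrow> ev F f (ext_act F h s) = ev F (Cmp C h f) s"
    by simp_all
qed

text \<open>By \<open>ev_ext_act\<close> the action is precomposition, so the functor laws reduce to
  those of composition in \<open>C\<close>. Closure under subsets keeps the values in
  \<open>\<S>\<close>, as \<open>ext_obj F X\<close> sits inside a value of
  \<open>F\<close>.\<close>

lemma psh_ext:
  assumes "\<And>A A'. \<lbrakk>A \<in> \<S>; A' \<subseteq> A\<rbrakk> \<Longrightarrow> A' \<in> \<S>"
  shows "psh \<S> C (ext F)"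
  unfolding ext_def
proof (rule psh_mk_psh[OF is_category_axioms])
  fix X assume X: "X \<in> Obj C"
  have "FO F (Dom C (cover X)) \<in> \<S>"
    using psh_FO[OF F] cover[OF X] by (simp add: P_Obj)
  then show "ext_obj F X \<in> \<S>"
    by (rule assms) (auto simp: ext_obj_def)
  fix s assume s: "s \<in> ext_obj F X"
  have "s \<in> ext_obj F (Cod C (Ide C X))"
    using X s by (simp add: arrow_simps)
  note s' = ext_act[OF Ide_Arr[OF X] this]
  show "ext_act F (Ide C X) s = s"
  proof (rule ext_obj_eqI[OF X _ s])
    show "ext_act F (Ide C X) s \<in> ext_obj F X"
      using s'(1) X by (simp add: arrow_simps)
    show "ev F f (ext_act F (Ide C X) s) = ev F f s"
      if "f \<in> Arr C" "Dom C f \<in> P" "Cod C f = X" for f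
      using s'(2)[of f] that X Cmp_Ide_left[of f] by (simp add: arrow_simps)
  qed
next
  show "ext_act F f s \<in> ext_obj F (Dom C f)" if "f \<in> Arr C" "s \<in> ext_obj F (Cod C f)" for f s
    using ext_act_in that .
next
  fix f g s assume f: "f \<in> Arr C" and g: "g \<in> Arr C" and fg: "Cod C f = Dom C g"
    and s: "s \<in> ext_obj F (Cod C g)"
  have gs: "ext_act F g s \<in> ext_obj F (Cod C f)"
    using ext_act_in[OF g s] fg by simp
  have s': "s \<in> ext_obj F (Cod C (Cmp C g f))" and gf: "Cmp C g f \<in> Arr C"
    using f g fg s by (simp_all add: arrow_simps)
  show "ext_act F (Cmp C g f) s = ext_act F f (ext_act F g s)"
  proof (rule ext_obj_eqI)
    show "Dom C f \<in> Obj C"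
      using f by (simp add: Dom_Obj)
    show "ext_act F (Cmp C g f) s \<in> ext_obj F (Dom C f)"
      using ext_act_in[OF gf s'] f g fg by (simp add: arrow_simps)
    show "ext_act F f (ext_act F g s) \<in> ext_obj F (Dom C f)"
      using ext_act_in[OF f gs] .
    show "ev F k (ext_act F (Cmp C g f) s) = ev F k (ext_act F f (ext_act F g s))"
      if k: "k \<in> Arr C" "Dom C k \<in> P" "Cod C k = Dom C f" for k
      using ev_ext_act[OF gf s', of k] ev_ext_act[OF f gs, of k] ev_ext_act[OF g s, of "Cmp C f k"]
        k f g fg by (simp add: arrow_simps Cmp_assoc)
  qed
qed

lemma ext_FO: "X \<in> Obj C \<Longrightarrow> FO (ext F) X = ext_obj F X"
  by (simp add: ext_def)

lemma ext_actE: "\<lbrakk>h \<in> Arr C; s \<in> ext_obj F (Cod C h)\<rbrakk> \<Longrightarrow> act (ext F) h s = ext_act F h s"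
  by (simp add: ext_def)

text \<open>An element over \<open>Dom C f\<close> with equal images under \<open>p\<close> and
  \<open>q\<close> is evaluated at \<open>g\<close> by lifting \<open>g\<close> through the
  epimorphism \<open>f\<close>; the kernel pair makes the result independent of the lift.\<close>

lemma epi_descent_ext: "epi_descent C (ext F)"
  unfolding epi_descent_def
proof (intro allI impI)
  fix f p q assume "epi C f \<and> pullback C f f p q"
  then have epi: "epi C f" and pb: "pullback C f f p q"
    by simp_all
  have f: "f \<in> Arr C" and p: "p \<in> Arr C" "Cod C p = Dom C f"
    and q: "q \<in> Arr C" "Cod C q = Dom C f" and pq: "Dom C p = Dom C q" "Cmp C f p = Cmp C f q"
    using pb by (simp_all add: pullback_def)
  have ob: "Cod C f \<in> Obj C" "Dom C f \<in> Obj C" "Dom C q \<in> Obj C"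
    using f q by (simp_all add: arrow_simps)
  have factor: "\<exists>h\<in>Arr C. Dom C h = Dom C r \<and> Cod C h = Dom C p \<and> Cmp C p h = r \<and> Cmp C q h = s"
    if "r \<in> Arr C" "s \<in> Arr C" "Dom C r = Dom C s" "Cod C r = Dom C f" "Cod C s = Dom C f"
      "Cmp C f r = Cmp C f s" for r s
    using pb that unfolding pullback_def by blast
  have inj: "s = t" if s: "s \<in> ext_obj F (Cod C f)" and t: "t \<in> ext_obj F (Cod C f)"
    and eq: "ext_act F f s = ext_act F f t" for s t
  proof (rule ext_obj_eqI[OF ob(1) s t])
    fix g assume g: "g \<in> Arr C" "Dom C g \<in> P" "Cod C g = Cod C f"
    obtain l where l: "l \<in> Arr C" "Dom C l = Dom C g" "Cod C l = Dom C f" "Cmp C f l = g"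
      using projective[OF epi g] by blast
    then show "ev F g s = ev F g t"
      using ev_ext_act[OF f s, of l] ev_ext_act[OF f t, of l] g eq by simp
  qed
  have eq_pq: "ext_act F p (ext_act F f s) = ext_act F q (ext_act F f s)"
    if s: "s \<in> ext_obj F (Cod C f)" for s
  proof -
    have fs: "ext_act F f s \<in> ext_obj F (Dom C f)"
      using ext_act_in[OF f s] .
    have "ext_act F p (ext_act F f s) \<in> ext_obj F (Dom C q)"
      "ext_act F q (ext_act F f s) \<in> ext_obj F (Dom C q)"
      using ext_act_in[of p] ext_act_in[of q] p q pq fs by simp_all
    then show ?thesis
    proof (rule ext_obj_eqI[OF ob(3)])
      fix k assume k: "k \<in> Arr C" "Dom C k \<in> P" "Cod C k = Dom C q"
      have "Cmp C f (Cmp C p k) = Cmp C f (Cmp C q k)"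
        using f p q pq k by (simp add: Cmp_assoc)
      then show "ev F k (ext_act F p (ext_act F f s)) = ev F k (ext_act F q (ext_act F f s))"
        using ev_ext_act[of p "ext_act F f s" k] ev_ext_act[of q "ext_act F f s" k] fs p q pq k
          ev_ext_act[OF f s, of "Cmp C p k"] ev_ext_act[OF f s, of "Cmp C q k"]
        by (simp add: arrow_simps)
    qed
  qed
  have surj: "\<exists>s\<in>ext_obj F (Cod C f). ext_act F f s = y"
    if y: "y \<in> ext_obj F (Dom C f)" and eq: "ext_act F p y = ext_act F q y" for y
  proof -
    have "\<exists>l\<in>Arr C. Dom C l = Dom C g \<and> Cod C l = Dom C f \<and> Cmp C f l = g"
      if "g \<in> Arr C" "Dom C g \<in> P" "Cod C g = Cod C f" for g
      using projective[OF epi that] .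
    \<comment> \<open>\<open>m g\<close> is a chosen lift of \<open>g\<close>. The choices need not
      be compatible with composition, which \<open>indep\<close> makes up for.\<close>
    then obtain m where m: "\<And>g. \<lbrakk>g \<in> Arr C; Dom C g \<in> P; Cod C g = Cod C f\<rbrakk> \<Longrightarrow>
        m g \<in> Arr C \<and> Dom C (m g) = Dom C g \<and> Cod C (m g) = Dom C f \<and> Cmp C f (m g) = g"
      by metis
    have indep: "ev F r y = ev F r' y"
      if r: "r \<in> Arr C" "Dom C r \<in> P" "Cod C r = Dom C f" "r' \<in> Arr C" "Dom C r' = Dom C r"
        "Cod C r' = Dom C f" "Cmp C f r = Cmp C f r'" for r r'
    proof -
      \<comment> \<open>Two lifts of one arrow form a cone over the kernel pair, and
        \<open>y\<close> has equal images along \<open>p\<close> and \<open>q\<close>.\<close>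
      obtain h where h: "h \<in> Arr C" "Dom C h = Dom C r" "Cod C h = Dom C p" "Cmp C p h = r"
        "Cmp C q h = r'"
        using factor[of r r'] r by auto
      show ?thesis
        using ev_ext_act[of p y h] ev_ext_act[of q y h] h r p q pq y eq by simp
    qed
    obtain s where s: "s \<in> ext_obj F (Cod C f)"
      "\<And>g. \<lbrakk>g \<in> Arr C; Dom C g \<in> P; Cod C g = Cod C f\<rbrakk> \<Longrightarrow> ev F g s = ev F (m g) y"
    proof (rule ext_obj_family[OF ob(1), of "\<lambda>g. ev F (m g) y"])
      fix g assume g: "g \<in> Arr C" "Dom C g \<in> P" "Cod C g = Cod C f"
      show "ev F (m g) y \<in> FO F (Dom C g)"
        using ev_in[of "m g" y] m[OF g] g y by simp
      fix b assume b: "b \<in> Arr C" "Dom C b \<in> P" "Cod C b = Dom C g"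
      have gb: "Cmp C g b \<in> Arr C" "Dom C (Cmp C g b) \<in> P" "Cod C (Cmp C g b) = Cod C f"
        using g b by (simp_all add: arrow_simps)
      have "Cmp C f (Cmp C (m g) b) = Cmp C g b"
        using m[OF g] b f by (simp add: Cmp_assoc)
      then have "ev F (m (Cmp C g b)) y = ev F (Cmp C (m g) b) y"
        using m[OF gb] m[OF g] g b f by (intro indep) (simp_all add: arrow_simps)
      also have "\<dots> = act F b (ev F (m g) y)"
        using m[OF g] g b y by (intro ev_Cmp) simp_all
      finally show "ev F (m (Cmp C g b)) y = act F b (ev F (m g) y)" .
    qed blast
    have "ext_act F f s = y"
    proof (rule ext_obj_eqI[OF ob(2) ext_act_in[OF f s(1)] y])
      fix r assume r: "r \<in> Arr C" "Dom C r \<in> P" "Cod C r = Dom C f"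
      have fr: "Cmp C f r \<in> Arr C" "Dom C (Cmp C f r) \<in> P" "Cod C (Cmp C f r) = Cod C f"
        using f r by (simp_all add: arrow_simps)
      have "ev F (m (Cmp C f r)) y = ev F r y"
        using m[OF fr] r f by (intro indep) (simp_all add: arrow_simps)
      then show "ev F r (ext_act F f s) = ev F r y"
        using ev_ext_act[OF f s(1) r] s(2)[OF fr] by simp
    qed
    with s(1) show ?thesis by blast
  qed
  have A: "act (ext F) f s = ext_act F f s" if "s \<in> ext_obj F (Cod C f)" for s
    using that by (rule ext_actE[OF f])
  have A': "act (ext F) p y = ext_act F p y" "act (ext F) q y = ext_act F q y"
    if "y \<in> ext_obj F (Dom C f)" for y
    using ext_actE[of p y] ext_actE[of q y] that p q by simp_all
  show "bij_betw (act (ext F) f) (FO (ext F) (Cod C f))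
      {y \<in> FO (ext F) (Dom C f). act (ext F) p y = act (ext F) q y}"
    unfolding bij_betw_def ext_FO[OF ob(1)] ext_FO[OF ob(2)]
  proof (intro conjI inj_onI set_eqI iffI)
    fix s t assume "s \<in> ext_obj F (Cod C f)" "t \<in> ext_obj F (Cod C f)"
      "act (ext F) f s = act (ext F) f t"
    then show "s = t"
      using inj by (simp add: A)
  next
    fix y assume "y \<in> act (ext F) f ` ext_obj F (Cod C f)"
    then obtain s where s: "s \<in> ext_obj F (Cod C f)" "y = act (ext F) f s"
      by blast
    then have "y = ext_act F f s"
      by (simp add: A)
    then show "y \<in> {y \<in> ext_obj F (Dom C f). act (ext F) p y = act (ext F) q y}"
      using ext_act_in[OF f s(1)] eq_pq[OF s(1)] A'[of y] by simp
  next
    fix y assume "y \<in> {y \<in> ext_obj F (Dom C f). act (ext F) p y = act (ext F) q y}"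
    then have y: "y \<in> ext_obj F (Dom C f)" "ext_act F p y = ext_act F q y"
      using A'[of y] by simp_all
    then obtain s where "s \<in> ext_obj F (Cod C f)" "ext_act F f s = y"
      using surj by blast
    then show "y \<in> act (ext F) f ` ext_obj F (Cod C f)"
      using A by (metis imageI)
  qed
qed

text \<open>An arrow from \<open>P\<close> into a coproduct decomposes its domain, and by the
  product condition for \<open>F\<close> a value at that arrow amounts to values on the two pieces.
  Over an initial object all values lie in one-element sets.\<close>

lemma coproducts_to_products_ext:
  assumes cop: "coproducts_to_products B F"
  shows "coproducts_to_products C (ext F)"
  unfolding coproducts_to_products_def
proof (intro conjI allI impI)
  fix X assume ini: "initial C X"
  then have X: "X \<in> Obj C"
    by (simp add: initial_def)
  have single: "is_singleton (FO F (Dom C f))" if "f \<in> Arr C" "Dom C f \<in> P" "Cod C f = X" for f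
    using cop initial_strict[OF ini that] unfolding coproducts_to_products_def by blast
  have unique: "x = y" if "f \<in> Arr C" "Dom C f \<in> P" "Cod C f = X" "x \<in> FO F (Dom C f)"
    "y \<in> FO F (Dom C f)" for f x y
    using single[OF that(1-3)] that(4,5) by (auto elim!: is_singletonE)
  have the_elem: "the_elem (FO F (Dom C f)) \<in> FO F (Dom C f)"
    if f: "f \<in> Arr C" "Dom C f \<in> P" "Cod C f = X" for f
  proof -
    obtain a where "FO F (Dom C f) = {a}"
      using single[OF f] by (rule is_singletonE)
    then show ?thesis by simp
  qed
  \<comment> \<open>The compatibility conditions on this family compare elements of one-element
    sets.\<close>
  obtain s where s: "s \<in> ext_obj F X"
  proof (rule ext_obj_family[OF X, of "\<lambda>f. the_elem (FO F (Dom C f))"])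
    show "the_elem (FO F (Dom C f)) \<in> FO F (Dom C f)"
      if "f \<in> Arr C" "Dom C f \<in> P" "Cod C f = X" for f
      using the_elem that .
    fix f b assume f: "f \<in> Arr C" "Dom C f \<in> P" "Cod C f = X"
      and b: "b \<in> Arr C" "Dom C b \<in> P" "Cod C b = Dom C f"
    have fb: "Cmp C f b \<in> Arr C" "Dom C (Cmp C f b) = Dom C b" "Cod C (Cmp C f b) = X"
      using f b by (simp_all add: arrow_simps)
    show "the_elem (FO F (Dom C (Cmp C f b))) = act F b (the_elem (FO F (Dom C f)))"
      using the_elem[OF fb(1)] fb b the_elem[OF f] f
      by (intro unique[OF fb(1)] ) (simp_all add: F_act_in)
  qed blast
  have "t = s" if t: "t \<in> ext_obj F X" for t
  proof (rule ext_obj_eqI[OF X t s])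
    fix f assume f: "f \<in> Arr C" "Dom C f \<in> P" "Cod C f = X"
    show "ev F f t = ev F f s"
      using ev_in[of f t] ev_in[of f s] f t s by (intro unique[OF f]) simp_all
  qed
  with s show "is_singleton (FO (ext F) X)"
    unfolding ext_FO[OF X] by (intro is_singletonI') auto
next
  fix i j assume ij: "coproduct C i j"
  then have i: "i \<in> Arr C" and j: "j \<in> Arr C" and ij_Cod: "Cod C j = Cod C i"
    by (simp_all add: coproduct_def)
  have ob: "Cod C i \<in> Obj C" "Dom C i \<in> Obj C" "Dom C j \<in> Obj C"
    using i j by (simp_all add: arrow_simps)
  have bij_uv: "bij_betw (\<lambda>x. (act F u x, act F v x)) (FO F (Cod C u)) (FO F (Dom C u) \<times> FO F (Dom C v))"
    if "coproduct B u v" for u v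
    using cop[unfolded coproducts_to_products_def, THEN conjunct2, rule_format, OF that] by simp
  have inj: "s = t" if s: "s \<in> ext_obj F (Cod C i)" and t: "t \<in> ext_obj F (Cod C i)"
    and eq_i: "ext_act F i s = ext_act F i t" and eq_j: "ext_act F j s = ext_act F j t" for s t
  proof (rule ext_obj_eqI[OF ob(1) s t])
    fix g assume g: "g \<in> Arr C" "Dom C g \<in> P" "Cod C g = Cod C i"
    obtain u v k l where uv: "coproduct B u v" "Cod C u = Dom C g" "weak_pullback_on C P i g u k"
      "weak_pullback_on C P j g v l"
      using coproduct_decompose[OF ij g] by blast
    have u: "u \<in> Arr C" "Dom C u \<in> P" "k \<in> Arr C" "Dom C k = Dom C u" "Cod C k = Dom C i"
      "Cmp C g u = Cmp C i k"
      and v: "v \<in> Arr C" "Dom C v \<in> P" "l \<in> Arr C" "Dom C l = Dom C v" "Cod C l = Dom C j"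
      "Cmp C g v = Cmp C j l" "Cod C v = Dom C g"
      using uv(3,4) by (simp_all add: weak_pullback_on_def)
    have s': "s \<in> ext_obj F (Cod C j)" and t': "t \<in> ext_obj F (Cod C j)"
      using s t ij_Cod by simp_all
    \<comment> \<open>Along \<open>u\<close> the arrow \<open>g\<close> runs through
      \<open>i\<close>, so the value there depends only on \<open>ext_act F i s\<close>; the same
      holds for \<open>v\<close> and \<open>j\<close>.\<close>
    have "act F u (ev F g s) = act F u (ev F g t)"
      using ev_Cmp[of g s u] ev_Cmp[of g t u] ev_ext_act[OF i s, of k] ev_ext_act[OF i t, of k]
        eq_i s t g u uv(2) by simp
    moreover have "act F v (ev F g s) = act F v (ev F g t)"
      using ev_Cmp[of g s v] ev_Cmp[of g t v] ev_ext_act[OF j s', of l] ev_ext_act[OF j t', of l]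
        eq_j s t g v by simp
    moreover have "inj_on (\<lambda>x. (act F u x, act F v x)) (FO F (Dom C g))"
      using bij_uv[OF uv(1)] uv(2) by (simp add: bij_betw_def)
    ultimately show "ev F g s = ev F g t"
      using ev_in[of g s] ev_in[of g t] g s t by (auto dest: inj_onD)
  qed
  have surj: "\<exists>s\<in>ext_obj F (Cod C i). ext_act F i s = x \<and> ext_act F j s = y"
    if x: "x \<in> ext_obj F (Dom C i)" and y: "y \<in> ext_obj F (Dom C j)" for x y
  proof -
    \<comment> \<open>\<open>R m z g w\<close> says that \<open>w\<close>, as a candidate value at
      \<open>g\<close>, matches \<open>z\<close> wherever \<open>g\<close> runs through
      \<open>m\<close>. It mentions no chosen decomposition and therefore passes along composition,
      as \<open>R_Cmp\<close> shows; by \<open>R_weak_pullback\<close> a single corner suffices to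
      check it.\<close>
    define R where "R m z g w \<longleftrightarrow> (\<forall>c\<in>Arr C. \<forall>d\<in>Arr C. Dom C c \<in> P \<and> Cod C c = Dom C g \<and>
      Dom C d = Dom C c \<and> Cod C d = Dom C m \<and> Cmp C g c = Cmp C m d \<longrightarrow> act F c w = ev F d z)"
      for m z g w
    have R_weak_pullback: "R m z g w \<longleftrightarrow> act F u w = ev F k z"
      if pb: "weak_pullback_on C P m g u k" and g: "g \<in> Arr C" "Dom C g \<in> P"
        and w: "w \<in> FO F (Dom C g)" and z: "z \<in> ext_obj F (Dom C m)" for m z g w u k
    proof
      have u: "u \<in> Arr C" "Dom C u \<in> P" "k \<in> Arr C" "Dom C k = Dom C u" "Cod C k = Dom C m"
        "Cmp C g u = Cmp C m k" "Cod C u = Dom C g"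
        using pb by (simp_all add: weak_pullback_on_def)
      then show "act F u w = ev F k z" if "R m z g w"
        using that unfolding R_def by blast
      assume eq: "act F u w = ev F k z"
      show "R m z g w"
        unfolding R_def
      proof (intro ballI impI)
        fix r s assume r: "r \<in> Arr C" and s: "s \<in> Arr C" and rs: "Dom C r \<in> P \<and> Cod C r = Dom C g \<and>
          Dom C s = Dom C r \<and> Cod C s = Dom C m \<and> Cmp C g r = Cmp C m s"
        obtain c where c: "c \<in> Arr C" "Dom C c = Dom C r" "Cod C c = Dom C u" "Cmp C u c = r"
          "Cmp C k c = s"
          using pb r s rs unfolding weak_pullback_on_def by metis
        have "act F r w = act F c (act F u w)"
          using F_act_Cmp[of c u w] c u g w rs by simp
        also have "\<dots> = ev F s z"
          using ev_Cmp[of k z c] c u eq z rs by simp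
        finally show "act F r w = ev F s z" .
      qed
    qed
    have R_Cmp: "R m z (Cmp C g b) (act F b w)"
      if "R m z g w" "g \<in> Arr C" "Dom C g \<in> P" "w \<in> FO F (Dom C g)" "b \<in> Arr C" "Dom C b \<in> P"
        "Cod C b = Dom C g" for m z g w b
      unfolding R_def
    proof (intro ballI impI)
      fix c d assume c: "c \<in> Arr C" and d: "d \<in> Arr C" and cd: "Dom C c \<in> P \<and> Cod C c = Dom C (Cmp C g b) \<and>
        Dom C d = Dom C c \<and> Cod C d = Dom C m \<and> Cmp C (Cmp C g b) c = Cmp C m d"
      have "act F c (act F b w) = act F (Cmp C b c) w"
        using F_act_Cmp[of c b w] that c cd by (simp add: arrow_simps)
      moreover have "Cmp C g (Cmp C b c) = Cmp C m d"
        using cd that c by (simp add: arrow_simps Cmp_assoc)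
      ultimately show "act F c (act F b w) = ev F d z"
        using that(1) c d cd that unfolding R_def by (simp add: arrow_simps)
    qed
    \<comment> \<open>On a decomposition of \<open>Dom C g\<close> the two conditions become
      equations along \<open>u\<close> and \<open>v\<close>, and the product condition for
      \<open>F\<close> solves them uniquely.\<close>
    have ex1: "\<exists>!w. w \<in> FO F (Dom C g) \<and> R i x g w \<and> R j y g w"
      if g: "g \<in> Arr C" "Dom C g \<in> P" "Cod C g = Cod C i" for g
    proof -
      obtain u v k l where uv: "coproduct B u v" "Cod C u = Dom C g" "weak_pullback_on C P i g u k"
        "weak_pullback_on C P j g v l"
        using coproduct_decompose[OF ij g] by blast
      have kl: "ev F k x \<in> FO F (Dom C u)" "ev F l y \<in> FO F (Dom C v)"
        using uv(3,4) x y ev_in[of k x] ev_in[of l y] unfolding weak_pullback_on_def by simp_all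
      have "bij_betw (\<lambda>w. (act F u w, act F v w)) (FO F (Dom C g)) (FO F (Dom C u) \<times> FO F (Dom C v))"
        using bij_uv[OF uv(1)] uv(2) by simp
      then have "\<exists>!w. w \<in> FO F (Dom C g) \<and> (act F u w, act F v w) = (ev F k x, ev F l y)"
        using kl by (intro bij_betw_ex1) auto
      then show ?thesis
        using R_weak_pullback[OF uv(3) g(1,2) _ x] R_weak_pullback[OF uv(4) g(1,2) _ y]
        by (simp cong: conj_cong)
    qed
    define W where "W g = (THE w. w \<in> FO F (Dom C g) \<and> R i x g w \<and> R j y g w)" for g
    have W: "W g \<in> FO F (Dom C g) \<and> R i x g (W g) \<and> R j y g (W g)"
      if "g \<in> Arr C" "Dom C g \<in> P" "Cod C g = Cod C i" for g
      unfolding W_def by (rule theI'[OF ex1[OF that]])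
    obtain s where s: "s \<in> ext_obj F (Cod C i)"
      "\<And>g. \<lbrakk>g \<in> Arr C; Dom C g \<in> P; Cod C g = Cod C i\<rbrakk> \<Longrightarrow> ev F g s = W g"
    proof (rule ext_obj_family[OF ob(1), of W])
      fix g assume g: "g \<in> Arr C" "Dom C g \<in> P" "Cod C g = Cod C i"
      show "W g \<in> FO F (Dom C g)"
        using W[OF g] by blast
      fix b assume b: "b \<in> Arr C" "Dom C b \<in> P" "Cod C b = Dom C g"
      have gb: "Cmp C g b \<in> Arr C" "Dom C (Cmp C g b) \<in> P" "Cod C (Cmp C g b) = Cod C i"
        using g b by (simp_all add: arrow_simps)
      have "act F b (W g) \<in> FO F (Dom C (Cmp C g b))"
        using F_act_in[of b "W g"] W[OF g] g b by (simp add: arrow_simps)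
      moreover have "R i x (Cmp C g b) (act F b (W g))" "R j y (Cmp C g b) (act F b (W g))"
        using W[OF g] R_Cmp g b by blast+
      \<comment> \<open>Compatibility of \<open>W\<close> comes from uniqueness: the restricted
        value satisfies the conditions that characterize \<open>W\<close> at the composite.\<close>
      ultimately show "W (Cmp C g b) = act F b (W g)"
        using W[OF gb] ex1[OF gb] by blast
    qed blast
    have s_act: "ext_act F m s = z" if m: "m \<in> Arr C" "Cod C m = Cod C i" and z: "z \<in> ext_obj F (Dom C m)"
      and R: "\<And>g. \<lbrakk>g \<in> Arr C; Dom C g \<in> P; Cod C g = Cod C i\<rbrakk> \<Longrightarrow> R m z g (W g)" for m z
    proof (rule ext_obj_eqI)
      have s': "s \<in> ext_obj F (Cod C m)"
        using s m by simp
      show "Dom C m \<in> Obj C" "z \<in> ext_obj F (Dom C m)" "ext_act F m s \<in> ext_obj F (Dom C m)"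
        using m z ext_act_in[OF m(1) s'] by (simp_all add: Dom_Obj)
      fix f assume f: "f \<in> Arr C" "Dom C f \<in> P" "Cod C f = Dom C m"
      have mf: "Cmp C m f \<in> Arr C" "Dom C (Cmp C m f) = Dom C f" "Cod C (Cmp C m f) = Cod C i"
        using m f by (simp_all add: arrow_simps)
      have id: "Cmp C (Cmp C m f) (Ide C (Dom C f)) = Cmp C m f"
        using Cmp_Ide_right[OF mf(1)] mf(2) by simp
      have "R m z (Cmp C m f) (W (Cmp C m f))"
        using R mf f by simp
      moreover have "Ide C (Dom C f) \<in> Arr C" "Dom C (Ide C (Dom C f)) = Dom C f"
        "Cod C (Ide C (Dom C f)) = Dom C f"
        using f by (simp_all add: arrow_simps)
      \<comment> \<open>\<open>R\<close> is used with \<open>c\<close> the identity and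
        \<open>d = f\<close>.\<close>
      ultimately have "act F (Ide C (Dom C f)) (W (Cmp C m f)) = ev F f z"
        using f mf id unfolding R_def by metis
      moreover have "act F (Ide C (Dom C f)) (W (Cmp C m f)) = W (Cmp C m f)"
        using F_act_Ide[of "Dom C f"] W[of "Cmp C m f"] f mf by simp
      ultimately show "ev F f (ext_act F m s) = ev F f z"
        using ev_ext_act[OF m(1) s' f] s(2)[of "Cmp C m f"] mf f by simp
    qed
    have "ext_act F i s = x" "ext_act F j s = y"
      using s_act[OF i _ x] s_act[OF j _ y] W ij_Cod by blast+
    with s(1) show ?thesis by blast
  qed
  have A: "act (ext F) i s = ext_act F i s" "act (ext F) j s = ext_act F j s"
    "ext_act F i s \<in> ext_obj F (Dom C i)" "ext_act F j s \<in> ext_obj F (Dom C j)"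
    if "s \<in> ext_obj F (Cod C i)" for s
    using that ext_actE[OF i] ext_actE[OF j] ext_act_in[OF i] ext_act_in[OF j] ij_Cod by simp_all
  show "bij_betw (\<lambda>x. (act (ext F) i x, act (ext F) j x)) (FO (ext F) (Cod C i))
      (FO (ext F) (Dom C i) \<times> FO (ext F) (Dom C j))"
    unfolding bij_betw_def ext_FO[OF ob(1)] ext_FO[OF ob(2)] ext_FO[OF ob(3)]
  proof (intro conjI inj_onI set_eqI iffI)
    fix s t assume "s \<in> ext_obj F (Cod C i)" "t \<in> ext_obj F (Cod C i)"
      "(act (ext F) i s, act (ext F) j s) = (act (ext F) i t, act (ext F) j t)"
    then show "s = t"
      using inj A by simp
  next
    fix z assume "z \<in> (\<lambda>x. (act (ext F) i x, act (ext F) j x)) ` ext_obj F (Cod C i)"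
    then show "z \<in> ext_obj F (Dom C i) \<times> ext_obj F (Dom C j)"
      using A by auto
  next
    fix z assume "z \<in> ext_obj F (Dom C i) \<times> ext_obj F (Dom C j)"
    then obtain s where "s \<in> ext_obj F (Cod C i)" "z = (ext_act F i s, ext_act F j s)"
      using surj by force
    then show "z \<in> (\<lambda>x. (act (ext F) i x, act (ext F) j x)) ` ext_obj F (Cod C i)"
      using A by (intro image_eqI[of _ _ s]) simp_all
  qed
qed

text \<open>For \<open>X\<close> in \<open>P\<close> this is the Yoneda bijection: a transformation
  out of the representable presheaf of \<open>X\<close> is determined by its value at the identity,
  and every value occurs.\<close>

lemma ext_restrict_isomorphic:
  assumes sub: "\<And>A A'. \<lbrakk>A \<in> \<S>; A' \<subseteq> A\<rbrakk> \<Longrightarrow> A' \<in> \<S>"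
  shows "isomorphic (PSh \<S> B) (restrict_fctr B (ext F)) F"
proof (rule isomorphic_pshI[where a = "\<lambda>X. ev F (Ide C X)"])
  show "psh \<S> B (restrict_fctr B (ext F))"
    by (rule is_functor_restrict_fctr_op[OF psh_ext[OF sub]])
  show "psh \<S> B F"
    by (rule F)
  show "is_category B"
    by (rule is_category_B)
next
  fix X assume "X \<in> Obj B"
  then have X: "X \<in> Obj C" "X \<in> P"
    by simp_all
  have id: "Ide C X \<in> Arr C" "Dom C (Ide C X) = X" "Cod C (Ide C X) = X"
    using X by (simp_all add: arrow_simps)
  have ev_Ide: "ev F f s = act F f (ev F (Ide C X) s)"
    if "f \<in> Arr C" "Dom C f \<in> P" "Cod C f = X" "s \<in> ext_obj F X" for f s
    using ev_Cmp[of "Ide C X" s f] Cmp_Ide_left[of f] that id X by simp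
  have "bij_betw (ev F (Ide C X)) (ext_obj F X) (FO F X)"
    unfolding bij_betw_def
  proof (intro conjI inj_onI equalityI subsetI)
    fix s t assume s: "s \<in> ext_obj F X" and t: "t \<in> ext_obj F X"
      and eq: "ev F (Ide C X) s = ev F (Ide C X) t"
    show "s = t"
    proof (rule ext_obj_eqI[OF X(1) s t])
      fix f assume f: "f \<in> Arr C" "Dom C f \<in> P" "Cod C f = X"
      show "ev F f s = ev F f t"
        using ev_Ide[OF f s] ev_Ide[OF f t] eq by simp
    qed
  next
    fix x assume "x \<in> ev F (Ide C X) ` ext_obj F X"
    then show "x \<in> FO F X"
      using ev_in[of "Ide C X"] id X by auto
  next
    fix x assume x: "x \<in> FO F X"
    obtain s where s: "s \<in> ext_obj F X"
      "\<And>f. \<lbrakk>f \<in> Arr C; Dom C f \<in> P; Cod C f = X\<rbrakk> \<Longrightarrow> ev F f s = act F f x"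
    proof (rule ext_obj_family[OF X(1), of "\<lambda>f. act F f x"])
      fix f assume f: "f \<in> Arr C" "Dom C f \<in> P" "Cod C f = X"
      then show "act F f x \<in> FO F (Dom C f)"
        using F_act_in[of f x] X x by simp
      fix b assume b: "b \<in> Arr C" "Dom C b \<in> P" "Cod C b = Dom C f"
      then show "act F (Cmp C f b) x = act F b (act F f x)"
        using F_act_Cmp[of b f x] f X x by simp
    qed blast
    then show "x \<in> ev F (Ide C X) ` ext_obj F X"
      using s(2)[of "Ide C X"] id X F_act_Ide[OF X(2) x] by (intro image_eqI[of _ _ s]) simp_all
  qed
  then show "bij_betw (ev F (Ide C X)) (FO (restrict_fctr B (ext F)) X) (FO F X)"
    using X by (simp add: ext_FO)
next
  fix f s assume "f \<in> Arr B" "s \<in> FO (restrict_fctr B (ext F)) (Cod B f)"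
  then have f: "f \<in> Arr C" "Dom C f \<in> P" "Cod C f \<in> P" and s: "s \<in> ext_obj F (Cod C f)"
    by (simp_all add: ext_FO P_Obj)
  have ob: "Ide C (Dom C f) \<in> Arr C" "Dom C (Ide C (Dom C f)) = Dom C f" "Cod C (Ide C (Dom C f)) = Dom C f"
    "Ide C (Cod C f) \<in> Arr C" "Dom C (Ide C (Cod C f)) = Cod C f" "Cod C (Ide C (Cod C f)) = Cod C f"
    using f by (simp_all add: arrow_simps)
  have "act F f (ev F (Ide C (Cod C f)) s) = ev F f s"
    using ev_Cmp[of "Ide C (Cod C f)" s f] Cmp_Ide_left[of f] f s ob by simp
  also have "\<dots> = ev F (Ide C (Dom C f)) (ext_act F f s)"
    using ev_ext_act[OF f(1) s, of "Ide C (Dom C f)"] Cmp_Ide_right[of f] f ob by simp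
  finally show "act F f (ev F (Ide C (Cod B f)) s) =
      ev F (Ide C (Dom B f)) (act (restrict_fctr B (ext F)) f s)"
    using f s by (simp add: ext_actE)
qed

end

end

section \<open>The restriction functor between presheaf categories\<close>

lemma PSh_simps [simp]:
  "Obj (PSh \<S> C) = {F. psh \<S> C F}"
  "Arr (PSh \<S> C) = {(F, \<eta>, G). is_nat_trans (op_cat C) (Sets \<S>) F G \<eta>}"
  "Dom (PSh \<S> C) (F, \<eta>, G) = F"
  "Cod (PSh \<S> C) (F, \<eta>, G) = G"
  "Ide (PSh \<S> C) F = (F, \<lambda>X\<in>Obj C. Ide (Sets \<S>) (FO F X), F)"
  "Cmp (PSh \<S> C) (G', \<theta>, H) (F, \<eta>, G) = (F, \<lambda>X\<in>Obj C. Cmp (Sets \<S>) (\<theta> X) (\<eta> X), H)"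
  by (simp_all add: PSh_def)

lemma is_category_PSh: "is_category (PSh \<S> C)"
  unfolding PSh_def by (rule is_category_functor_cat)

lemma is_nat_trans_restrict_op:
  fixes C :: "('o, 'a) cat" and P :: "'o set"
  assumes "is_nat_trans (op_cat C) D F G \<eta>"
  defines "B \<equiv> full_subcat C P"
  shows "is_nat_trans (op_cat B) D (restrict_fctr B F) (restrict_fctr B G) (restrict \<eta> (Obj B))"
proof -
  interpret is_nat_trans "op_cat C" D F G \<eta> by fact
  have "is_functor (op_cat B) D (restrict_fctr B F)" "is_functor (op_cat B) D (restrict_fctr B G)"
    unfolding B_def
    by (rule is_functor_restrict_fctr_op[OF F.is_functor_axioms],
        rule is_functor_restrict_fctr_op[OF G.is_functor_axioms])
  moreover have "restrict \<eta> (Obj B) \<in> Obj B \<rightarrow>\<^sub>E Arr D"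
    using component_PiE by (auto simp: B_def)
  moreover have "Dom C f \<in> Obj C" "Cod C f \<in> Obj C" if "f \<in> Arr C" for f
    using F.C.Dom_Obj[of f] F.C.Cod_Obj[of f] that by simp_all
  ultimately show ?thesis
    unfolding is_nat_trans_def is_nat_trans_axioms_def
    using Dom_component Cod_component natural by (simp add: B_def)
qed

text \<open>The shape of \<open>Res\<close> for arbitrary categories, so that functoriality is
  proved without reference to topology.\<close>

definition psh_restriction ::
  "'u set set \<Rightarrow> ('o, 'a) cat \<Rightarrow> ('o, 'a) cat \<Rightarrow>
    (('o, 'a, 'u) psh, ('o, 'a, 'u set, 'u set_arr) ntrans,
     ('o, 'a, 'u) psh, ('o, 'a, 'u set, 'u set_arr) ntrans) fctr" where
  "psh_restriction \<S> C B =
    \<lparr>FO = (\<lambda>F\<in>Obj (PSh \<S> C). restrict_fctr B F),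
     FA = (\<lambda>t\<in>Arr (PSh \<S> C). (case t of (F, \<eta>, G) \<Rightarrow>
       (restrict_fctr B F, restrict \<eta> (Obj B), restrict_fctr B G)))\<rparr>"

lemma psh_restriction_simps:
  "psh \<S> C F \<Longrightarrow> FO (psh_restriction \<S> C B) F = restrict_fctr B F"
  "is_nat_trans (op_cat C) (Sets \<S>) F G \<eta> \<Longrightarrow> FA (psh_restriction \<S> C B) (F, \<eta>, G) =
     (restrict_fctr B F, restrict \<eta> (Obj B), restrict_fctr B G)"
  by (simp_all add: psh_restriction_def)

lemma nat_trans_functors:
  assumes "is_nat_trans C D F G \<eta>"
  shows "is_functor C D F" "is_functor C D G"
  using assms by (simp_all add: is_nat_trans_def)

lemma is_functor_psh_restriction:
  "is_functor (PSh \<S> C) (PSh \<S> (full_subcat C P)) (psh_restriction \<S> C (full_subcat C P))"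
proof -
  let ?B = "full_subcat C P"
  let ?R = "psh_restriction \<S> C ?B"
  interpret C: is_category "PSh \<S> C" by (rule is_category_PSh)
  interpret D: is_category "PSh \<S> ?B" by (rule is_category_PSh)
  note restr = is_nat_trans_restrict_op[where P = P]
  show ?thesis
  proof unfold_locales
    show "FO ?R \<in> Obj (PSh \<S> C) \<rightarrow>\<^sub>E Obj (PSh \<S> ?B)"
      using is_functor_restrict_fctr_op by (auto simp: psh_restriction_def)
    show "FA ?R \<in> Arr (PSh \<S> C) \<rightarrow>\<^sub>E Arr (PSh \<S> ?B)"
    proof (rule PiE_I)
      fix t assume "t \<in> Arr (PSh \<S> C)"
      then obtain F \<eta> G where t: "t = (F, \<eta>, G)" and n: "is_nat_trans (op_cat C) (Sets \<S>) F G \<eta>"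
        by auto
      show "FA ?R t \<in> Arr (PSh \<S> ?B)"
        unfolding t psh_restriction_simps(2)[OF n] using restr[OF n] by simp
    qed (simp add: psh_restriction_def)
  next
    fix t assume "t \<in> Arr (PSh \<S> C)"
    then obtain F \<eta> G where t: "t = (F, \<eta>, G)" and n: "is_nat_trans (op_cat C) (Sets \<S>) F G \<eta>"
      by auto
    then show "Dom (PSh \<S> ?B) (FA ?R t) = FO ?R (Dom (PSh \<S> C) t)"
      "Cod (PSh \<S> ?B) (FA ?R t) = FO ?R (Cod (PSh \<S> C) t)"
      unfolding t using nat_trans_functors[OF n] by (simp_all add: psh_restriction_simps(2)[OF n] psh_restriction_simps(1))
  next
    fix F assume "F \<in> Obj (PSh \<S> C)"
    then have F: "psh \<S> C F" by simp
    have "(\<lambda>X\<in>Obj ?B. Ide (Sets \<S>) (FO (restrict_fctr ?B F) X)) =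
        restrict (\<lambda>X\<in>Obj C. Ide (Sets \<S>) (FO F X)) (Obj ?B)"
      by auto
    then show "FA ?R (Ide (PSh \<S> C) F) = Ide (PSh \<S> ?B) (FO ?R F)"
      unfolding PSh_simps psh_restriction_simps(1)[OF F] psh_restriction_simps(2)[OF is_nat_trans_Ide[OF F], unfolded op_cat_simps]
      by simp
  next
    fix s t assume "s \<in> Arr (PSh \<S> C)" "t \<in> Arr (PSh \<S> C)" "Cod (PSh \<S> C) s = Dom (PSh \<S> C) t"
    then obtain F \<eta> G \<theta> H where s: "s = (F, \<eta>, G)" and t: "t = (G, \<theta>, H)"
      and n: "is_nat_trans (op_cat C) (Sets \<S>) F G \<eta>" "is_nat_trans (op_cat C) (Sets \<S>) G H \<theta>"
      by auto
    have "restrict (\<lambda>X\<in>Obj C. Cmp (Sets \<S>) (\<theta> X) (\<eta> X)) (Obj ?B) =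
        (\<lambda>X\<in>Obj ?B. Cmp (Sets \<S>) (restrict \<theta> (Obj ?B) X) (restrict \<eta> (Obj ?B) X))"
      by auto
    then show "FA ?R (Cmp (PSh \<S> C) t s) = Cmp (PSh \<S> ?B) (FA ?R t) (FA ?R s)"
      unfolding s t PSh_simps psh_restriction_simps(2)[OF n(1)] psh_restriction_simps(2)[OF n(2)]
        psh_restriction_simps(2)[OF is_nat_trans_Cmp[OF n], unfolded op_cat_simps]
      by simp
  qed
qed

context projective_site
begin

text \<open>The hypothesis speaks of universal cocones of \<open>C\<close>, so a universal cocone of
  \<open>B\<close> first has to be one of \<open>C\<close>; this is what
  \<open>initial_from_P\<close> and \<open>coproduct_from_P\<close> provide.\<close>

lemma coproducts_to_products_restrict:
  assumes "coproducts_to_products C F"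
  shows "coproducts_to_products B (restrict_fctr B F)"
  unfolding coproducts_to_products_def
proof (intro conjI allI impI)
  fix X assume X: "initial B X"
  then have "X \<in> Obj B"
    by (simp add: initial_def)
  then show "is_singleton (FO (restrict_fctr B F) X)"
    using assms initial_from_P[OF X] unfolding coproducts_to_products_def by simp
next
  fix i j assume ij: "coproduct B i j"
  then have "i \<in> Arr B" "j \<in> Arr B"
    by (simp_all only: coproduct_def)
  then show "bij_betw (\<lambda>x. (act (restrict_fctr B F) i x, act (restrict_fctr B F) j x))
      (FO (restrict_fctr B F) (Cod B i))
      (FO (restrict_fctr B F) (Dom B i) \<times> FO (restrict_fctr B F) (Dom B j))"
    using assms[unfolded coproducts_to_products_def, THEN conjunct2, rule_format,
        OF coproduct_from_P[OF ij]] by (simp add: P_Obj)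
qed

text \<open>Fullness and faithfulness come from descent for the target presheaf; the product
  condition is what restriction and extension have to carry across.\<close>

theorem equivalence_restriction:
  assumes sub: "\<And>A A'. \<lbrakk>A \<in> \<S>; A' \<subseteq> A\<rbrakk> \<Longrightarrow> A' \<in> \<S>"
  defines "Sh \<equiv> full_subcat (PSh \<S> C) {F. coproducts_to_products C F \<and> epi_descent C F}"
    and "Sh' \<equiv> full_subcat (PSh \<S> B) {F. coproducts_to_products B F}"
  shows "equivalence Sh Sh' (restrict_fctr Sh (psh_restriction \<S> C B))"
proof (rule equivalenceI)
  let ?R = "restrict_fctr Sh (psh_restriction \<S> C B)"
  have ObjD: "psh \<S> C F" "epi_descent C F" "FO ?R F = restrict_fctr B F" if "F \<in> Obj Sh" for F
    using that by (simp_all add: Sh_def psh_restriction_simps)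
  have FA_R: "FA ?R (F, \<eta>, G) = (restrict_fctr B F, restrict \<eta> (Obj B), restrict_fctr B G)"
    if "(F, \<eta>, G) \<in> Arr Sh" for F \<eta> G
    using that by (simp add: Sh_def psh_restriction_simps)
  show "is_functor Sh Sh' ?R"
    unfolding Sh_def Sh'_def
    by (rule is_functor_restrict_fctr[OF is_functor_psh_restriction])
      (auto simp: psh_restriction_simps coproducts_to_products_restrict)
  show "\<exists>t\<in>Arr Sh. Dom Sh t = F \<and> Cod Sh t = G \<and> FA ?R t = u"
    if F: "F \<in> Obj Sh" and G: "G \<in> Obj Sh"
      and u: "u \<in> Arr Sh'" "Dom Sh' u = FO ?R F" "Cod Sh' u = FO ?R G" for F G u
  proof -
    obtain \<theta> where u_eq: "u = (restrict_fctr B F, \<theta>, restrict_fctr B G)"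
      and \<theta>: "is_nat_trans (op_cat B) (Sets \<S>) (restrict_fctr B F) (restrict_fctr B G) \<theta>"
      using u ObjD(3)[OF F] ObjD(3)[OF G] by (auto simp: Sh'_def)
    note psh = ObjD(1)[OF F] ObjD(1)[OF G]
    have a: "arr_fun (\<theta> X) x \<in> FO G X" if "X \<in> P" "x \<in> FO F X" for X x
      using is_nat_transD(3)[OF \<theta>, of X x] that by (simp add: P_Obj)
    have nat: "act G f (arr_fun (\<theta> (Cod C f)) x) = arr_fun (\<theta> (Dom C f)) (act F f x)"
      if "f \<in> Arr C" "Dom C f \<in> P" "Cod C f \<in> P" "x \<in> FO F (Cod C f)" for f x
      using is_nat_transD(4)[OF \<theta>, of f x] that by (simp add: P_Obj)
    obtain b where b: "\<And>X x. \<lbrakk>X \<in> Obj C; x \<in> FO F X\<rbrakk> \<Longrightarrow> b X x \<in> FO G X"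
      "\<And>f x. \<lbrakk>f \<in> Arr C; x \<in> FO F (Cod C f)\<rbrakk> \<Longrightarrow> act G f (b (Cod C f) x) = b (Dom C f) (act F f x)"
      "\<And>X x. \<lbrakk>X \<in> P; x \<in> FO F X\<rbrakk> \<Longrightarrow> b X x = arr_fun (\<theta> X) x"
      using extend_nat[OF psh ObjD(2)[OF G], of "\<lambda>X. arr_fun (\<theta> X)"] a nat by blast
    define \<eta> where "\<eta> = mk_nat C F G b"
    have \<eta>: "is_nat_trans (op_cat C) (Sets \<S>) F G \<eta>"
      unfolding \<eta>_def by (rule is_nat_trans_mk_nat[OF psh is_category_axioms b(1,2)])
    have "restrict \<eta> (Obj B) = \<theta>"
    proof (rule nat_trans_eqI[OF is_nat_trans_restrict_op[OF \<eta>] \<theta>])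
      fix X x assume "X \<in> Obj B" "x \<in> FO (restrict_fctr B F) X"
      then show "arr_fun (restrict \<eta> (Obj B) X) x = arr_fun (\<theta> X) x"
        using b(3)[of X x] by (simp add: \<eta>_def mk_nat_def)
    qed
    moreover have "(F, \<eta>, G) \<in> Arr Sh"
      using F G \<eta> by (simp add: Sh_def)
    ultimately show ?thesis
      using FA_R u_eq by (intro bexI[of _ "(F, \<eta>, G)"]) (simp_all add: Sh_def)
  qed
  show "s = t"
    if hyps: "s \<in> Arr Sh" "t \<in> Arr Sh" "Dom Sh s = Dom Sh t" "Cod Sh s = Cod Sh t" "FA ?R s = FA ?R t" for s t
  proof -
    obtain F \<eta> G \<theta> where st: "s = (F, \<eta>, G)" "t = (F, \<theta>, G)"
      using hyps(1-4) by (auto simp: Sh_def)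
    have n: "is_nat_trans (op_cat C) (Sets \<S>) F G \<eta>" "is_nat_trans (op_cat C) (Sets \<S>) F G \<theta>"
      and G: "epi_descent C G"
      using hyps(1,2) by (simp_all add: st Sh_def)
    have eq: "restrict \<eta> (Obj B) = restrict \<theta> (Obj B)"
      using hyps(5) FA_R[OF hyps(1)[unfolded st(1)]] FA_R[OF hyps(2)[unfolded st(2)]] by (simp add: st)
    have "\<eta> X = \<theta> X" if "X \<in> P" for X
      using fun_cong[OF eq, of X] that by (simp add: P_Obj)
    then have "\<eta> = \<theta>"
      by (rule nat_eq_if_eq_on_P[OF nat_trans_functors[OF n(1)] G n])
    then show ?thesis
      by (simp add: st)
  qed
  show "\<exists>G\<in>Obj Sh. isomorphic Sh' (FO ?R G) F" if "F \<in> Obj Sh'" for F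
  proof -
    have F: "psh \<S> B F" "coproducts_to_products B F"
      using that by (simp_all add: Sh'_def)
    have psh: "psh \<S> C (ext F)"
      by (rule psh_ext[OF F(1) sub])
    have cop: "coproducts_to_products C (ext F)"
      by (rule coproducts_to_products_ext[OF F])
    have G: "ext F \<in> Obj Sh"
      using psh cop epi_descent_ext[OF F(1)] by (simp add: Sh_def)
    have "isomorphic (PSh \<S> B) (restrict_fctr B (ext F)) F"
      by (rule ext_restrict_isomorphic[OF F(1) sub])
    then have "isomorphic Sh' (restrict_fctr B (ext F)) F"
      unfolding Sh'_def using F(2) coproducts_to_products_restrict[OF cop]
      by (intro isomorphic_full_subcat) simp_all
    then show ?thesis
      using G ObjD(3)[OF G] by (intro bexI[of _ "ext F"]) simp_all
  qed
qed

end

section \<open>Spaces of ultrafilters\<close>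

text \<open>\<open>e\<close> renames the points, and the topology pulled back along its inverse is
  the original one on the new carrier. \<open>beta\<close> has this form, and so have the spaces
  made by \<open>realize_space\<close>.\<close>

lemma homeomorphic_maps_pullback_topology:
  assumes "inj_on e (topspace X)"
  shows "homeomorphic_maps X (pullback_topology (e ` topspace X) (the_inv_into (topspace X) e) X)
    e (the_inv_into (topspace X) e)"
proof -
  let ?d = "the_inv_into (topspace X) e"
  let ?Y = "pullback_topology (e ` topspace X) ?d X"
  have de: "?d (e x) = x" if "x \<in> topspace X" for x
    using assms that by (rule the_inv_into_f_f)
  have "continuous_map ?Y X (id \<circ> ?d)"
    by (rule continuous_map_pullback) simp
  moreover have "continuous_map X ?Y e"
  proof (rule continuous_map_pullback')
    show "continuous_map X X (?d \<circ> e)"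
      using continuous_map_id by (rule continuous_map_eq) (simp add: de)
  qed auto
  ultimately show ?thesis
    unfolding homeomorphic_maps_def by (auto simp: topspace_pullback_topology de)
qed

lemma ultrafiltersD:
  assumes "U \<in> ultrafilters S"
  shows "A \<in> U \<Longrightarrow> A \<subseteq> S" "S \<in> U" "{} \<notin> U" "\<lbrakk>A \<in> U; B \<in> U\<rbrakk> \<Longrightarrow> A \<inter> B \<in> U"
    "\<lbrakk>A \<in> U; A \<subseteq> B; B \<subseteq> S\<rbrakk> \<Longrightarrow> B \<in> U" "A \<subseteq> S \<Longrightarrow> A \<in> U \<or> S - A \<in> U"
  using assms unfolding ultrafilters_def by blast+

lemma topspace_ultrafilter_space [simp]: "topspace (ultrafilter_space S) = ultrafilters S"
proof -
  have "{U \<in> ultrafilters S. S \<in> U} = ultrafilters S"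
    using ultrafiltersD(2) by blast
  then have "ultrafilters S \<in> {{U \<in> ultrafilters S. A \<in> U} |A. A \<subseteq> S}"
    by (intro CollectI exI[of _ S]) simp
  then show ?thesis
    unfolding ultrafilter_space_def topology_generated_by_topspace by (intro equalityI) blast+
qed

lemma openin_ultrafilter_space_basic:
  "A \<subseteq> S \<Longrightarrow> openin (ultrafilter_space S) {U \<in> ultrafilters S. A \<in> U}"
  unfolding ultrafilter_space_def by (rule topology_generated_by_Basis) auto

text \<open>The generating sets are by definition only a subbase. Closure of ultrafilters under
  binary intersections makes them a base.\<close>

lemma ultrafilter_space_base:
  assumes "openin (ultrafilter_space S) W" "U \<in> W"
  shows "\<exists>A\<in>U. \<forall>V\<in>ultrafilters S. A \<in> V \<longrightarrow> V \<in> W"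
proof -
  have U: "U \<in> ultrafilters S"
    using openin_subset[OF assms(1)] assms(2) by auto
  have "generate_topology_on {{U \<in> ultrafilters S. A \<in> U} |A. A \<subseteq> S} W"
    using assms(1) unfolding ultrafilter_space_def by (rule openin_topology_generated_by)
  then have "U \<in> W \<longrightarrow> ?thesis"
  proof (induction rule: generate_topology_on.induct)
    case (Int a b)
    show ?case
    proof
      assume Uab: "U \<in> a \<inter> b"
      obtain A where A: "A \<in> U" "\<forall>V\<in>ultrafilters S. A \<in> V \<longrightarrow> V \<in> a"
        using Int.IH(1) Uab by blast
      obtain B where B: "B \<in> U" "\<forall>V\<in>ultrafilters S. B \<in> V \<longrightarrow> V \<in> b"
        using Int.IH(2) Uab by blast
      have "V \<in> a \<inter> b" if V: "V \<in> ultrafilters S" "A \<inter> B \<in> V" for V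
      proof -
        have "A \<in> V" "B \<in> V"
          using ultrafiltersD(5)[OF V] ultrafiltersD(1)[OF U] A(1) B(1) by simp_all
        then show ?thesis
          using A(2) B(2) V(1) by blast
      qed
      then show "\<exists>A\<in>U. \<forall>V\<in>ultrafilters S. A \<in> V \<longrightarrow> V \<in> a \<inter> b"
        using ultrafiltersD(4)[OF U A(1) B(1)] by blast
    qed
  next
    case (UN K)
    show ?case
    proof
      assume "U \<in> \<Union>K"
      then obtain k where "k \<in> K" "U \<in> k" by blast
      then show "\<exists>A\<in>U. \<forall>V\<in>ultrafilters S. A \<in> V \<longrightarrow> V \<in> \<Union>K"
        using UN.IH[of k] by blast
    qed
  next
    case (Basis s)
    then obtain A where "s = {U \<in> ultrafilters S. A \<in> U}"
      by blast
    then show ?case by auto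
  qed simp
  with assms(2) show ?thesis by blast
qed

text \<open>Distinct ultrafilters differ on some set, and then one contains it and the other its
  complement; no ultrafilter contains both.\<close>

lemma Hausdorff_ultrafilter_space: "Hausdorff_space (ultrafilter_space S)"
  unfolding Hausdorff_space_def
proof (intro allI impI)
  fix U V assume UV: "U \<in> topspace (ultrafilter_space S) \<and> V \<in> topspace (ultrafilter_space S) \<and> U \<noteq> V"
  then have U: "U \<in> ultrafilters S" and V: "V \<in> ultrafilters S"
    by simp_all
  have "\<exists>A. A \<subseteq> S \<and> A \<in> U \<and> S - A \<in> V"
  proof (cases "U \<subseteq> V")
    case True
    then obtain A where "A \<in> V" "A \<notin> U"
      using UV by blast
    then have "A \<subseteq> S" "S - A \<in> U" "S - (S - A) = A"
      using ultrafiltersD(1)[OF V, of A] ultrafiltersD(6)[OF U, of A] by blast+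
    with \<open>A \<in> V\<close> show ?thesis
      by (intro exI[of _ "S - A"]) auto
  next
    case False
    then obtain A where "A \<in> U" "A \<notin> V"
      by blast
    then show ?thesis
      using ultrafiltersD(1)[OF U, of A] ultrafiltersD(6)[OF V, of A] by blast
  qed
  then obtain A where A: "A \<subseteq> S" "A \<in> U" "S - A \<in> V"
    by blast
  have "A \<notin> W" if "W \<in> ultrafilters S" "S - A \<in> W" for W
    using ultrafiltersD(3)[OF that(1)] ultrafiltersD(4)[OF that(1) _ that(2), of A] by auto
  then show "\<exists>M N. openin (ultrafilter_space S) M \<and> openin (ultrafilter_space S) N \<and>
      U \<in> M \<and> V \<in> N \<and> disjnt M N"
    using A U V
    by (intro exI[of _ "{U \<in> ultrafilters S. A \<in> U}"] exI[of _ "{U \<in> ultrafilters S. S - A \<in> U}"])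
      (auto simp: openin_ultrafilter_space_basic disjnt_def)
qed

text \<open>These are the basic neighbourhoods of \<open>\<phi>\<close>, cylinders over finitely
  many coordinates.\<close>

lemma openin_product_discrete_agree:
  fixes \<phi> :: "'a \<Rightarrow> 'b"
  assumes "finite F" "F \<subseteq> I"
  shows "openin (product_topology (\<lambda>_. discrete_topology UNIV) I)
    {\<psi> \<in> I \<rightarrow>\<^sub>E UNIV. \<forall>i\<in>F. \<psi> i = \<phi> i}"
proof -
  have "openin (product_topology (\<lambda>_. discrete_topology UNIV) I) (\<Pi>\<^sub>E i\<in>I. if i \<in> F then {\<phi> i} else UNIV)"
    by (rule product_topology_basis) (auto intro: finite_subset[OF _ assms(1)])
  moreover have "(\<Pi>\<^sub>E i\<in>I. if i \<in> F then {\<phi> i} else UNIV) = {\<psi> \<in> I \<rightarrow>\<^sub>E UNIV. \<forall>i\<in>F. \<psi> i = \<phi> i}"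
    using assms(2) by (auto simp: PiE_iff extensional_def split: if_splits)
  ultimately show ?thesis by simp
qed

text \<open>
  Identifying a family of subsets with its characteristic function makes the ultrafilters a closed
  subset of a power of the two-point space.
\<close>

lemma compact_ultrafilter_space: "compact_space (ultrafilter_space S)"
proof -
  define X where "X = product_topology (\<lambda>_. discrete_topology (UNIV :: bool set)) (Pow S)"
  define fam :: "('a set \<Rightarrow> bool) \<Rightarrow> 'a set set" where "fam \<phi> = {A \<in> Pow S. \<phi> A}" for \<phi>
  define K where "K = {\<phi> \<in> topspace X. fam \<phi> \<in> ultrafilters S}"
  have top: "topspace X = Pow S \<rightarrow>\<^sub>E UNIV"
    by (simp add: X_def)
  have "\<exists>N. openin X N \<and> \<phi> \<in> N \<and> N \<subseteq> topspace X - K" if \<phi>: "\<phi> \<in> topspace X - K" for \<phi>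
  proof -
    have "fam \<phi> \<notin> ultrafilters S"
      using \<phi> by (simp add: K_def)
    \<comment> \<open>A failing ultrafilter axiom is witnessed by at most three sets, so every
      function that agrees with \<open>\<phi>\<close> on these coordinates fails it too. Hence the
      complement of \<open>K\<close> is open.\<close>
    then obtain F where F: "finite F" "F \<subseteq> Pow S"
      and bad: "\<And>\<psi>. \<forall>A\<in>F. \<psi> A = \<phi> A \<Longrightarrow> fam \<psi> \<notin> ultrafilters S"
    proof -
      have "\<not> (S \<in> fam \<phi>) \<or> {} \<in> fam \<phi> \<or> (\<exists>A\<in>fam \<phi>. \<exists>B\<in>fam \<phi>. A \<inter> B \<notin> fam \<phi>) \<or>
          (\<exists>A\<in>fam \<phi>. \<exists>B. A \<subseteq> B \<and> B \<subseteq> S \<and> B \<notin> fam \<phi>) \<or>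
          (\<exists>A. A \<subseteq> S \<and> A \<notin> fam \<phi> \<and> S - A \<notin> fam \<phi>)"
        using \<open>fam \<phi> \<notin> ultrafilters S\<close> unfolding ultrafilters_def by (auto simp: fam_def)
      then consider "\<not> \<phi> S" | "\<phi> {}" | A B where "A \<subseteq> S" "B \<subseteq> S" "\<phi> A" "\<phi> B" "\<not> \<phi> (A \<inter> B)"
        | A B where "A \<subseteq> B" "B \<subseteq> S" "\<phi> A" "\<not> \<phi> B"
        | A where "A \<subseteq> S" "\<not> \<phi> A" "\<not> \<phi> (S - A)"
        by (auto simp: fam_def)
      then show thesis
      proof cases
        case 1
        show ?thesis
          by (rule that[of "{S}"]) (use 1 ultrafiltersD(2) in \<open>auto simp: fam_def\<close>)
      next
        case 2
        show ?thesis
          by (rule that[of "{{}}"]) (use 2 ultrafiltersD(3) in \<open>fastforce simp: fam_def\<close>)+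
      next
        case (3 A B)
        have "fam \<psi> \<notin> ultrafilters S" if "\<forall>C\<in>{A, B, A \<inter> B}. \<psi> C = \<phi> C" for \<psi>
          using 3 that ultrafiltersD(4)[of "fam \<psi>" S A B] by (auto simp: fam_def)
        then show ?thesis
          using 3 by (intro that[of "{A, B, A \<inter> B}"]) auto
      next
        case (4 A B)
        have "fam \<psi> \<notin> ultrafilters S" if "\<forall>C\<in>{A, B}. \<psi> C = \<phi> C" for \<psi>
          using 4 that ultrafiltersD(5)[of "fam \<psi>" S A B] by (auto simp: fam_def)
        then show ?thesis
          using 4 by (intro that[of "{A, B}"]) auto
      next
        case (5 A)
        have "fam \<psi> \<notin> ultrafilters S" if "\<forall>C\<in>{A, S - A}. \<psi> C = \<phi> C" for \<psi>
          using 5 that ultrafiltersD(6)[of "fam \<psi>" S A] by (auto simp: fam_def)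
        then show ?thesis
          using 5 by (intro that[of "{A, S - A}"]) auto
      qed
    qed
    show ?thesis
      using openin_product_discrete_agree[OF F, of \<phi>] bad \<phi>
      by (intro exI[of _ "{\<psi> \<in> Pow S \<rightarrow>\<^sub>E UNIV. \<forall>i\<in>F. \<psi> i = \<phi> i}"]) (auto simp: top K_def X_def)
  qed
  then have "openin X (topspace X - K)"
    by (subst openin_subopen) blast
  then have "closedin X K"
    by (simp add: closedin_def K_def)
  moreover have "compact_space X"
    unfolding X_def compact_space_product_topology by (simp add: compact_space_discrete_topology)
  ultimately have "compactin X K"
    by (rule closedin_compact_space[rotated])
  then have compact: "compactin (subtopology X K) K"
    by (simp add: compactin_subtopology)
  \<comment> \<open>The preimage of a generating set is the trace on \<open>K\<close> of a cylinder
    over one coordinate.\<close>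
  have "continuous_map (subtopology X K) (ultrafilter_space S) fam"
    unfolding ultrafilter_space_def
  proof (rule continuous_on_generated_topo)
    fix W assume "W \<in> {{U \<in> ultrafilters S. A \<in> U} |A. A \<subseteq> S}"
    then obtain A where A: "A \<subseteq> S" "W = {U \<in> ultrafilters S. A \<in> U}"
      by blast
    have "openin X {\<psi> \<in> Pow S \<rightarrow>\<^sub>E UNIV. \<forall>i\<in>{A}. \<psi> i = True}"
      unfolding X_def using A(1) by (intro openin_product_discrete_agree[of "{A}" _ "\<lambda>_. True"]) auto
    moreover have "fam -` W \<inter> topspace (subtopology X K) = {\<psi> \<in> Pow S \<rightarrow>\<^sub>E UNIV. \<forall>i\<in>{A}. \<psi> i = True} \<inter> K"
      using A by (auto simp: K_def top fam_def)
    ultimately show "openin (subtopology X K) (fam -` W \<inter> topspace (subtopology X K))"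
      by (auto simp: openin_subtopology)
  next
    show "fam ` topspace (subtopology X K) \<subseteq> \<Union>{{U \<in> ultrafilters S. A \<in> U} |A. A \<subseteq> S}"
      unfolding topspace_ultrafilter_space[unfolded ultrafilter_space_def topology_generated_by_topspace]
      by (auto simp: K_def)
  qed
  from image_compactin[OF compact this] have "compactin (ultrafilter_space S) (fam ` K)" .
  moreover have "fam ` K = ultrafilters S"
  proof (intro equalityI subsetI)
    fix U assume U: "U \<in> ultrafilters S"
    define \<phi> where "\<phi> = (\<lambda>A\<in>Pow S. A \<in> U)"
    have "fam \<phi> = U"
      using ultrafiltersD(1)[OF U] by (auto simp: fam_def \<phi>_def)
    then show "U \<in> fam ` K"
      using U by (intro image_eqI[of _ _ \<phi>]) (auto simp: K_def top \<phi>_def)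
  qed (auto simp: K_def)
  ultimately show ?thesis
    by (simp add: compact_space_def)
qed

section \<open>Extension of functions to the space of ultrafilters\<close>

definition principal :: "'a set \<Rightarrow> 'a \<Rightarrow> 'a set set" where
  "principal S s = {A. A \<subseteq> S \<and> s \<in> A}"

lemma principal_in: "s \<in> S \<Longrightarrow> principal S s \<in> ultrafilters S"
  by (auto simp: principal_def ultrafilters_def)

text \<open>A nonempty open set contains every ultrafilter that has some fixed nonempty
  \<open>A\<close> as a member, in particular the principal one at a point of
  \<open>A\<close>.\<close>

lemma principal_dense: "ultrafilter_space S closure_of (principal S ` S) = ultrafilters S"
proof -
  have "principal S ` S \<inter> W \<noteq> {}" if W: "openin (ultrafilter_space S) W" "W \<noteq> {}" for W
  proof -
    obtain U where U: "U \<in> W"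
      using W by blast
    then have "U \<in> ultrafilters S"
      using openin_subset[OF W(1)] by auto
    obtain A where A: "A \<in> U" "\<forall>V\<in>ultrafilters S. A \<in> V \<longrightarrow> V \<in> W"
      using ultrafilter_space_base[OF W(1) U] by blast
    then have "A \<noteq> {}" "A \<subseteq> S"
      using ultrafiltersD(1,3)[OF \<open>U \<in> ultrafilters S\<close>] by auto
    then obtain s where "s \<in> A" "s \<in> S" by blast
    then have "principal S s \<in> W"
      using A(2) principal_in[OF \<open>s \<in> S\<close>] \<open>A \<subseteq> S\<close> by (simp add: principal_def)
    with \<open>s \<in> S\<close> show ?thesis by blast
  qed
  then show ?thesis
    using dense_intersects_open[of "ultrafilter_space S" "principal S ` S"] by simp
qed

text \<open>\<open>g U\<close> is a limit of \<open>f\<close> along \<open>U\<close>: a point in the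
  closure of the image of every \<open>A\<close> in \<open>U\<close>. Compactness of
  \<open>K\<close> provides it, and regularity of \<open>K\<close> gives continuity.\<close>

lemma ultrafilter_space_extend:
  assumes K: "compact_space K" "Hausdorff_space K" and f: "f ` S \<subseteq> topspace K"
  obtains g where "continuous_map (ultrafilter_space S) K g" "\<And>s. s \<in> S \<Longrightarrow> g (principal S s) = f s"
proof -
  have ex: "\<exists>x\<in>topspace K. \<forall>A\<in>U. x \<in> K closure_of (f ` A)" if U: "U \<in> ultrafilters S" for U
  proof -
    have fip: "K closure_of (f ` A) \<noteq> {}" if "A \<in> U" for A
    proof -
      have "A \<noteq> {}" "f ` A \<subseteq> topspace K"
        using that ultrafiltersD(1)[OF U that] ultrafiltersD(3)[OF U] f by blast+
      then show ?thesis
        using closure_of_subset by fastforce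
    qed
    \<comment> \<open>Inserting \<open>S\<close> keeps the intersection inside \<open>S\<close> even
      when the family is empty.\<close>
    have finite_Inter: "\<Inter>(insert S \<F>) \<in> U" if "finite \<F>" "\<F> \<subseteq> U" for \<F>
      using that
    proof (induction \<F>)
      case (insert A \<F>)
      have "\<Inter>(insert S (insert A \<F>)) = A \<inter> \<Inter>(insert S \<F>)" by blast
      with insert show ?case
        using ultrafiltersD(4)[OF U] by simp
    qed (simp add: ultrafiltersD(2)[OF U])
    have "\<Inter>((\<lambda>A. K closure_of (f ` A)) ` U) \<noteq> {}"
    proof -
      have "\<Inter>\<G> \<noteq> {}" if \<G>: "finite \<G>" "\<G> \<subseteq> (\<lambda>A. K closure_of (f ` A)) ` U" for \<G>
      proof -
        obtain \<F> where \<F>: "finite \<F>" "\<F> \<subseteq> U" "\<G> = (\<lambda>A. K closure_of (f ` A)) ` \<F>"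
          using finite_subset_image[OF \<G>] by blast
        have "K closure_of (f ` \<Inter>(insert S \<F>)) \<noteq> {}"
          using finite_Inter[OF \<F>(1,2)] fip by blast
        moreover have "K closure_of (f ` \<Inter>(insert S \<F>)) \<subseteq> \<Inter>\<G>"
          unfolding \<F>(3) by (intro INT_greatest closure_of_mono) blast
        ultimately show ?thesis by blast
      qed
      then show ?thesis
        using K(1) unfolding compact_space_fip by (metis (no_types, lifting) closedin_closure_of imageE)
    qed
    then obtain x where x: "\<forall>A\<in>U. x \<in> K closure_of (f ` A)"
      by blast
    then have "x \<in> topspace K"
      using ultrafiltersD(2)[OF U] closure_of_subset_topspace by fastforce
    with x show ?thesis by blast
  qed
  then obtain g where g: "\<And>U. U \<in> ultrafilters S \<Longrightarrow> g U \<in> topspace K"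
    "\<And>U A. \<lbrakk>U \<in> ultrafilters S; A \<in> U\<rbrakk> \<Longrightarrow> g U \<in> K closure_of (f ` A)"
    by metis
  show ?thesis
  proof
    show "continuous_map (ultrafilter_space S) K g"
      unfolding continuous_map_def topspace_ultrafilter_space
    proof (intro conjI allI impI)
      show "g \<in> ultrafilters S \<rightarrow> topspace K"
        using g by blast
      fix V assume V: "openin K V"
      show "openin (ultrafilter_space S) {U \<in> ultrafilters S. g U \<in> V}"
      proof (subst openin_subopen, intro ballI)
        fix U assume "U \<in> {U \<in> ultrafilters S. g U \<in> V}"
        then have U: "U \<in> ultrafilters S" "g U \<in> V" by simp_all
        have "closedin K (topspace K - V)" "g U \<in> topspace K - (topspace K - V)"
          using V U g(1) by auto
        \<comment> \<open>Regularity shrinks \<open>V\<close> to a neighbourhood \<open>W\<close>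
          whose closure still lies in \<open>V\<close>. Control of the closure matters because
          \<open>g\<close> is known only through closures.\<close>
        then obtain W where W: "openin K W" "g U \<in> W" "disjnt (topspace K - V) (K closure_of W)"
          using compact_Hausdorff_imp_regular_space[OF K] unfolding regular_space by blast
        define A where "A = {s \<in> S. f s \<in> W}"
        \<comment> \<open>Otherwise \<open>U\<close> contains \<open>S - A\<close>, which puts
          \<open>g U\<close> in the closure of a set that misses its open neighbourhood
          \<open>W\<close>.\<close>
        have "A \<in> U"
        proof (rule ccontr)
          assume "A \<notin> U"
          then have "S - A \<in> U"
            using ultrafiltersD(6)[OF U(1), of A] by (auto simp: A_def)
          then have "g U \<in> K closure_of (f ` (S - A))"
            using g(2)[OF U(1)] by blast
          moreover have "K closure_of (f ` (S - A)) \<subseteq> topspace K - W"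
            using W(1) f by (intro closure_of_minimal) (auto simp: A_def)
          ultimately show False
            using W(2) by blast
        qed
        moreover have "g U' \<in> V" if "U' \<in> ultrafilters S" "A \<in> U'" for U'
        proof -
          have "g U' \<in> K closure_of W"
            using g(2)[OF that] closure_of_mono[of "f ` A" W K] by (auto simp: A_def)
          then show ?thesis
            using W(3) g(1)[OF that(1)] by (auto simp: disjnt_def)
        qed
        ultimately show "\<exists>T. openin (ultrafilter_space S) T \<and> U \<in> T \<and> T \<subseteq> {U \<in> ultrafilters S. g U \<in> V}"
          using U(1) by (intro exI[of _ "{U \<in> ultrafilters S. A \<in> U}"])
            (auto simp: openin_ultrafilter_space_basic A_def)
      qed
    qed
    fix s assume s: "s \<in> S"
    \<comment> \<open>\<open>{s}\<close> belongs to the principal ultrafilter, and points are closed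
      in \<open>K\<close>.\<close>
    have "g (principal S s) \<in> K closure_of (f ` {s})"
      using s by (intro g(2) principal_in) (auto simp: principal_def)
    also have "K closure_of (f ` {s}) = {f s}"
      using s f K(2) by (auto intro!: closure_of_closedin closedin_Hausdorff_singleton)
    finally show "g (principal S s) = f s" by simp
  qed
qed

text \<open>
  Collapsing a closed set \<open>A\<close> to a point yields the one-point compactification of its complement.
\<close>

lemma continuous_map_collapse:
  assumes X: "compact_space X" "Hausdorff_space X" and A: "closedin X A"
  defines "Y \<equiv> Alexandroff_compactification (subtopology X (topspace X - A))"
  shows "compact_space Y" "Hausdorff_space Y" "continuous_map X Y (\<lambda>x. if x \<in> A then None else Some x)"
proof -
  let ?X = "subtopology X (topspace X - A)"
  have op: "openin X (topspace X - A)"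
    using A by blast
  show "compact_space Y"
    by (simp add: Y_def)
  \<comment> \<open>An open subspace of a compact Hausdorff space is locally compact; together with
    the Hausdorff property this makes its one-point compactification Hausdorff.\<close>
  have "locally_compact_space ?X"
    using X op by (intro locally_compact_space_open_subset) (simp_all add: compact_imp_locally_compact_space)
  then show "Hausdorff_space Y"
    unfolding Y_def Hausdorff_space_Alexandroff_compactification
    using X(2) Hausdorff_space_subtopology by blast
  have A_sub: "A \<subseteq> topspace X"
    using A closedin_subset by blast
  show "continuous_map X Y (\<lambda>x. if x \<in> A then None else Some x)"
    unfolding continuous_map_def
  proof (intro conjI allI impI)
    fix V assume "openin Y V"
    then consider U where "openin ?X U" "V = Some ` U"
      | C where "compactin ?X C" "V = insert None (Some ` (topspace ?X - C))"
      unfolding Y_def openin_Alexandroff_compactification by blast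
    then show "openin X {x \<in> topspace X. (if x \<in> A then None else Some x) \<in> V}"
    proof cases
      case (1 U)
      then have "openin X U" "U \<subseteq> topspace X - A"
        using op openin_trans_full openin_subset[of ?X U] by (auto simp: topspace_subtopology)
      moreover have "{x \<in> topspace X. (if x \<in> A then None else Some x) \<in> V} = U"
        using 1(2) \<open>U \<subseteq> topspace X - A\<close> by (auto split: if_splits)
      ultimately show ?thesis by simp
    next
      case (2 C)
      then have C: "compactin X C" "C \<subseteq> topspace X - A"
        by (auto simp: compactin_subtopology)
      then have "openin X (topspace X - C)"
        using compactin_imp_closedin[OF X(2)] by blast
      moreover have "{x \<in> topspace X. (if x \<in> A then None else Some x) \<in> V} = topspace X - C"
        using 2(2) C(2) A_sub by (auto split: if_splits)
      ultimately show ?thesis by simp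
    qed
  qed (auto simp: Y_def)
qed

section \<open>Compact Hausdorff spaces\<close>

text \<open>Sets of any type that have a copy in \<open>\<S>\<close>. Auxiliary carriers consist of
  pairs, options or families of sets, which are not elements of \<open>'u\<close>.\<close>

definition small :: "'u set set \<Rightarrow> 'b set \<Rightarrow> bool" where
  "small \<S> A \<longleftrightarrow> (\<exists>e. inj_on e A \<and> e ` A \<in> \<S>)"

definition tfun :: "'u top_arr \<Rightarrow> 'u \<Rightarrow> 'u" where
  "tfun a = fst (snd a)"

lemma CHaus_Obj [simp]: "Obj (CHaus \<S>) = CHaus_obj \<S>"
  by (simp add: CHaus_def)

lemma CHaus_objD:
  assumes "X \<in> CHaus_obj \<S>"
  shows "compact_space X" "Hausdorff_space X" "topspace X \<in> \<S>"
  using assms by (simp_all add: CHaus_obj_def)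

lemma CHaus_arr_cases:
  assumes "a \<in> Arr (CHaus \<S>)"
  obtains X f Y where "a = (X, f, Y)" "X \<in> CHaus_obj \<S>" "Y \<in> CHaus_obj \<S>" "continuous_map X Y f"
    "f \<in> extensional (topspace X)"
  using assms by (auto simp: CHaus_def)

lemma CHaus_arr:
  "\<lbrakk>X \<in> CHaus_obj \<S>; Y \<in> CHaus_obj \<S>; continuous_map X Y f; f \<in> extensional (topspace X)\<rbrakk>
    \<Longrightarrow> (X, f, Y) \<in> Arr (CHaus \<S>)"
  by (simp add: CHaus_def)

lemma CHaus_triple [simp]:
  "Dom (CHaus \<S>) (X, f, Y) = X" "Cod (CHaus \<S>) (X, f, Y) = Y" "tfun (X, f, Y) = f"
  "Ide (CHaus \<S>) X = (X, \<lambda>x\<in>topspace X. x, X)"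
  "Cmp (CHaus \<S>) (Y', g, Z) (X, f, Y) = (X, compose (topspace X) g f, Z)"
  by (simp_all add: CHaus_def tfun_def)

lemma continuous_map_compose_ext:
  assumes "continuous_map X Y f" "continuous_map Y Z g"
  shows "continuous_map X Z (compose (topspace X) g f)"
  by (rule continuous_map_eq[OF continuous_map_compose[OF assms]]) (simp add: compose_def)

lemma is_category_CHaus: "is_category (CHaus \<S>)"
proof unfold_locales
  fix X assume "X \<in> Obj (CHaus \<S>)"
  then have X: "X \<in> CHaus_obj \<S>" by simp
  have "continuous_map X X (\<lambda>x\<in>topspace X. x)"
    by (rule continuous_map_eq[OF continuous_map_id]) simp
  with X show "Ide (CHaus \<S>) X \<in> Arr (CHaus \<S>)"
    "Dom (CHaus \<S>) (Ide (CHaus \<S>) X) = X" "Cod (CHaus \<S>) (Ide (CHaus \<S>) X) = X"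
    by (simp_all add: CHaus_arr)
next
  fix f assume "f \<in> Arr (CHaus \<S>)"
  then obtain X u Y where f: "f = (X, u, Y)" and X: "X \<in> CHaus_obj \<S>" "Y \<in> CHaus_obj \<S>"
    and u: "continuous_map X Y u" "u \<in> extensional (topspace X)"
    by (rule CHaus_arr_cases)
  then show "Dom (CHaus \<S>) f \<in> Obj (CHaus \<S>)" "Cod (CHaus \<S>) f \<in> Obj (CHaus \<S>)"
    by simp_all
  have "u \<in> topspace X \<rightarrow> topspace Y"
    using u(1) by (simp add: continuous_map_def)
  with u(2) show "Cmp (CHaus \<S>) f (Ide (CHaus \<S>) (Dom (CHaus \<S>) f)) = f"
    "Cmp (CHaus \<S>) (Ide (CHaus \<S>) (Cod (CHaus \<S>) f)) f = f"
    unfolding f by (simp_all add: compose_Id Id_compose)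
next
  fix f g assume "f \<in> Arr (CHaus \<S>)" "g \<in> Arr (CHaus \<S>)" and fg: "Cod (CHaus \<S>) f = Dom (CHaus \<S>) g"
  then obtain X u Y Y' v Z where f: "f = (X, u, Y)" and g: "g = (Y', v, Z)"
    and X: "X \<in> CHaus_obj \<S>" "Z \<in> CHaus_obj \<S>"
    and u: "continuous_map X Y u" and v: "continuous_map Y' Z v"
    by (metis CHaus_arr_cases)
  with fg have v: "continuous_map Y Z v"
    by simp
  show "Cmp (CHaus \<S>) g f \<in> Arr (CHaus \<S>)"
    unfolding f g CHaus_triple
    by (rule CHaus_arr[OF X continuous_map_compose_ext[OF u v]]) (simp add: compose_def)
  show "Dom (CHaus \<S>) (Cmp (CHaus \<S>) g f) = Dom (CHaus \<S>) f"
    "Cod (CHaus \<S>) (Cmp (CHaus \<S>) g f) = Cod (CHaus \<S>) g"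
    by (simp_all add: f g)
next
  fix f g h assume "f \<in> Arr (CHaus \<S>)" "g \<in> Arr (CHaus \<S>)" "h \<in> Arr (CHaus \<S>)"
    and fg: "Cod (CHaus \<S>) f = Dom (CHaus \<S>) g" "Cod (CHaus \<S>) g = Dom (CHaus \<S>) h"
  then obtain X u Y Y' v Z Z' w W where fgh: "f = (X, u, Y)" "g = (Y', v, Z)" "h = (Z', w, W)"
    and u: "continuous_map X Y u"
    by (metis CHaus_arr_cases)
  then have "u \<in> topspace X \<rightarrow> topspace Y" "Y' = Y"
    using u fg by (simp_all add: continuous_map_def)
  then show "Cmp (CHaus \<S>) h (Cmp (CHaus \<S>) g f) = Cmp (CHaus \<S>) (Cmp (CHaus \<S>) h g) f"
    by (simp add: fgh compose_assoc)
qed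

lemma CHaus_arrD:
  assumes "a \<in> Arr (CHaus \<S>)"
  shows "Dom (CHaus \<S>) a \<in> CHaus_obj \<S>" "Cod (CHaus \<S>) a \<in> CHaus_obj \<S>"
    "continuous_map (Dom (CHaus \<S>) a) (Cod (CHaus \<S>) a) (tfun a)"
  by (rule CHaus_arr_cases[OF assms]; simp)+

lemma tfun_in:
  "\<lbrakk>a \<in> Arr (CHaus \<S>); x \<in> topspace (Dom (CHaus \<S>) a)\<rbrakk> \<Longrightarrow> tfun a x \<in> topspace (Cod (CHaus \<S>) a)"
  using CHaus_arrD(3)[of a \<S>] by (auto simp: continuous_map_def)

lemma tfun_Cmp:
  assumes "a \<in> Arr (CHaus \<S>)" "b \<in> Arr (CHaus \<S>)" "x \<in> topspace (Dom (CHaus \<S>) a)"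
  shows "tfun (Cmp (CHaus \<S>) b a) x = tfun b (tfun a x)"
  by (rule CHaus_arr_cases[OF assms(1)], rule CHaus_arr_cases[OF assms(2)])
    (use assms(3) in \<open>simp add: compose_def\<close>)

lemma CHaus_arr_eqI:
  assumes "a \<in> Arr (CHaus \<S>)" "b \<in> Arr (CHaus \<S>)" "Dom (CHaus \<S>) a = Dom (CHaus \<S>) b"
    "Cod (CHaus \<S>) a = Cod (CHaus \<S>) b"
    and eq: "\<And>x. x \<in> topspace (Dom (CHaus \<S>) a) \<Longrightarrow> tfun a x = tfun b x"
  shows "a = b"
proof -
  obtain X f Y where a: "a = (X, f, Y)" "f \<in> extensional (topspace X)"
    using assms(1) by (rule CHaus_arr_cases)
  obtain X' g Y' where b: "b = (X', g, Y')" "g \<in> extensional (topspace X')"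
    using assms(2) by (rule CHaus_arr_cases)
  have "f = g"
    using a b assms(3) eq by (intro extensionalityI[of f "topspace X" g]) simp_all
  then show ?thesis
    using a b assms(3,4) by simp
qed

lemma CHaus_arrE:
  assumes "X \<in> CHaus_obj \<S>" "Y \<in> CHaus_obj \<S>" "continuous_map X Y f"
  obtains a where "a \<in> Arr (CHaus \<S>)" "Dom (CHaus \<S>) a = X" "Cod (CHaus \<S>) a = Y"
    "\<And>x. x \<in> topspace X \<Longrightarrow> tfun a x = f x"
proof
  have "continuous_map X Y (restrict f (topspace X))"
    using assms(3) by (rule continuous_map_eq) simp
  then show "(X, restrict f (topspace X), Y) \<in> Arr (CHaus \<S>)"
    by (intro CHaus_arr assms) simp_all
qed simp_all

text \<open>Compactness of the domain makes the image compact, and compact sets in a Hausdorff space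
  are closed.\<close>

lemma closedin_image_arr:
  assumes "a \<in> Arr (CHaus \<S>)"
  shows "closedin (Cod (CHaus \<S>) a) (tfun a ` topspace (Dom (CHaus \<S>) a))"
  using CHaus_arrD[OF assms] CHaus_objD
  by (metis compact_space_def compactin_imp_closedin image_compactin)

lemma initial_CHausI:
  assumes "X \<in> CHaus_obj \<S>" "topspace X = {}"
  shows "initial (CHaus \<S>) X"
  unfolding initial_def
proof (intro conjI ballI)
  fix Y assume "Y \<in> Obj (CHaus \<S>)"
  then have Y: "Y \<in> CHaus_obj \<S>" by simp
  have "continuous_map X Y (\<lambda>_. undefined)"
    using assms(2) by (simp add: continuous_map_def)
  then obtain a where a: "a \<in> Arr (CHaus \<S>)" "Dom (CHaus \<S>) a = X" "Cod (CHaus \<S>) a = Y"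
    using CHaus_arrE[OF assms(1) Y] by blast
  moreover have "b = a" if "b \<in> Arr (CHaus \<S>)" "Dom (CHaus \<S>) b = X" "Cod (CHaus \<S>) b = Y" for b
    by (rule CHaus_arr_eqI[OF that(1) a(1)]) (use a that assms(2) in simp_all)
  ultimately show "\<exists>!f. f \<in> Arr (CHaus \<S>) \<and> Dom (CHaus \<S>) f = X \<and> Cod (CHaus \<S>) f = Y"
    by blast
qed (use assms in simp)

section \<open>Initial objects and coproducts in full subcategories\<close>

lemma initial_full_subcat:
  assumes "initial C X" "X \<in> P"
  shows "initial (full_subcat C P) X"
  using assms unfolding initial_def by auto

lemma coproductD:
  assumes "coproduct C i j" "f \<in> Arr C" "g \<in> Arr C" "Dom C f = Dom C i" "Dom C g = Dom C j"
    "Cod C f = Cod C g"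
  shows "\<exists>!h. h \<in> Arr C \<and> Dom C h = Cod C i \<and> Cod C h = Cod C f \<and> Cmp C h i = f \<and> Cmp C h j = g"
  using assms unfolding coproduct_def by blast

lemma coproductI:
  assumes "i \<in> Arr C" "j \<in> Arr C" "Cod C i = Cod C j"
    and "\<And>f g. \<lbrakk>f \<in> Arr C; g \<in> Arr C; Dom C f = Dom C i; Dom C g = Dom C j; Cod C f = Cod C g\<rbrakk> \<Longrightarrow>
      \<exists>!h. h \<in> Arr C \<and> Dom C h = Cod C i \<and> Cod C h = Cod C f \<and> Cmp C h i = f \<and> Cmp C h j = g"
  shows "coproduct C i j"
  unfolding coproduct_def by (intro conjI ballI impI, (rule assms(1-3))+, rule assms(4)) simp_all

lemma coproduct_full_subcat:
  assumes "coproduct C i j" "Dom C i \<in> P" "Dom C j \<in> P" "Cod C i \<in> P"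
  shows "coproduct (full_subcat C P) i j"
proof -
  have ij: "i \<in> Arr C" "j \<in> Arr C" "Cod C i = Cod C j"
    and univ: "\<And>f g. \<lbrakk>f \<in> Arr C; g \<in> Arr C; Dom C f = Dom C i; Dom C g = Dom C j; Cod C f = Cod C g\<rbrakk> \<Longrightarrow>
      \<exists>!h. h \<in> Arr C \<and> Dom C h = Cod C i \<and> Cod C h = Cod C f \<and> Cmp C h i = f \<and> Cmp C h j = g"
    using assms(1) unfolding coproduct_def by blast+
  have "\<exists>!h. h \<in> Arr (full_subcat C P) \<and> Dom C h = Cod C i \<and> Cod C h = Cod C f \<and>
      Cmp C h i = f \<and> Cmp C h j = g"
    if "f \<in> Arr (full_subcat C P)" "g \<in> Arr (full_subcat C P)" "Dom C f = Dom C i" "Dom C g = Dom C j"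
      "Cod C f = Cod C g" for f g
  proof -
    have "h \<in> Arr (full_subcat C P) \<and> Dom C h = Cod C i \<and> Cod C h = Cod C f \<and> Cmp C h i = f \<and> Cmp C h j = g
      \<longleftrightarrow> h \<in> Arr C \<and> Dom C h = Cod C i \<and> Cod C h = Cod C f \<and> Cmp C h i = f \<and> Cmp C h j = g" for h
      using assms(4) that by auto
    then show ?thesis
      using univ[of f g] that by simp
  qed
  then show ?thesis
    unfolding coproduct_def using ij assms by simp
qed

text \<open>If \<open>C\<close> has a coproduct of the same two objects that lies in
  \<open>P\<close>, the two universal properties give comparison arrows \<open>h\<close> and
  \<open>k\<close>. The equation \<open>kh\<close> carries uniqueness over from the coproduct in
  \<open>C\<close>.\<close>

lemma coproduct_from_full_subcat:
  assumes C: "is_category C" and ij: "coproduct (full_subcat C P) i j"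
    and ij': "coproduct C i' j'" "Dom C i' = Dom C i" "Dom C j' = Dom C j" "Cod C i' \<in> P"
  shows "coproduct C i j"
proof -
  interpret is_category C by fact
  let ?B = "full_subcat C P"
  have i: "i \<in> Arr C" "Dom C i \<in> P" "Cod C i \<in> P" and j: "j \<in> Arr C" "Dom C j \<in> P" "Cod C j = Cod C i"
    using ij by (simp_all add: coproduct_def)
  have i': "i' \<in> Arr C" and j': "j' \<in> Arr C" "Cod C j' = Cod C i'"
    using ij'(1) by (simp_all add: coproduct_def)
  have univ: "\<exists>!h. h \<in> Arr ?B \<and> Dom ?B h = Cod ?B i \<and> Cod ?B h = Cod ?B f \<and> Cmp ?B h i = f \<and> Cmp ?B h j = g"
    if "f \<in> Arr ?B" "g \<in> Arr ?B" "Dom ?B f = Dom ?B i" "Dom ?B g = Dom ?B j" "Cod ?B f = Cod ?B g" for f g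
    using ij that unfolding coproduct_def by blast
  have univ': "\<exists>!h. h \<in> Arr C \<and> Dom C h = Cod C i' \<and> Cod C h = Cod C f \<and> Cmp C h i' = f \<and> Cmp C h j' = g"
    if "f \<in> Arr C" "g \<in> Arr C" "Dom C f = Dom C i'" "Dom C g = Dom C j'" "Cod C f = Cod C g" for f g
    using ij'(1) that unfolding coproduct_def by blast
  obtain h where h: "h \<in> Arr C" "Dom C h = Cod C i" "Cod C h = Cod C i'" "Cmp C h i = i'" "Cmp C h j = j'"
    using univ[of i' j'] i i' j j' ij' by auto
  obtain k where k: "k \<in> Arr C" "Dom C k = Cod C i'" "Cod C k = Cod C i" "Cmp C k i' = i" "Cmp C k j' = j"
    using univ'[of i j] i i' j j' ij' by auto
  \<comment> \<open>Both arrows fix \<open>i\<close> and \<open>j\<close>, and by the universal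
    property in the subcategory there is only one such arrow.\<close>
  have kh: "Cmp C k h = Ide C (Cod C i)"
  proof -
    have ex1: "\<exists>!m. m \<in> Arr ?B \<and> Dom C m = Cod C i \<and> Cod C m = Cod C i \<and> Cmp C m i = i \<and> Cmp C m j = j"
      using univ[of i j] i j by simp
    have "Cmp C k h \<in> Arr ?B \<and> Dom C (Cmp C k h) = Cod C i \<and> Cod C (Cmp C k h) = Cod C i \<and>
        Cmp C (Cmp C k h) i = i \<and> Cmp C (Cmp C k h) j = j"
      using Cmp_assoc[OF i(1) h(1) k(1)] Cmp_assoc[OF j(1) h(1) k(1)] h k i j
      by (simp add: Cmp_Arr Dom_Cmp Cod_Cmp)
    moreover have "Ide C (Cod C i) \<in> Arr ?B \<and> Dom C (Ide C (Cod C i)) = Cod C i \<and>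
        Cod C (Ide C (Cod C i)) = Cod C i \<and> Cmp C (Ide C (Cod C i)) i = i \<and> Cmp C (Ide C (Cod C i)) j = j"
      using Cmp_Ide_left[OF i(1)] Cmp_Ide_left[OF j(1)] i j Cod_Obj[OF i(1)]
      by (simp add: Ide_Arr Dom_Ide Cod_Ide)
    ultimately show ?thesis
      using ex1 by blast
  qed
  have "\<exists>!m. m \<in> Arr C \<and> Dom C m = Cod C i \<and> Cod C m = Cod C f \<and> Cmp C m i = f \<and> Cmp C m j = g"
    if fg: "f \<in> Arr C" "g \<in> Arr C" "Dom C f = Dom C i" "Dom C g = Dom C j" "Cod C f = Cod C g" for f g
  proof -
    have ex1: "\<exists>!m. m \<in> Arr C \<and> Dom C m = Cod C i' \<and> Cod C m = Cod C f \<and> Cmp C m i' = f \<and> Cmp C m j' = g"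
      using univ'[of f g] fg ij' by simp
    then obtain m where m: "m \<in> Arr C" "Dom C m = Cod C i'" "Cod C m = Cod C f" "Cmp C m i' = f" "Cmp C m j' = g"
      by blast
    show ?thesis
    proof (rule ex1I[of _ "Cmp C m h"])
      show "Cmp C m h \<in> Arr C \<and> Dom C (Cmp C m h) = Cod C i \<and> Cod C (Cmp C m h) = Cod C f \<and>
          Cmp C (Cmp C m h) i = f \<and> Cmp C (Cmp C m h) j = g"
        using Cmp_assoc[OF i(1) h(1) m(1)] Cmp_assoc[OF j(1) h(1) m(1)] h m j
        by (simp add: Cmp_Arr Dom_Cmp Cod_Cmp)
      fix n assume n: "n \<in> Arr C \<and> Dom C n = Cod C i \<and> Cod C n = Cod C f \<and> Cmp C n i = f \<and> Cmp C n j = g"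
      have "Cmp C (Cmp C n k) i' = f" "Cmp C (Cmp C n k) j' = g"
        using Cmp_assoc[OF i' k(1), of n] Cmp_assoc[OF j'(1) k(1), of n] k n j' by simp_all
      moreover have "Cmp C n k \<in> Arr C" "Dom C (Cmp C n k) = Cod C i'" "Cod C (Cmp C n k) = Cod C f"
        using n k by (simp_all add: Cmp_Arr Dom_Cmp Cod_Cmp)
      ultimately have "Cmp C n k = m"
        using ex1 m by blast
      then have "Cmp C m h = Cmp C n (Cmp C k h)"
        using n k h by (simp add: Cmp_assoc)
      then show "n = Cmp C m h"
        using kh n Cmp_Ide_right[of n] by simp
    qed
  qed
  then show ?thesis
    unfolding coproduct_def using i j by simp
qed

context set_universe
begin

section \<open>Size bounds from closure under power sets\<close>

lemma small_mem [simp]: "A \<in> \<S> \<Longrightarrow> small \<S> A"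
  unfolding small_def by (rule exI[of _ "\<lambda>x. x"]) simp

lemma small_inj:
  assumes "small \<S> B" "inj_on f A" "f ` A \<subseteq> B"
  shows "small \<S> A"
proof -
  obtain e where e: "inj_on e B" "e ` B \<in> \<S>"
    using assms(1) unfolding small_def by blast
  have "inj_on (e \<circ> f) A"
    using assms(2) inj_on_subset[OF e(1) assms(3)] by (rule comp_inj_on)
  moreover have "(e \<circ> f) ` A \<in> \<S>"
    by (rule subset_closed[OF e(2)]) (use assms(3) in auto)
  ultimately show ?thesis
    unfolding small_def by blast
qed

lemma small_Pow:
  assumes "small \<S> A"
  shows "small \<S> (Pow A)"
proof -
  obtain e where e: "inj_on e A" "e ` A \<in> \<S>"
    using assms unfolding small_def by blast
  obtain B f where "B \<in> \<S>" "bij_betw f (Pow (e ` A)) B"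
    using Pow_closed[OF e(2)] by blast
  then have "small \<S> (Pow (e ` A))"
    unfolding small_def bij_betw_def by blast
  then show ?thesis
    by (rule small_inj[where f = "\<lambda>X. e ` X"]) (use inj_on_image_Pow[OF e(1)] in auto)
qed

text \<open>By comparability of cardinals one summand injects into the other, say \<open>A\<close>
  into \<open>B\<close> by \<open>f\<close>. The sum then embeds into the double power set of
  \<open>B\<close>.\<close>

lemma small_Plus:
  assumes "A \<in> \<S>" "B \<in> \<S>"
  shows "small \<S> (A <+> B)"
proof -
  have aux: "small \<S> (A <+> B)" if "B \<in> \<S>" "inj_on f A" "f ` A \<subseteq> B" for A B and f :: "'u \<Rightarrow> 'u"
  proof (rule small_inj)
    show "small \<S> (Pow (Pow B))"
      by (intro small_Pow small_mem that)
    \<comment> \<open>The extra member \<open>{}\<close> marks the elements that come from the left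
      summand.\<close>
    show "inj_on (case_sum (\<lambda>a. {{f a}, {}}) (\<lambda>b. {{b}})) (A <+> B)"
      using that(2) unfolding inj_on_def Plus_def
      by (intro ballI impI, elim UnE imageE) (simp_all add: doubleton_eq_iff)
    show "case_sum (\<lambda>a. {{f a}, {}}) (\<lambda>b. {{b}}) ` (A <+> B) \<subseteq> Pow (Pow B)"
      using that(3) by auto
  qed
  have "(card_of A, card_of B) \<in> ordLeq \<or> (card_of B, card_of A) \<in> ordLeq"
    by (rule ordLeq_total) (rule card_of_Well_order)+
  then have "(\<exists>f. inj_on f A \<and> f ` A \<subseteq> B) \<or> (\<exists>f. inj_on f B \<and> f ` B \<subseteq> A)"
    by (simp only: card_of_ordLeq)
  then show ?thesis
  proof (elim disjE exE conjE)
    fix f assume "inj_on f A" "f ` A \<subseteq> B"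
    then show ?thesis
      by (rule aux[OF assms(2)])
  next
    fix f assume "inj_on f B" "f ` B \<subseteq> A"
    then have "small \<S> (B <+> A)"
      by (rule aux[OF assms(1)])
    then show ?thesis
      by (rule small_inj[where f = "case_sum Inr Inl"]) (auto simp: inj_on_def)
  qed
qed

text \<open>The tags \<open>Inl\<close> and \<open>Inr\<close> let an unordered pair remember its
  order, so the square embeds into the power set of a sum.\<close>

lemma small_Times:
  assumes "A \<in> \<S>"
  shows "small \<S> (A \<times> A)"
proof (rule small_inj)
  show "small \<S> (Pow (A <+> A))"
    by (intro small_Pow small_Plus assms)
  show "inj_on (\<lambda>(a, b). {Inl a, Inr b}) (A \<times> A)"
    by (rule inj_onI) (clarsimp simp: doubleton_eq_iff)
qed auto

lemma empty_in: "{} \<in> \<S>"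
  using universe_nonempty subset_closed by blast

text \<open>Fibre products, collapsed spaces and the two-point space are built over other types;
  this transports them to objects of the category.\<close>

lemma realize_space:
  assumes "compact_space X" "Hausdorff_space X" "small \<S> (topspace X)"
  obtains K e d where "K \<in> CHaus_obj \<S>" "homeomorphic_maps X K e d"
proof -
  obtain e where e: "inj_on e (topspace X)" "e ` topspace X \<in> \<S>"
    using assms(3) unfolding small_def by blast
  let ?K = "pullback_topology (e ` topspace X) (the_inv_into (topspace X) e) X"
  have h: "homeomorphic_maps X ?K e (the_inv_into (topspace X) e)"
    by (rule homeomorphic_maps_pullback_topology[OF e(1)])
  then have hs: "X homeomorphic_space ?K"
    unfolding homeomorphic_space_def by blast
  have "topspace ?K = e ` topspace X"
    using h homeomorphic_maps_map homeomorphic_imp_surjective_map by metis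
  then have "?K \<in> CHaus_obj \<S>"
    using assms(1,2) e(2) homeomorphic_compact_space[OF hs] homeomorphic_Hausdorff_space[OF hs]
    by (simp add: CHaus_obj_def)
  then show ?thesis
    using h by (rule that)
qed

lemma ultrafilter_code:
  assumes "S \<in> \<S>"
  shows "inj_on (ultrafilter_code \<S> S) (ultrafilters S)"
    "ultrafilter_code \<S> S ` ultrafilters S \<in> \<S>"
proof -
  have "small \<S> (Pow (Pow S))"
    by (intro small_Pow small_mem assms)
  then have "small \<S> (ultrafilters S)"
    by (rule small_inj[where f = "\<lambda>x. x"]) (auto simp: ultrafilters_def)
  from someI_ex[OF this[unfolded small_def]]
  show "inj_on (ultrafilter_code \<S> S) (ultrafilters S)" "ultrafilter_code \<S> S ` ultrafilters S \<in> \<S>"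
    by (simp_all add: ultrafilter_code_def)
qed

section \<open>Stone-Cech compactifications as objects of the category\<close>

lemma homeomorphic_maps_beta:
  assumes "S \<in> \<S>"
  shows "homeomorphic_maps (ultrafilter_space S) (beta \<S> S) (ultrafilter_code \<S> S)
    (the_inv_into (ultrafilters S) (ultrafilter_code \<S> S))"
  using homeomorphic_maps_pullback_topology[of "ultrafilter_code \<S> S" "ultrafilter_space S"]
    ultrafilter_code(1)[OF assms] by (simp add: beta_def)

lemma topspace_beta: "S \<in> \<S> \<Longrightarrow> topspace (beta \<S> S) = ultrafilter_code \<S> S ` ultrafilters S"
  using homeomorphic_maps_beta homeomorphic_maps_map homeomorphic_imp_surjective_map
    topspace_ultrafilter_space by metis

lemma beta_obj:
  assumes "S \<in> \<S>"
  shows "beta \<S> S \<in> CHaus_obj \<S>"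
proof -
  have hs: "ultrafilter_space S homeomorphic_space beta \<S> S"
    using homeomorphic_maps_beta[OF assms] unfolding homeomorphic_space_def by blast
  show ?thesis
    using homeomorphic_compact_space[OF hs] homeomorphic_Hausdorff_space[OF hs]
      compact_ultrafilter_space[of S] Hausdorff_ultrafilter_space[of S] ultrafilter_code(2)[OF assms]
    by (simp add: CHaus_obj_def topspace_beta[OF assms])
qed

text \<open>The canonical map from \<open>S\<close> into its compactification, seen through the
  renaming of ultrafilters.\<close>

definition unit :: "'u set \<Rightarrow> 'u \<Rightarrow> 'u" where
  "unit S s = ultrafilter_code \<S> S (principal S s)"

lemma unit_in: "\<lbrakk>S \<in> \<S>; s \<in> S\<rbrakk> \<Longrightarrow> unit S s \<in> topspace (beta \<S> S)"
  by (simp add: topspace_beta unit_def principal_in)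

lemma unit_dense:
  assumes "S \<in> \<S>"
  shows "beta \<S> S closure_of (unit S ` S) = topspace (beta \<S> S)"
proof -
  have "homeomorphic_map (ultrafilter_space S) (beta \<S> S) (ultrafilter_code \<S> S)"
    using homeomorphic_maps_beta[OF assms] homeomorphic_maps_map by blast
  then have "beta \<S> S closure_of (ultrafilter_code \<S> S ` (principal S ` S)) =
      ultrafilter_code \<S> S ` (ultrafilter_space S closure_of (principal S ` S))"
    by (rule homeomorphic_map_closure_of) (auto simp: principal_in)
  then show ?thesis
    by (simp add: principal_dense topspace_beta[OF assms] image_image unit_def)
qed

text \<open>With \<open>beta_arr_eqI\<close> this is the universal property of the compactification:
  arrows out of it are arbitrary functions on \<open>S\<close>. Projectivity and the coproducts of
  these spaces come from it.\<close>

lemma beta_extend: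
  assumes S: "S \<in> \<S>" and K: "K \<in> CHaus_obj \<S>" and f: "f ` S \<subseteq> topspace K"
  obtains a where "a \<in> Arr (CHaus \<S>)" "Dom (CHaus \<S>) a = beta \<S> S" "Cod (CHaus \<S>) a = K"
    "\<And>s. s \<in> S \<Longrightarrow> tfun a (unit S s) = f s"
proof -
  obtain g where g: "continuous_map (ultrafilter_space S) K g" "\<And>s. s \<in> S \<Longrightarrow> g (principal S s) = f s"
    using ultrafilter_space_extend[OF CHaus_objD(1,2)[OF K] f] by blast
  let ?d = "the_inv_into (ultrafilters S) (ultrafilter_code \<S> S)"
  have "continuous_map (beta \<S> S) K (g \<circ> ?d)"
    using homeomorphic_maps_beta[OF S] g(1) unfolding homeomorphic_maps_def
    by (blast intro: continuous_map_compose)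
  then obtain a where a: "a \<in> Arr (CHaus \<S>)" "Dom (CHaus \<S>) a = beta \<S> S" "Cod (CHaus \<S>) a = K"
    "\<And>x. x \<in> topspace (beta \<S> S) \<Longrightarrow> tfun a x = (g \<circ> ?d) x"
    using CHaus_arrE[OF beta_obj[OF S] K] by blast
  have "tfun a (unit S s) = f s" if "s \<in> S" for s
    using a(4)[OF unit_in[OF S that]] g(2)[OF that]
      the_inv_into_f_f[OF ultrafilter_code(1)[OF S] principal_in[OF that]] by (simp add: unit_def)
  with a(1-3) show ?thesis
    by (rule that)
qed

text \<open>Continuous maps into a Hausdorff space that agree on the dense image of
  \<open>unit\<close> are equal.\<close>

lemma beta_arr_eqI:
  assumes S: "S \<in> \<S>" and a: "a \<in> Arr (CHaus \<S>)" "Dom (CHaus \<S>) a = beta \<S> S"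
    and b: "b \<in> Arr (CHaus \<S>)" "Dom (CHaus \<S>) b = beta \<S> S"
    and Cod: "Cod (CHaus \<S>) a = Cod (CHaus \<S>) b"
    and eq: "\<And>s. s \<in> S \<Longrightarrow> tfun a (unit S s) = tfun b (unit S s)"
  shows "a = b"
proof (rule CHaus_arr_eqI[OF a(1) b(1)])
  fix x assume "x \<in> topspace (Dom (CHaus \<S>) a)"
  then have x: "x \<in> beta \<S> S closure_of (unit S ` S)"
    by (simp add: unit_dense[OF S] a(2))
  show "tfun a x = tfun b x"
    using x CHaus_objD(2)[OF CHaus_arrD(2)[OF a(1)]]
    by (rule forall_in_closure_of_eq)
      (use CHaus_arrD(3)[OF a(1)] CHaus_arrD(3)[OF b(1)] a b Cod eq in auto)
qed (simp_all add: a b Cod)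

section \<open>Epimorphisms and kernel pairs\<close>

lemma separating_arrows:
  assumes Z: "Z \<in> CHaus_obj \<S>" and A: "closedin Z A" and z: "z \<in> topspace Z" "z \<notin> A"
  obtains g h where "g \<in> Arr (CHaus \<S>)" "h \<in> Arr (CHaus \<S>)" "Dom (CHaus \<S>) g = Z" "Dom (CHaus \<S>) h = Z"
    "Cod (CHaus \<S>) g = Cod (CHaus \<S>) h" "\<And>x. x \<in> A \<Longrightarrow> tfun g x = tfun h x" "g \<noteq> h"
proof -
  let ?Y = "Alexandroff_compactification (subtopology Z (topspace Z - A))"
  \<comment> \<open>\<open>?c\<close> collapses \<open>A\<close> to the point \<open>None\<close>.
    Compared with the constant map at that point it agrees on \<open>A\<close> and differs at
    \<open>z\<close>.\<close>
  let ?c = "\<lambda>x. if x \<in> A then None else Some x"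
  note Y = continuous_map_collapse[OF CHaus_objD(1,2)[OF Z] A]
  \<comment> \<open>The added point calls for a larger bound than \<open>topspace Z\<close>: the
    empty set and the singletons embed the new carrier into the power set.\<close>
  have "small \<S> (Pow (topspace Z))"
    by (intro small_Pow small_mem CHaus_objD(3)[OF Z])
  then have "small \<S> (topspace ?Y)"
    by (rule small_inj[where f = "case_option {} (\<lambda>x. {x})"]) (auto simp: inj_on_def)
  then obtain K e d where K: "K \<in> CHaus_obj \<S>" and ed: "homeomorphic_maps ?Y K e d"
    using realize_space Y(1,2) by blast
  have e: "continuous_map ?Y K e" and de: "\<And>y. y \<in> topspace ?Y \<Longrightarrow> d (e y) = y"
    using ed unfolding homeomorphic_maps_def by blast+
  have c: "continuous_map Z K (e \<circ> ?c)"
    using Y(3) e by (rule continuous_map_compose)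
  have "e None \<in> topspace K"
    using e by (auto simp: continuous_map_def)
  then have c': "continuous_map Z K (\<lambda>_. e None)"
    by simp
  obtain g where g: "g \<in> Arr (CHaus \<S>)" "Dom (CHaus \<S>) g = Z" "Cod (CHaus \<S>) g = K"
    "\<And>x. x \<in> topspace Z \<Longrightarrow> tfun g x = (e \<circ> ?c) x"
    by (rule CHaus_arrE[OF Z K c]) blast
  obtain h where h: "h \<in> Arr (CHaus \<S>)" "Dom (CHaus \<S>) h = Z" "Cod (CHaus \<S>) h = K"
    "\<And>x. x \<in> topspace Z \<Longrightarrow> tfun h x = e None"
    by (rule CHaus_arrE[OF Z K c']) blast
  have "d (tfun g z) = Some z" "d (tfun h z) = None"
    using z g(4)[of z] h(4)[of z] de[of "Some z"] de[of None] by simp_all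
  then have "g \<noteq> h" by auto
  moreover have "tfun g x = tfun h x" if "x \<in> A" for x
    using that closedin_subset[OF A] g(4)[of x] h(4)[of x] by auto
  ultimately show ?thesis
    using that g(1-3) h(1-3) by simp
qed

text \<open>The image of an arrow is closed, so a missed point would yield two different arrows with
  the same composite with \<open>f\<close>.\<close>

lemma epi_CHaus_iff:
  "epi (CHaus \<S>) f \<longleftrightarrow>
    f \<in> Arr (CHaus \<S>) \<and> tfun f ` topspace (Dom (CHaus \<S>) f) = topspace (Cod (CHaus \<S>) f)"
proof (intro iffI conjI)
  assume epi: "epi (CHaus \<S>) f"
  then show f: "f \<in> Arr (CHaus \<S>)"
    by (simp add: epi_def)
  let ?A = "tfun f ` topspace (Dom (CHaus \<S>) f)"
  show "?A = topspace (Cod (CHaus \<S>) f)"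
  proof (rule ccontr)
    assume "?A \<noteq> topspace (Cod (CHaus \<S>) f)"
    moreover have "?A \<subseteq> topspace (Cod (CHaus \<S>) f)"
      using tfun_in[OF f] by blast
    ultimately obtain z where z: "z \<in> topspace (Cod (CHaus \<S>) f)" "z \<notin> ?A"
      by blast
    obtain g h where gh: "g \<in> Arr (CHaus \<S>)" "h \<in> Arr (CHaus \<S>)" "Dom (CHaus \<S>) g = Cod (CHaus \<S>) f"
      "Dom (CHaus \<S>) h = Cod (CHaus \<S>) f" "Cod (CHaus \<S>) g = Cod (CHaus \<S>) h"
      "\<And>x. x \<in> ?A \<Longrightarrow> tfun g x = tfun h x" "g \<noteq> h"
      by (rule separating_arrows[OF CHaus_arrD(2)[OF f] closedin_image_arr[OF f] z]) blast
    interpret is_category "CHaus \<S>" by (rule is_category_CHaus)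
    have "Cmp (CHaus \<S>) g f = Cmp (CHaus \<S>) h f"
      by (rule CHaus_arr_eqI[of _ \<S>]) (use gh f in \<open>simp_all add: Cmp_Arr Dom_Cmp Cod_Cmp tfun_Cmp\<close>)
    then show False
      using epi gh unfolding epi_def by metis
  qed
next
  assume *: "f \<in> Arr (CHaus \<S>) \<and> tfun f ` topspace (Dom (CHaus \<S>) f) = topspace (Cod (CHaus \<S>) f)"
  then have f: "f \<in> Arr (CHaus \<S>)" by simp
  have "g = h" if g: "g \<in> Arr (CHaus \<S>)" "Dom (CHaus \<S>) g = Cod (CHaus \<S>) f"
    and h: "h \<in> Arr (CHaus \<S>)" "Dom (CHaus \<S>) h = Cod (CHaus \<S>) f"
    and Cod: "Cod (CHaus \<S>) g = Cod (CHaus \<S>) h"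
    and eq: "Cmp (CHaus \<S>) g f = Cmp (CHaus \<S>) h f" for g h
  proof (rule CHaus_arr_eqI[OF g(1) h(1)])
    fix y assume "y \<in> topspace (Dom (CHaus \<S>) g)"
    then obtain x where x: "x \<in> topspace (Dom (CHaus \<S>) f)" "y = tfun f x"
      using * g by auto
    then show "tfun g y = tfun h y"
      using tfun_Cmp[OF f g(1) x(1)] tfun_Cmp[OF f h(1) x(1)] eq by simp
  qed (simp_all add: g h Cod)
  with f show "epi (CHaus \<S>) f"
    unfolding epi_def by blast
qed

text \<open>It is realized as the subspace of the square on which the two projections agree under
  \<open>f\<close>. The Hausdorff codomain makes it closed, hence compact, and
  \<open>realize_space\<close> moves it into the universe.\<close>

lemma kernel_pair_CHaus:
  assumes f: "f \<in> Arr (CHaus \<S>)"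
  shows "\<exists>p q. pullback (CHaus \<S>) f f p q"
proof -
  interpret is_category "CHaus \<S>" by (rule is_category_CHaus)
  define Y where "Y = Dom (CHaus \<S>) f"
  define D where "D = {z \<in> topspace (prod_topology Y Y). (tfun f \<circ> fst) z = (tfun f \<circ> snd) z}"
  define E where "E = subtopology (prod_topology Y Y) D"
  have Y: "Y \<in> CHaus_obj \<S>"
    using CHaus_arrD(1)[OF f] by (simp add: Y_def)
  have cf: "continuous_map Y (Cod (CHaus \<S>) f) (tfun f)"
    using CHaus_arrD(3)[OF f] by (simp add: Y_def)
  have "closedin (prod_topology Y Y) D"
    unfolding D_def
    by (rule closedin_continuous_maps_eq[OF CHaus_objD(2)[OF CHaus_arrD(2)[OF f]]])
      (intro continuous_map_compose[OF _ cf] continuous_map_fst continuous_map_snd)+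
  moreover have "compact_space (prod_topology Y Y)" "Hausdorff_space (prod_topology Y Y)"
    using CHaus_objD[OF Y] by (simp_all add: compact_space_prod_topology Hausdorff_space_prod_topology)
  ultimately have "compact_space E" "Hausdorff_space E"
    unfolding E_def by (simp_all add: compact_space_subtopology closedin_compact_space Hausdorff_space_subtopology)
  moreover have "small \<S> (topspace E)"
    by (rule small_inj[OF small_Times[OF CHaus_objD(3)[OF Y]], where f = "\<lambda>x. x"])
      (auto simp: E_def)
  ultimately obtain K e d where K: "K \<in> CHaus_obj \<S>" and ed: "homeomorphic_maps E K e d"
    using realize_space by blast
  have e: "continuous_map E K e" and d: "continuous_map K E d"
    and de: "\<And>z. z \<in> topspace E \<Longrightarrow> d (e z) = z" and ed: "\<And>x. x \<in> topspace K \<Longrightarrow> e (d x) = x"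
    using ed unfolding homeomorphic_maps_def by blast+
  have d': "continuous_map K (prod_topology Y Y) d"
    using d unfolding E_def by (rule continuous_map_into_fulltopology)
  have top_E: "topspace E = D"
    by (auto simp: E_def D_def)
  have d_in: "d x \<in> D" if "x \<in> topspace K" for x
    using d that top_E by (auto simp: continuous_map_def)
  obtain p where p: "p \<in> Arr (CHaus \<S>)" "Dom (CHaus \<S>) p = K" "Cod (CHaus \<S>) p = Y"
    "\<And>x. x \<in> topspace K \<Longrightarrow> tfun p x = (fst \<circ> d) x"
    by (rule CHaus_arrE[OF K Y continuous_map_compose[OF d' continuous_map_fst]]) blast
  obtain q where q: "q \<in> Arr (CHaus \<S>)" "Dom (CHaus \<S>) q = K" "Cod (CHaus \<S>) q = Y"
    "\<And>x. x \<in> topspace K \<Longrightarrow> tfun q x = (snd \<circ> d) x"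
    by (rule CHaus_arrE[OF K Y continuous_map_compose[OF d' continuous_map_snd]]) blast
  have fpq: "Cmp (CHaus \<S>) f p = Cmp (CHaus \<S>) f q"
  proof (rule CHaus_arr_eqI[of _ \<S>])
    fix x assume "x \<in> topspace (Dom (CHaus \<S>) (Cmp (CHaus \<S>) f p))"
    then have x: "x \<in> topspace K"
      using f p by (simp add: Dom_Cmp Y_def)
    show "tfun (Cmp (CHaus \<S>) f p) x = tfun (Cmp (CHaus \<S>) f q) x"
      using d_in[OF x] x p q f by (simp add: tfun_Cmp D_def)
  qed (use f p q in \<open>simp_all add: Cmp_Arr Dom_Cmp Cod_Cmp Y_def\<close>)
  have univ: "\<exists>!h. h \<in> Arr (CHaus \<S>) \<and> Dom (CHaus \<S>) h = Dom (CHaus \<S>) s \<and> Cod (CHaus \<S>) h = K \<and>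
      Cmp (CHaus \<S>) p h = s \<and> Cmp (CHaus \<S>) q h = t"
    if s: "s \<in> Arr (CHaus \<S>)" "Cod (CHaus \<S>) s = Y"
      and t: "t \<in> Arr (CHaus \<S>)" "Dom (CHaus \<S>) t = Dom (CHaus \<S>) s" "Cod (CHaus \<S>) t = Y"
      and st: "Cmp (CHaus \<S>) f s = Cmp (CHaus \<S>) f t" for s t
  proof -
    let ?W = "Dom (CHaus \<S>) s"
    have st_D: "(tfun s x, tfun t x) \<in> D" if "x \<in> topspace ?W" for x
      using that tfun_in[OF s(1)] tfun_in[OF t(1)] s t tfun_Cmp[OF s(1) f, of x] tfun_Cmp[OF t(1) f, of x] st
      by (simp add: D_def)
    have "continuous_map ?W (prod_topology Y Y) (\<lambda>x. (tfun s x, tfun t x))"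
      using CHaus_arrD(3)[OF s(1)] CHaus_arrD(3)[OF t(1)] s t by (simp add: continuous_map_pairedI)
    then have "continuous_map ?W E (\<lambda>x. (tfun s x, tfun t x))"
      unfolding E_def using st_D by (simp add: continuous_map_in_subtopology image_subset_iff)
    then have "continuous_map ?W K (e \<circ> (\<lambda>x. (tfun s x, tfun t x)))"
      using e by (rule continuous_map_compose)
    then obtain h where h: "h \<in> Arr (CHaus \<S>)" "Dom (CHaus \<S>) h = ?W" "Cod (CHaus \<S>) h = K"
      "\<And>x. x \<in> topspace ?W \<Longrightarrow> tfun h x = (e \<circ> (\<lambda>x. (tfun s x, tfun t x))) x"
      by (rule CHaus_arrE[OF CHaus_arrD(1)[OF s(1)] K]) blast
    show ?thesis
    proof (rule ex1I[of _ h])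
      have dh: "d (tfun h x) = (tfun s x, tfun t x)" if "x \<in> topspace ?W" for x
        using h(4)[OF that] de st_D[OF that] top_E by simp
      have "Cmp (CHaus \<S>) p h = s"
        by (rule CHaus_arr_eqI[of _ \<S>])
          (use p h s dh tfun_in[OF h(1)] in \<open>simp_all add: Cmp_Arr Dom_Cmp Cod_Cmp tfun_Cmp\<close>)
      moreover have "Cmp (CHaus \<S>) q h = t"
        by (rule CHaus_arr_eqI[of _ \<S>])
          (use q h t dh tfun_in[OF h(1)] in \<open>simp_all add: Cmp_Arr Dom_Cmp Cod_Cmp tfun_Cmp\<close>)
      ultimately show "h \<in> Arr (CHaus \<S>) \<and> Dom (CHaus \<S>) h = ?W \<and> Cod (CHaus \<S>) h = K \<and>
          Cmp (CHaus \<S>) p h = s \<and> Cmp (CHaus \<S>) q h = t"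
        using h by simp
      fix k assume k: "k \<in> Arr (CHaus \<S>) \<and> Dom (CHaus \<S>) k = ?W \<and> Cod (CHaus \<S>) k = K \<and>
          Cmp (CHaus \<S>) p k = s \<and> Cmp (CHaus \<S>) q k = t"
      then have k_Arr: "k \<in> Arr (CHaus \<S>)" by simp
      show "k = h"
      proof (rule CHaus_arr_eqI[OF k_Arr h(1)])
        fix x assume "x \<in> topspace (Dom (CHaus \<S>) k)"
        then have x: "x \<in> topspace (Dom (CHaus \<S>) k)" "x \<in> topspace ?W" using k by simp_all
        then have kx: "tfun k x \<in> topspace K"
          using tfun_in[OF k_Arr] k by simp
        \<comment> \<open>\<open>p\<close> and \<open>q\<close> are the coordinates of
          \<open>d\<close>, so \<open>d\<close> after \<open>k\<close> is forced, and
          \<open>e\<close> undoes \<open>d\<close>.\<close>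
        have "d (tfun k x) = (tfun s x, tfun t x)"
          using tfun_Cmp[OF k_Arr p(1) x(1)] tfun_Cmp[OF k_Arr q(1) x(1)] k p(4)[OF kx] q(4)[OF kx]
          by (simp add: prod_eq_iff)
        then show "tfun k x = tfun h x"
          using ed[OF kx] h(4)[OF x(2)] by simp
      qed (use k h in simp_all)
    qed
  qed
  have "pullback (CHaus \<S>) f f p q"
    unfolding pullback_def
  proof (intro conjI ballI impI)
    fix s t assume s: "s \<in> Arr (CHaus \<S>)" and t: "t \<in> Arr (CHaus \<S>)"
      and "Dom (CHaus \<S>) s = Dom (CHaus \<S>) t \<and> Cod (CHaus \<S>) s = Dom (CHaus \<S>) f \<and>
        Cod (CHaus \<S>) t = Dom (CHaus \<S>) f \<and> Cmp (CHaus \<S>) f s = Cmp (CHaus \<S>) f t"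
    then have st: "Cod (CHaus \<S>) s = Y" "Dom (CHaus \<S>) t = Dom (CHaus \<S>) s" "Cod (CHaus \<S>) t = Y"
      "Cmp (CHaus \<S>) f s = Cmp (CHaus \<S>) f t"
      by (simp_all add: Y_def)
    show "\<exists>!h. h \<in> Arr (CHaus \<S>) \<and> Dom (CHaus \<S>) h = Dom (CHaus \<S>) s \<and>
        Cod (CHaus \<S>) h = Dom (CHaus \<S>) p \<and> Cmp (CHaus \<S>) p h = s \<and> Cmp (CHaus \<S>) q h = t"
      unfolding p(2) by (rule univ[OF s st(1) t st(2-4)])
  qed (use f p q fpq in \<open>simp_all add: Y_def\<close>)
  then show ?thesis by blast
qed

section \<open>Initial objects and coproducts of compact Hausdorff spaces\<close>

lemma initial_CHausD:
  assumes "initial (full_subcat (CHaus \<S>) P) X" "beta \<S> {} \<in> P"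
  shows "X \<in> CHaus_obj \<S>" "topspace X = {}"
proof -
  show "X \<in> CHaus_obj \<S>"
    using assms(1) by (simp add: initial_def)
  \<comment> \<open>Only an empty space maps to an empty one, and an initial object maps to the
    compactification of \<open>{}\<close> in every full subcategory that contains it. Taking
    \<open>P = UNIV\<close> covers the whole category.\<close>
  have empty: "topspace (beta \<S> {}) = {}"
    using unit_dense[OF empty_in] by simp
  have "beta \<S> {} \<in> Obj (full_subcat (CHaus \<S>) P)"
    using beta_obj[OF empty_in] assms(2) by simp
  then obtain f where "f \<in> Arr (full_subcat (CHaus \<S>) P)" "Dom (full_subcat (CHaus \<S>) P) f = X"
    "Cod (full_subcat (CHaus \<S>) P) f = beta \<S> {}"
    using assms(1) unfolding initial_def by blast
  then have f: "f \<in> Arr (CHaus \<S>)" "Dom (CHaus \<S>) f = X" "Cod (CHaus \<S>) f = beta \<S> {}"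
    by simp_all
  show "topspace X = {}"
    using tfun_in[OF f(1)] unfolding f(2,3) empty by blast
qed

text \<open>Two power sets over the empty set give two elements, so a discrete two-point space has a
  copy in the universe.\<close>

lemma two_points:
  obtains K x y where "K \<in> CHaus_obj \<S>" "x \<in> topspace K" "y \<in> topspace K" "x \<noteq> y"
proof -
  have "small \<S> (Pow (Pow {} :: 'u set set))"
    by (intro small_Pow small_mem empty_in)
  then have "small \<S> (topspace (discrete_topology (UNIV :: bool set)))"
    by (rule small_inj[where f = "\<lambda>b. if b then {{}} else {}"]) (auto simp: inj_on_def)
  then obtain K e d where K: "K \<in> CHaus_obj \<S>" and h: "homeomorphic_maps (discrete_topology (UNIV :: bool set)) K e d"
    using realize_space[of "discrete_topology (UNIV :: bool set)"]
    by (metis compact_space_discrete_topology Hausdorff_space_discrete_topology finite)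
  have de: "d (e b) = b" for b
    using h by (simp add: homeomorphic_maps_def)
  have "e b \<in> topspace K" for b
    using h by (auto simp: homeomorphic_maps_def continuous_map_def)
  moreover have "e True \<noteq> e False"
    using de by metis
  ultimately show ?thesis
    using that K by blast
qed

text \<open>No concrete model of the coproduct is fixed; this and the next two facts read off its
  points from the universal property. Here the identity of the first summand, joined with a constant
  map on the second, induces a retraction of \<open>i\<close>. The point \<open>x\<close> serves as
  the constant.\<close>

lemma coproduct_CHaus_inj:
  assumes ij: "coproduct (CHaus \<S>) i j"
  shows "inj_on (tfun i) (topspace (Dom (CHaus \<S>) i))"
proof (rule inj_onI)
  let ?X = "Dom (CHaus \<S>) i"
  fix x y assume x: "x \<in> topspace ?X" and y: "y \<in> topspace ?X" and eq: "tfun i x = tfun i y"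
  interpret is_category "CHaus \<S>" by (rule is_category_CHaus)
  have i: "i \<in> Arr (CHaus \<S>)" and j: "j \<in> Arr (CHaus \<S>)"
    using ij by (simp_all add: coproduct_def)
  have X: "?X \<in> CHaus_obj \<S>" and Y: "Dom (CHaus \<S>) j \<in> CHaus_obj \<S>"
    using CHaus_arrD(1) i j by blast+
  have "continuous_map (Dom (CHaus \<S>) j) ?X (\<lambda>_. x)"
    using x by simp
  then obtain c where c: "c \<in> Arr (CHaus \<S>)" "Dom (CHaus \<S>) c = Dom (CHaus \<S>) j" "Cod (CHaus \<S>) c = ?X"
    using CHaus_arrE[OF Y X] by blast
  have id: "Ide (CHaus \<S>) ?X \<in> Arr (CHaus \<S>)" "Dom (CHaus \<S>) (Ide (CHaus \<S>) ?X) = ?X"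
    "Cod (CHaus \<S>) (Ide (CHaus \<S>) ?X) = ?X"
    using Ide_Arr X by simp_all
  obtain h where h: "h \<in> Arr (CHaus \<S>)" "Cmp (CHaus \<S>) h i = Ide (CHaus \<S>) ?X"
    using ij c id unfolding coproduct_def by metis
  have "tfun h (tfun i z) = z" if "z \<in> topspace ?X" for z
    using tfun_Cmp[OF i h(1) that] h(2) that by simp
  with x y eq show "x = y" by metis
qed

text \<open>Send the two summands to different points of one space; the induced arrow separates
  their images.\<close>

lemma coproduct_CHaus_disjoint:
  assumes ij: "coproduct (CHaus \<S>) i j"
    and x: "x \<in> topspace (Dom (CHaus \<S>) i)" and y: "y \<in> topspace (Dom (CHaus \<S>) j)"
  shows "tfun i x \<noteq> tfun j y"
proof
  assume eq: "tfun i x = tfun j y"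
  have i: "i \<in> Arr (CHaus \<S>)" and j: "j \<in> Arr (CHaus \<S>)"
    using ij by (simp_all add: coproduct_def)
  obtain K a b where K: "K \<in> CHaus_obj \<S>" "a \<in> topspace K" "b \<in> topspace K" "a \<noteq> b"
    by (rule two_points)
  have "continuous_map (Dom (CHaus \<S>) i) K (\<lambda>_. a)"
    using K(2) by simp
  then obtain f where f: "f \<in> Arr (CHaus \<S>)" "Dom (CHaus \<S>) f = Dom (CHaus \<S>) i" "Cod (CHaus \<S>) f = K"
    "\<And>z. z \<in> topspace (Dom (CHaus \<S>) i) \<Longrightarrow> tfun f z = a"
    by (rule CHaus_arrE[OF CHaus_arrD(1)[OF i] K(1)]) blast
  have "continuous_map (Dom (CHaus \<S>) j) K (\<lambda>_. b)"
    using K(3) by simp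
  then obtain g where g: "g \<in> Arr (CHaus \<S>)" "Dom (CHaus \<S>) g = Dom (CHaus \<S>) j" "Cod (CHaus \<S>) g = K"
    "\<And>z. z \<in> topspace (Dom (CHaus \<S>) j) \<Longrightarrow> tfun g z = b"
    by (rule CHaus_arrE[OF CHaus_arrD(1)[OF j] K(1)]) blast
  obtain h where h: "h \<in> Arr (CHaus \<S>)" "Cmp (CHaus \<S>) h i = f" "Cmp (CHaus \<S>) h j = g"
    using ij f(1-3) g(1-3) unfolding coproduct_def by metis
  have "tfun h (tfun i x) = a" "tfun h (tfun j y) = b"
    using tfun_Cmp[OF i h(1) x] tfun_Cmp[OF j h(1) y] h f(4)[OF x] g(4)[OF y] by simp_all
  with eq K(4) show False by simp
qed

text \<open>The union of the two images is closed, so a point outside would give two different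
  arrows that agree on both summands, against uniqueness.\<close>

lemma coproduct_CHaus_cover:
  assumes ij: "coproduct (CHaus \<S>) i j" and z: "z \<in> topspace (Cod (CHaus \<S>) i)"
  shows "z \<in> tfun i ` topspace (Dom (CHaus \<S>) i) \<or> z \<in> tfun j ` topspace (Dom (CHaus \<S>) j)"
proof (rule ccontr)
  let ?A = "tfun i ` topspace (Dom (CHaus \<S>) i) \<union> tfun j ` topspace (Dom (CHaus \<S>) j)"
  assume "\<not> ?thesis"
  then have zA: "z \<notin> ?A" by simp
  interpret is_category "CHaus \<S>" by (rule is_category_CHaus)
  have i: "i \<in> Arr (CHaus \<S>)" and j: "j \<in> Arr (CHaus \<S>)" and Cod: "Cod (CHaus \<S>) j = Cod (CHaus \<S>) i"
    using ij by (simp_all add: coproduct_def)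
  have "closedin (Cod (CHaus \<S>) i) ?A"
    using closedin_image_arr[OF i] closedin_image_arr[OF j] Cod by (simp add: closedin_Un)
  then obtain g h where gh: "g \<in> Arr (CHaus \<S>)" "h \<in> Arr (CHaus \<S>)" "Dom (CHaus \<S>) g = Cod (CHaus \<S>) i"
    "Dom (CHaus \<S>) h = Cod (CHaus \<S>) i" "Cod (CHaus \<S>) g = Cod (CHaus \<S>) h"
    "\<And>x. x \<in> ?A \<Longrightarrow> tfun g x = tfun h x" "g \<noteq> h"
    by (rule separating_arrows[OF CHaus_arrD(2)[OF i] _ z zA]) blast
  have eq_i: "Cmp (CHaus \<S>) g i = Cmp (CHaus \<S>) h i"
    by (rule CHaus_arr_eqI[of _ \<S>]) (use gh i in \<open>simp_all add: Cmp_Arr Dom_Cmp Cod_Cmp tfun_Cmp\<close>)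
  have eq_j: "Cmp (CHaus \<S>) g j = Cmp (CHaus \<S>) h j"
    by (rule CHaus_arr_eqI[of _ \<S>]) (use gh j Cod in \<open>simp_all add: Cmp_Arr Dom_Cmp Cod_Cmp tfun_Cmp\<close>)
  have "Cmp (CHaus \<S>) g i \<in> Arr (CHaus \<S>)" "Cmp (CHaus \<S>) g j \<in> Arr (CHaus \<S>)"
    "Dom (CHaus \<S>) (Cmp (CHaus \<S>) g i) = Dom (CHaus \<S>) i" "Dom (CHaus \<S>) (Cmp (CHaus \<S>) g j) = Dom (CHaus \<S>) j"
    "Cod (CHaus \<S>) (Cmp (CHaus \<S>) g i) = Cod (CHaus \<S>) g" "Cod (CHaus \<S>) (Cmp (CHaus \<S>) g j) = Cod (CHaus \<S>) g"
    using gh i j Cod by (simp_all add: Cmp_Arr Dom_Cmp Cod_Cmp)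
  then have "\<exists>!k. k \<in> Arr (CHaus \<S>) \<and> Dom (CHaus \<S>) k = Cod (CHaus \<S>) i \<and>
      Cod (CHaus \<S>) k = Cod (CHaus \<S>) (Cmp (CHaus \<S>) g i) \<and>
      Cmp (CHaus \<S>) k i = Cmp (CHaus \<S>) g i \<and> Cmp (CHaus \<S>) k j = Cmp (CHaus \<S>) g j"
    by (intro coproductD[OF ij]) simp_all
  moreover have "Cod (CHaus \<S>) g = Cod (CHaus \<S>) (Cmp (CHaus \<S>) g i)"
    "Cod (CHaus \<S>) h = Cod (CHaus \<S>) (Cmp (CHaus \<S>) g i)"
    using gh i by (simp_all add: Cod_Cmp)
  moreover note gh(1-4) eq_i[symmetric] eq_j[symmetric]
  ultimately have "g = h"
    by blast
  with gh(7) show False by simp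
qed

text \<open>Arrows out of a compactification are functions on the underlying set, so a disjoint
  decomposition of \<open>R\<close>, with \<open>m\<close> and \<open>n\<close> the inclusions of
  the pieces, becomes a coproduct.\<close>

lemma coproduct_beta:
  assumes S: "S \<in> \<S>" and T: "T \<in> \<S>" and R: "R \<in> \<S>"
    and m: "inj_on m S" "inj_on n T" "m ` S \<inter> n ` T = {}" "m ` S \<union> n ` T = R"
    and u: "u \<in> Arr (CHaus \<S>)" "Dom (CHaus \<S>) u = beta \<S> S" "Cod (CHaus \<S>) u = beta \<S> R"
      "\<And>s. s \<in> S \<Longrightarrow> tfun u (unit S s) = unit R (m s)"
    and v: "v \<in> Arr (CHaus \<S>)" "Dom (CHaus \<S>) v = beta \<S> T" "Cod (CHaus \<S>) v = beta \<S> R"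
      "\<And>t. t \<in> T \<Longrightarrow> tfun v (unit T t) = unit R (n t)"
  shows "coproduct (CHaus \<S>) u v"
proof -
  interpret is_category "CHaus \<S>" by (rule is_category_CHaus)
  have univ: "\<exists>!h. h \<in> Arr (CHaus \<S>) \<and> Dom (CHaus \<S>) h = beta \<S> R \<and> Cod (CHaus \<S>) h = Cod (CHaus \<S>) f \<and>
      Cmp (CHaus \<S>) h u = f \<and> Cmp (CHaus \<S>) h v = g"
    if f: "f \<in> Arr (CHaus \<S>)" "Dom (CHaus \<S>) f = beta \<S> S"
      and g: "g \<in> Arr (CHaus \<S>)" "Dom (CHaus \<S>) g = beta \<S> T" "Cod (CHaus \<S>) g = Cod (CHaus \<S>) f" for f g
  proof -
    define w where "w r = (if r \<in> m ` S then tfun f (unit S (inv_into S m r))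
      else tfun g (unit T (inv_into T n r)))" for r
    have w_m: "w (m s) = tfun f (unit S s)" if "s \<in> S" for s
      using that m(1) by (simp add: w_def)
    have w_n: "w (n t) = tfun g (unit T t)" if "t \<in> T" for t
    proof -
      have "n t \<notin> m ` S"
        using that m(3) by blast
      then show ?thesis
        using that m(2) by (simp add: w_def)
    qed
    have w_in: "w ` R \<subseteq> topspace (Cod (CHaus \<S>) f)"
    proof
      fix k assume "k \<in> w ` R"
      then consider s where "s \<in> S" "k = w (m s)" | t where "t \<in> T" "k = w (n t)"
        using m(4) by blast
      then show "k \<in> topspace (Cod (CHaus \<S>) f)"
      proof cases
        case 1
        then show ?thesis
          using tfun_in[OF f(1)] unit_in[OF S] f by (simp add: w_m)
      next
        case 2
        then show ?thesis
          using tfun_in[OF g(1)] unit_in[OF T] g by (simp add: w_n)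
      qed
    qed
    obtain h where h: "h \<in> Arr (CHaus \<S>)" "Dom (CHaus \<S>) h = beta \<S> R" "Cod (CHaus \<S>) h = Cod (CHaus \<S>) f"
      "\<And>r. r \<in> R \<Longrightarrow> tfun h (unit R r) = w r"
      by (rule beta_extend[OF R CHaus_arrD(2)[OF f(1)] w_in]) blast
    have mn: "\<And>s. s \<in> S \<Longrightarrow> m s \<in> R" "\<And>t. t \<in> T \<Longrightarrow> n t \<in> R"
      using m(4) by blast+
    have hu: "Cmp (CHaus \<S>) k u \<in> Arr (CHaus \<S>)" "Dom (CHaus \<S>) (Cmp (CHaus \<S>) k u) = beta \<S> S"
      "Cod (CHaus \<S>) (Cmp (CHaus \<S>) k u) = Cod (CHaus \<S>) k"
      "\<And>s. s \<in> S \<Longrightarrow> tfun (Cmp (CHaus \<S>) k u) (unit S s) = tfun k (unit R (m s))"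
      and hv: "Cmp (CHaus \<S>) k v \<in> Arr (CHaus \<S>)" "Dom (CHaus \<S>) (Cmp (CHaus \<S>) k v) = beta \<S> T"
      "Cod (CHaus \<S>) (Cmp (CHaus \<S>) k v) = Cod (CHaus \<S>) k"
      "\<And>t. t \<in> T \<Longrightarrow> tfun (Cmp (CHaus \<S>) k v) (unit T t) = tfun k (unit R (n t))"
      if "k \<in> Arr (CHaus \<S>)" "Dom (CHaus \<S>) k = beta \<S> R" for k
      using that u v unit_in[OF S] unit_in[OF T]
      by (simp_all add: Cmp_Arr Dom_Cmp Cod_Cmp tfun_Cmp)
    show ?thesis
    proof (rule ex1I[of _ h])
      have "Cmp (CHaus \<S>) h u = f"
        by (rule beta_arr_eqI[OF S hu(1,2)[OF h(1,2)] f]) (simp_all add: hu[OF h(1,2)] h mn w_m)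
      moreover have "Cmp (CHaus \<S>) h v = g"
        by (rule beta_arr_eqI[OF T hv(1,2)[OF h(1,2)] g(1,2)]) (simp_all add: hv[OF h(1,2)] h mn w_n g)
      ultimately show "h \<in> Arr (CHaus \<S>) \<and> Dom (CHaus \<S>) h = beta \<S> R \<and> Cod (CHaus \<S>) h = Cod (CHaus \<S>) f \<and>
          Cmp (CHaus \<S>) h u = f \<and> Cmp (CHaus \<S>) h v = g"
        using h by simp
      fix k assume k: "k \<in> Arr (CHaus \<S>) \<and> Dom (CHaus \<S>) k = beta \<S> R \<and> Cod (CHaus \<S>) k = Cod (CHaus \<S>) f \<and>
          Cmp (CHaus \<S>) k u = f \<and> Cmp (CHaus \<S>) k v = g"
      then have k': "k \<in> Arr (CHaus \<S>)" "Dom (CHaus \<S>) k = beta \<S> R" by simp_all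
      show "k = h"
      proof (rule beta_arr_eqI[OF R k' h(1,2)])
        fix r assume "r \<in> R"
        then consider s where "s \<in> S" "r = m s" | t where "t \<in> T" "r = n t"
          using m(4) by blast
        then show "tfun k (unit R r) = tfun h (unit R r)"
        proof cases
          case 1
          then show ?thesis
            using hu(4)[OF k', of s] k h(4)[of r] mn w_m by simp
        next
          case 2
          then show ?thesis
            using hv(4)[OF k', of t] k h(4)[of r] mn w_n by simp
        qed
      qed (use k h in simp)
    qed
  qed
  show ?thesis
  proof (rule coproductI)
    fix f g assume "f \<in> Arr (CHaus \<S>)" "g \<in> Arr (CHaus \<S>)" "Dom (CHaus \<S>) f = Dom (CHaus \<S>) u"
      "Dom (CHaus \<S>) g = Dom (CHaus \<S>) v" "Cod (CHaus \<S>) f = Cod (CHaus \<S>) g"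
    then show "\<exists>!h. h \<in> Arr (CHaus \<S>) \<and> Dom (CHaus \<S>) h = Cod (CHaus \<S>) u \<and>
        Cod (CHaus \<S>) h = Cod (CHaus \<S>) f \<and> Cmp (CHaus \<S>) h u = f \<and> Cmp (CHaus \<S>) h v = g"
      unfolding u(3) by (intro univ) (simp_all add: u(2) v(2))
  qed (use u v in simp_all)
qed

text \<open>The disjoint sum lives on another type; \<open>R\<close> is its copy in
  \<open>\<S>\<close>, which exists by \<open>small_Plus\<close>.\<close>

lemma coproduct_beta_exists:
  assumes S: "S \<in> \<S>" and T: "T \<in> \<S>"
  shows "\<exists>u v. coproduct (CHaus \<S>) u v \<and> Dom (CHaus \<S>) u = beta \<S> S \<and> Dom (CHaus \<S>) v = beta \<S> T \<and>
    Cod (CHaus \<S>) u \<in> beta \<S> ` \<S>"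
proof -
  obtain e where e: "inj_on e (S <+> T)" "e ` (S <+> T) \<in> \<S>"
    using small_Plus[OF S T] unfolding small_def by blast
  define R where "R = e ` (S <+> T)"
  have R: "R \<in> \<S>"
    using e(2) by (simp add: R_def)
  have "(\<lambda>s. unit R (e (Inl s))) ` S \<subseteq> topspace (beta \<S> R)"
    by (rule image_subsetI, rule unit_in[OF R]) (auto simp: R_def)
  then obtain u where u: "u \<in> Arr (CHaus \<S>)" "Dom (CHaus \<S>) u = beta \<S> S" "Cod (CHaus \<S>) u = beta \<S> R"
    "\<And>s. s \<in> S \<Longrightarrow> tfun u (unit S s) = unit R (e (Inl s))"
    by (rule beta_extend[OF S beta_obj[OF R]]) blast
  have "(\<lambda>t. unit R (e (Inr t))) ` T \<subseteq> topspace (beta \<S> R)"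
    by (rule image_subsetI, rule unit_in[OF R]) (auto simp: R_def)
  then obtain v where v: "v \<in> Arr (CHaus \<S>)" "Dom (CHaus \<S>) v = beta \<S> T" "Cod (CHaus \<S>) v = beta \<S> R"
    "\<And>t. t \<in> T \<Longrightarrow> tfun v (unit T t) = unit R (e (Inr t))"
    by (rule beta_extend[OF T beta_obj[OF R]]) blast
  have "coproduct (CHaus \<S>) u v"
  proof (rule coproduct_beta[OF S T R _ _ _ _ u v])
    show "inj_on (\<lambda>s. e (Inl s)) S" "inj_on (\<lambda>t. e (Inr t)) T"
      using e(1) by (auto simp: inj_on_def)
    show "(\<lambda>s. e (Inl s)) ` S \<inter> (\<lambda>t. e (Inr t)) ` T = {}"
      using e(1) by (auto simp: inj_on_def)
    show "(\<lambda>s. e (Inl s)) ` S \<union> (\<lambda>t. e (Inr t)) ` T = R"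
      by (auto simp: R_def)
  qed
  then show ?thesis
    using u v R by blast
qed

text \<open>\<open>A\<close> collects the points of \<open>S\<close> that \<open>g\<close> sends
  into the first summand. A test arrow \<open>r\<close> whose composite with \<open>g\<close> runs
  through \<open>i\<close> avoids the image of \<open>v\<close>, so its values lie in the image of
  \<open>u\<close>.\<close>

lemma weak_pullback_beta:
  assumes ij: "coproduct (CHaus \<S>) i j" and S: "S \<in> \<S>"
    and g: "g \<in> Arr (CHaus \<S>)" "Dom (CHaus \<S>) g = beta \<S> S" "Cod (CHaus \<S>) g = Cod (CHaus \<S>) i"
    and A: "A = {s \<in> S. tfun g (unit S s) \<in> tfun i ` topspace (Dom (CHaus \<S>) i)}"
    and u: "u \<in> Arr (CHaus \<S>)" "Dom (CHaus \<S>) u = beta \<S> A" "Cod (CHaus \<S>) u = beta \<S> S"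
      "\<And>s. s \<in> A \<Longrightarrow> tfun u (unit A s) = unit S s"
    and v: "v \<in> Arr (CHaus \<S>)" "Dom (CHaus \<S>) v = beta \<S> (S - A)" "Cod (CHaus \<S>) v = beta \<S> S"
      "\<And>s. s \<in> S - A \<Longrightarrow> tfun v (unit (S - A) s) = unit S s"
  shows "\<exists>k. weak_pullback_on (CHaus \<S>) (beta \<S> ` \<S>) i g u k"
proof -
  interpret is_category "CHaus \<S>" by (rule is_category_CHaus)
  have i: "i \<in> Arr (CHaus \<S>)" and j: "j \<in> Arr (CHaus \<S>)" and Cod: "Cod (CHaus \<S>) j = Cod (CHaus \<S>) i"
    using ij by (simp_all add: coproduct_def)
  let ?X = "Dom (CHaus \<S>) i" and ?Y = "Dom (CHaus \<S>) j"
  have AS: "A \<in> \<S>" "S - A \<in> \<S>" "A \<subseteq> S"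
    using subset_closed[OF S] by (auto simp: A)
  have inj_i: "inj_on (tfun i) (topspace ?X)"
    by (rule coproduct_CHaus_inj[OF ij])
  have g_unit: "tfun g (unit S s) \<in> topspace (Cod (CHaus \<S>) i)" if "s \<in> S" for s
    using tfun_in[OF g(1)] unit_in[OF S that] g by simp
  have "(\<lambda>s. inv_into (topspace ?X) (tfun i) (tfun g (unit S s))) ` A \<subseteq> topspace ?X"
    by (auto simp: A intro: inv_into_into)
  \<comment> \<open>On \<open>A\<close> the arrow \<open>g\<close> is pulled back pointwise through
    the injective \<open>i\<close>; extending this function gives \<open>k\<close>.\<close>
  then obtain k where k: "k \<in> Arr (CHaus \<S>)" "Dom (CHaus \<S>) k = beta \<S> A" "Cod (CHaus \<S>) k = ?X"
    "\<And>s. s \<in> A \<Longrightarrow> tfun k (unit A s) = inv_into (topspace ?X) (tfun i) (tfun g (unit S s))"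
    by (rule beta_extend[OF AS(1) CHaus_arrD(1)[OF i]]) blast
  have "(\<lambda>s. inv_into (topspace ?Y) (tfun j) (tfun g (unit S s))) ` (S - A) \<subseteq> topspace ?Y"
    using coproduct_CHaus_cover[OF ij] g_unit by (auto simp: A intro!: inv_into_into)
  \<comment> \<open>\<open>l\<close> serves the second summand: it shows that \<open>g\<close> sends
    the whole image of \<open>v\<close>, beyond the points of \<open>S - A\<close>, into the image
    of \<open>j\<close>.\<close>
  then obtain l where l: "l \<in> Arr (CHaus \<S>)" "Dom (CHaus \<S>) l = beta \<S> (S - A)" "Cod (CHaus \<S>) l = ?Y"
    "\<And>s. s \<in> S - A \<Longrightarrow> tfun l (unit (S - A) s) = inv_into (topspace ?Y) (tfun j) (tfun g (unit S s))"
    by (rule beta_extend[OF AS(2) CHaus_arrD(1)[OF j]]) blast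
  have gu: "Cmp (CHaus \<S>) g u = Cmp (CHaus \<S>) i k"
  proof (rule beta_arr_eqI[OF AS(1)])
    fix s assume s: "s \<in> A"
    then have "tfun i (tfun k (unit A s)) = tfun g (unit S s)"
      using k(4)[OF s] by (simp add: A f_inv_into_f)
    then show "tfun (Cmp (CHaus \<S>) g u) (unit A s) = tfun (Cmp (CHaus \<S>) i k) (unit A s)"
      using u(4)[OF s] unit_in[OF AS(1) s] g u k i by (simp add: tfun_Cmp)
  qed (use g u i k in \<open>simp_all add: Cmp_Arr Dom_Cmp Cod_Cmp\<close>)
  have gv: "Cmp (CHaus \<S>) g v = Cmp (CHaus \<S>) j l"
  proof (rule beta_arr_eqI[OF AS(2)])
    fix s assume s: "s \<in> S - A"
    then have "tfun g (unit S s) \<in> tfun j ` topspace ?Y"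
      using coproduct_CHaus_cover[OF ij] g_unit[of s] by (auto simp: A)
    then have "tfun j (tfun l (unit (S - A) s)) = tfun g (unit S s)"
      using l(4)[OF s] by (simp add: f_inv_into_f)
    then show "tfun (Cmp (CHaus \<S>) g v) (unit (S - A) s) = tfun (Cmp (CHaus \<S>) j l) (unit (S - A) s)"
      using v(4)[OF s] unit_in[OF AS(2) s] g v l j by (simp add: tfun_Cmp)
  qed (use g v j l Cod in \<open>simp_all add: Cmp_Arr Dom_Cmp Cod_Cmp\<close>)
  have cover: "x \<in> tfun u ` topspace (beta \<S> A) \<or> x \<in> tfun v ` topspace (beta \<S> (S - A))"
    if x: "x \<in> topspace (beta \<S> S)" for x
  proof -
    let ?I = "tfun u ` topspace (beta \<S> A) \<union> tfun v ` topspace (beta \<S> (S - A))"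
    \<comment> \<open>The two images form a closed set that contains the dense points from
      \<open>S\<close>.\<close>
    have "closedin (beta \<S> S) ?I"
      using closedin_image_arr[OF u(1)] closedin_image_arr[OF v(1)] u(2,3) v(2,3) by (simp add: closedin_Un)
    moreover have "unit S ` S \<subseteq> ?I"
    proof
      fix y assume "y \<in> unit S ` S"
      then consider s where "s \<in> A" "y = unit S s" | s where "s \<in> S - A" "y = unit S s"
        by blast
      then show "y \<in> ?I"
      proof cases
        case 1
        then show ?thesis
          using u(4)[of s] unit_in[OF AS(1), of s] by (metis UnI1 imageI)
      next
        case 2
        then show ?thesis
          using v(4)[of s] unit_in[OF AS(2), of s] by (metis UnI2 imageI)
      qed
    qed
    ultimately have "beta \<S> S closure_of (unit S ` S) \<subseteq> ?I"
      by (rule closure_of_minimal[rotated])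
    then show ?thesis
      using x unit_dense[OF S] by blast
  qed
  have factor: "\<exists>c\<in>Arr (CHaus \<S>). Dom (CHaus \<S>) c = Dom (CHaus \<S>) r \<and> Cod (CHaus \<S>) c = beta \<S> A \<and>
      Cmp (CHaus \<S>) u c = r \<and> Cmp (CHaus \<S>) k c = s"
    if r: "r \<in> Arr (CHaus \<S>)" "Dom (CHaus \<S>) r = beta \<S> T" "Cod (CHaus \<S>) r = beta \<S> S" and T: "T \<in> \<S>"
      and s: "s \<in> Arr (CHaus \<S>)" "Dom (CHaus \<S>) s = beta \<S> T" "Cod (CHaus \<S>) s = ?X"
      and eq: "Cmp (CHaus \<S>) g r = Cmp (CHaus \<S>) i s" for r s T
  proof -
    have "\<exists>y\<in>topspace (beta \<S> A). tfun u y = tfun r (unit T t)" if t: "t \<in> T" for t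
    proof -
      have rt: "tfun r (unit T t) \<in> topspace (beta \<S> S)"
        using tfun_in[OF r(1)] unit_in[OF T t] r by simp
      have "tfun r (unit T t) \<notin> tfun v ` topspace (beta \<S> (S - A))"
      proof
        assume "tfun r (unit T t) \<in> tfun v ` topspace (beta \<S> (S - A))"
        then obtain y where y: "y \<in> topspace (beta \<S> (S - A))" "tfun r (unit T t) = tfun v y"
          by blast
        have "tfun g (tfun v y) = tfun j (tfun l y)"
          using tfun_Cmp[OF v(1) g(1), of y] tfun_Cmp[OF l(1) j, of y] gv y v l by simp
        moreover have "tfun g (tfun r (unit T t)) = tfun i (tfun s (unit T t))"
          using tfun_Cmp[OF r(1) g(1), of "unit T t"] tfun_Cmp[OF s(1) i, of "unit T t"] eq
            unit_in[OF T t] r s by simp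
        ultimately have "tfun i (tfun s (unit T t)) = tfun j (tfun l y)"
          using y by simp
        moreover have "tfun s (unit T t) \<in> topspace ?X"
          using tfun_in[OF s(1), of "unit T t"] unit_in[OF T t] s by simp
        moreover have "tfun l y \<in> topspace ?Y"
          using tfun_in[OF l(1), of y] y l by simp
        ultimately show False
          using coproduct_CHaus_disjoint[OF ij] by blast
      qed
      then have "tfun r (unit T t) \<in> tfun u ` topspace (beta \<S> A)"
        using cover[OF rt] by blast
      then show ?thesis
        by (metis imageE)
    qed
    \<comment> \<open>Preimages under \<open>u\<close> are chosen only at the points of
      \<open>T\<close> and then extended; the factorization through \<open>u\<close> holds by
      density.\<close>
    then obtain c0 where c0: "\<And>t. t \<in> T \<Longrightarrow> c0 t \<in> topspace (beta \<S> A)"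
      "\<And>t. t \<in> T \<Longrightarrow> tfun u (c0 t) = tfun r (unit T t)"
      by metis
    have "c0 ` T \<subseteq> topspace (beta \<S> A)"
      using c0(1) by blast
    then obtain c where c: "c \<in> Arr (CHaus \<S>)" "Dom (CHaus \<S>) c = beta \<S> T" "Cod (CHaus \<S>) c = beta \<S> A"
      "\<And>t. t \<in> T \<Longrightarrow> tfun c (unit T t) = c0 t"
      by (rule beta_extend[OF T beta_obj[OF AS(1)]]) blast
    have uc: "Cmp (CHaus \<S>) u c = r"
      by (rule beta_arr_eqI[OF T])
        (use u c r c0 unit_in[OF T] in \<open>simp_all add: Cmp_Arr Dom_Cmp Cod_Cmp tfun_Cmp\<close>)
    \<comment> \<open>Both sides agree after \<open>i\<close>, which is injective.\<close>
    have "Cmp (CHaus \<S>) k c = s"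
    proof (rule CHaus_arr_eqI[OF _ s(1)])
      fix x assume "x \<in> topspace (Dom (CHaus \<S>) (Cmp (CHaus \<S>) k c))"
      then have x: "x \<in> topspace (beta \<S> T)"
        using k c by (simp add: Dom_Cmp)
      have cx: "tfun c x \<in> topspace (beta \<S> A)"
        using tfun_in[OF c(1), of x] x c by simp
      have "tfun i (tfun k (tfun c x)) = tfun g (tfun u (tfun c x))"
        using tfun_Cmp[OF u(1) g(1), of "tfun c x"] tfun_Cmp[OF k(1) i, of "tfun c x"] gu cx u k by simp
      also have "\<dots> = tfun g (tfun r x)"
        using tfun_Cmp[OF c(1) u(1), of x] uc x c by simp
      also have "\<dots> = tfun i (tfun s x)"
        using tfun_Cmp[OF r(1) g(1), of x] tfun_Cmp[OF s(1) i, of x] eq x r s by simp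
      finally have "tfun k (tfun c x) = tfun s x"
        using inj_onD[OF inj_i] tfun_in[OF k(1), of "tfun c x"] tfun_in[OF s(1), of x] cx x k s by simp
      then show "tfun (Cmp (CHaus \<S>) k c) x = tfun s x"
        using tfun_Cmp[OF c(1) k(1), of x] x c by simp
    qed (use k c s in \<open>simp_all add: Cmp_Arr Dom_Cmp Cod_Cmp\<close>)
    with c uc r show ?thesis by auto
  qed
  have "weak_pullback_on (CHaus \<S>) (beta \<S> ` \<S>) i g u k"
    unfolding weak_pullback_on_def
  proof (intro conjI ballI impI)
    fix r s assume r: "r \<in> Arr (CHaus \<S>)" and s: "s \<in> Arr (CHaus \<S>)"
      and rs: "Dom (CHaus \<S>) r \<in> beta \<S> ` \<S> \<and> Dom (CHaus \<S>) s = Dom (CHaus \<S>) r \<and>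
        Cod (CHaus \<S>) r = Dom (CHaus \<S>) g \<and> Cod (CHaus \<S>) s = Dom (CHaus \<S>) i \<and>
        Cmp (CHaus \<S>) g r = Cmp (CHaus \<S>) i s"
    then obtain T where T: "T \<in> \<S>" "Dom (CHaus \<S>) r = beta \<S> T"
      by blast
    show "\<exists>c\<in>Arr (CHaus \<S>). Dom (CHaus \<S>) c = Dom (CHaus \<S>) r \<and> Cod (CHaus \<S>) c = Dom (CHaus \<S>) u \<and>
        Cmp (CHaus \<S>) u c = r \<and> Cmp (CHaus \<S>) k c = s"
      unfolding u(2) using r s rs T g(2) by (intro factor[of r T s]) simp_all
  qed (use u g k gu AS in simp_all)
  then show ?thesis by blast
qed

text \<open>The complement of \<open>A\<close> collects the points over the second summand, so the
  weak pullback along \<open>j\<close> is obtained like the one along \<open>i\<close>, with the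
  summands and the pieces exchanged.\<close>

lemma coproduct_decompose_beta:
  assumes ij: "coproduct (CHaus \<S>) i j" and S: "S \<in> \<S>"
    and g: "g \<in> Arr (CHaus \<S>)" "Dom (CHaus \<S>) g = beta \<S> S" "Cod (CHaus \<S>) g = Cod (CHaus \<S>) i"
  shows "\<exists>u v k l. coproduct (full_subcat (CHaus \<S>) (beta \<S> ` \<S>)) u v \<and> Cod (CHaus \<S>) u = beta \<S> S \<and>
    weak_pullback_on (CHaus \<S>) (beta \<S> ` \<S>) i g u k \<and> weak_pullback_on (CHaus \<S>) (beta \<S> ` \<S>) j g v l"
proof -
  have Cod: "Cod (CHaus \<S>) j = Cod (CHaus \<S>) i"
    using ij by (simp add: coproduct_def)
  define A where "A = {s \<in> S. tfun g (unit S s) \<in> tfun i ` topspace (Dom (CHaus \<S>) i)}"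
  have AS: "A \<in> \<S>" "S - A \<in> \<S>" "A \<subseteq> S"
    using subset_closed[OF S] by (auto simp: A_def)
  have g_unit: "tfun g (unit S s) \<in> topspace (Cod (CHaus \<S>) i)" if "s \<in> S" for s
    using tfun_in[OF g(1)] unit_in[OF S that] g by simp
  have A': "S - A = {s \<in> S. tfun g (unit S s) \<in> tfun j ` topspace (Dom (CHaus \<S>) j)}"
  proof -
    have "tfun g (unit S s) \<in> tfun j ` topspace (Dom (CHaus \<S>) j) \<longleftrightarrow>
        tfun g (unit S s) \<notin> tfun i ` topspace (Dom (CHaus \<S>) i)" if "s \<in> S" for s
    proof
      assume "tfun g (unit S s) \<in> tfun j ` topspace (Dom (CHaus \<S>) j)"
      then obtain y where y: "tfun g (unit S s) = tfun j y" "y \<in> topspace (Dom (CHaus \<S>) j)"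
        by (rule imageE)
      show "tfun g (unit S s) \<notin> tfun i ` topspace (Dom (CHaus \<S>) i)"
      proof
        assume "tfun g (unit S s) \<in> tfun i ` topspace (Dom (CHaus \<S>) i)"
        then obtain x where x: "tfun g (unit S s) = tfun i x" "x \<in> topspace (Dom (CHaus \<S>) i)"
          by (rule imageE)
        show False
          using coproduct_CHaus_disjoint[OF ij x(2) y(2)] x(1) y(1) by simp
      qed
    next
      assume "tfun g (unit S s) \<notin> tfun i ` topspace (Dom (CHaus \<S>) i)"
      then show "tfun g (unit S s) \<in> tfun j ` topspace (Dom (CHaus \<S>) j)"
        using coproduct_CHaus_cover[OF ij g_unit[OF that]] by simp
    qed
    then show ?thesis
      by (auto simp: A_def)
  qed
  have "unit S ` A \<subseteq> topspace (beta \<S> S)" "unit S ` (S - A) \<subseteq> topspace (beta \<S> S)"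
    using unit_in[OF S] AS(3) by blast+
  note extend = beta_extend[OF AS(1) beta_obj[OF S] this(1)] beta_extend[OF AS(2) beta_obj[OF S] this(2)]
  obtain u where u: "u \<in> Arr (CHaus \<S>)" "Dom (CHaus \<S>) u = beta \<S> A" "Cod (CHaus \<S>) u = beta \<S> S"
    "\<And>s. s \<in> A \<Longrightarrow> tfun u (unit A s) = unit S s"
    by (rule extend(1)) blast
  obtain v where v: "v \<in> Arr (CHaus \<S>)" "Dom (CHaus \<S>) v = beta \<S> (S - A)" "Cod (CHaus \<S>) v = beta \<S> S"
    "\<And>s. s \<in> S - A \<Longrightarrow> tfun v (unit (S - A) s) = unit S s"
    by (rule extend(2)) blast
  have "coproduct (CHaus \<S>) u v"
    by (rule coproduct_beta[OF AS(1,2) S, of "\<lambda>s. s" "\<lambda>s. s"]) (use u v AS(3) in auto)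
  then have cop: "coproduct (full_subcat (CHaus \<S>) (beta \<S> ` \<S>)) u v"
    by (rule coproduct_full_subcat) (use u v AS S in auto)
  obtain k where k: "weak_pullback_on (CHaus \<S>) (beta \<S> ` \<S>) i g u k"
    using weak_pullback_beta[OF ij S g A_def u v] by blast
  \<comment> \<open>Exchanging the pieces asks for the complement of \<open>S - A\<close>.\<close>
  have double: "S - (S - A) = A"
    using AS(3) by blast
  have "\<exists>l. weak_pullback_on (CHaus \<S>) (beta \<S> ` \<S>) j g v l"
    by (rule weak_pullback_beta[OF coproduct_sym[OF ij] S g(1,2) _ A' v u(1) _ u(3)])
      (simp_all only: double u(2,4) Cod g(3))
  then obtain l where "weak_pullback_on (CHaus \<S>) (beta \<S> ` \<S>) j g v l"
    by blast
  with cop k u(3) show ?thesis by blast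
qed

lemma projective_site_CHaus: "projective_site (CHaus \<S>) (beta \<S> ` \<S>)"
proof (intro projective_site.intro projective_site_axioms.intro is_category_CHaus)
  let ?C = "CHaus \<S>" and ?P = "beta \<S> ` \<S>"
  interpret is_category ?C by (rule is_category_CHaus)
  have beta_empty: "beta \<S> {} \<in> ?P"
    using empty_in by blast
  show "X \<in> Obj ?C" if "X \<in> ?P" for X
    using that beta_obj by auto
  show "\<exists>e. epi ?C e \<and> Dom ?C e \<in> ?P \<and> Cod ?C e = X" if "X \<in> Obj ?C" for X
  proof -
    let ?S = "topspace X"
    have X: "X \<in> CHaus_obj \<S>" and S: "?S \<in> \<S>"
      using that CHaus_objD(3) by simp_all
    have "(\<lambda>x. x) ` ?S \<subseteq> topspace X"
      by simp
    \<comment> \<open>Extending the identity function of the underlying set gives a continuous map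
      onto \<open>X\<close>.\<close>
    then obtain e where e: "e \<in> Arr ?C" "Dom ?C e = beta \<S> ?S" "Cod ?C e = X"
      "\<And>s. s \<in> ?S \<Longrightarrow> tfun e (unit ?S s) = s"
      by (rule beta_extend[OF S X]) blast
    have "x \<in> tfun e ` topspace (beta \<S> ?S)" if "x \<in> ?S" for x
      using e(4)[OF that] unit_in[OF S that] by (metis imageI)
    then have "tfun e ` topspace (beta \<S> ?S) = ?S"
      using tfun_in[OF e(1)] e by auto
    then show ?thesis
      using e(1-3) S by (intro exI[of _ e]) (simp add: epi_CHaus_iff)
  qed
  show "\<exists>l\<in>Arr ?C. Dom ?C l = Dom ?C g \<and> Cod ?C l = Dom ?C f \<and> Cmp ?C f l = g"
    if epi: "epi ?C f" and g: "g \<in> Arr ?C" "Dom ?C g \<in> ?P" "Cod ?C g = Cod ?C f" for f g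
  proof -
    obtain S where S: "S \<in> \<S>" "Dom ?C g = beta \<S> S"
      using g(2) by blast
    have f: "f \<in> Arr ?C" "tfun f ` topspace (Dom ?C f) = topspace (Cod ?C f)"
      using epi by (simp_all add: epi_CHaus_iff)
    \<comment> \<open>Surjectivity provides a lift at each point of \<open>S\<close>; by the
      universal property any choice of these lifts extends to an arrow.\<close>
    have "\<exists>y\<in>topspace (Dom ?C f). tfun f y = tfun g (unit S s)" if "s \<in> S" for s
    proof -
      have "tfun g (unit S s) \<in> tfun f ` topspace (Dom ?C f)"
        using tfun_in[OF g(1), of "unit S s"] unit_in[OF S(1) that] S(2) g(3) f(2) by simp
      then show ?thesis
        by (metis imageE)
    qed
    then obtain y where y: "\<And>s. s \<in> S \<Longrightarrow> y s \<in> topspace (Dom ?C f)"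
      "\<And>s. s \<in> S \<Longrightarrow> tfun f (y s) = tfun g (unit S s)"
      by metis
    have "y ` S \<subseteq> topspace (Dom ?C f)"
      using y(1) by blast
    then obtain l where l: "l \<in> Arr ?C" "Dom ?C l = beta \<S> S" "Cod ?C l = Dom ?C f"
      "\<And>s. s \<in> S \<Longrightarrow> tfun l (unit S s) = y s"
      by (rule beta_extend[OF S(1) CHaus_arrD(1)[OF f(1)]]) blast
    have "Cmp ?C f l = g"
      by (rule beta_arr_eqI[OF S(1)])
        (use f l g S y unit_in[OF S(1)] in \<open>simp_all add: Cmp_Arr Dom_Cmp Cod_Cmp tfun_Cmp\<close>)
    with l S(2) show ?thesis by auto
  qed
  show "\<exists>p q. pullback ?C f f p q" if "epi ?C f" for f
    using that by (intro kernel_pair_CHaus) (simp add: epi_CHaus_iff)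
  show "initial ?C X" if "initial (full_subcat ?C ?P) X" for X
    using initial_CHausD[OF that beta_empty] by (rule initial_CHausI)
  show "initial (full_subcat ?C ?P) (Dom ?C f)"
    if X: "initial ?C X" and f: "f \<in> Arr ?C" "Dom ?C f \<in> ?P" "Cod ?C f = X" for X f
  proof (rule initial_full_subcat[OF initial_CHausI])
    \<comment> \<open>Writing the whole category as a full subcategory makes
      \<open>initial_CHausD\<close> applicable.\<close>
    have "initial (full_subcat ?C UNIV) X"
      using X by (simp add: full_subcat_UNIV)
    then have empty: "topspace X = {}"
      by (rule initial_CHausD) simp
    show "topspace (Dom ?C f) = {}"
      using tfun_in[OF f(1)] unfolding f(3) empty by blast
  qed (use CHaus_arrD(1)[OF f(1)] f(2) in simp_all)
  show "coproduct ?C i j" if ij: "coproduct (full_subcat ?C ?P) i j" for i j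
  proof -
    have "Dom ?C i \<in> ?P" "Dom ?C j \<in> ?P"
      using ij by (simp_all add: coproduct_def)
    then obtain S T where ST: "S \<in> \<S>" "T \<in> \<S>" "Dom ?C i = beta \<S> S" "Dom ?C j = beta \<S> T"
      by blast
    \<comment> \<open>The sum of \<open>S\<close> and \<open>T\<close> provides a coproduct of the
      whole category with vertex in the subcategory, to which the given one is compared.\<close>
    obtain u v where "coproduct ?C u v" "Dom ?C u = beta \<S> S" "Dom ?C v = beta \<S> T" "Cod ?C u \<in> ?P"
      using coproduct_beta_exists[OF ST(1,2)] by blast
    then show ?thesis
      using coproduct_from_full_subcat[OF is_category_CHaus ij] ST by simp
  qed
  show "\<exists>u v k l. coproduct (full_subcat ?C ?P) u v \<and> Cod ?C u = Dom ?C g \<and>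
      weak_pullback_on ?C ?P i g u k \<and> weak_pullback_on ?C ?P j g v l"
    if ij: "coproduct ?C i j" and g: "g \<in> Arr ?C" "Dom ?C g \<in> ?P" "Cod ?C g = Cod ?C i" for i j g
  proof -
    obtain S where S: "S \<in> \<S>" "Dom ?C g = beta \<S> S"
      using g(2) by blast
    show ?thesis
      using coproduct_decompose_beta[OF ij S(1) g(1) S(2) g(3)] S(2) by simp
  qed
qed

end

theorem corollary3p4:
  fixes \<S> :: "'u set set"
  assumes "set_universe \<S>"
  shows "is_functor (PSh \<S> (CHaus \<S>)) (PSh \<S> (betaSets \<S>)) (Res \<S>) \<and>
    equivalence (CSets \<S>) (NCSets \<S>) (restrict_fctr (CSets \<S>) (Res \<S>))"
proof -
  interpret set_universe \<S> by fact
  interpret projective_site "CHaus \<S>" "beta \<S> ` \<S>" by (rule projective_site_CHaus)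
  \<comment> \<open>\<open>Res\<close> is an instance of the general restriction functor by
    definition, so the abstract equivalence applies as it stands.\<close>
  have Res: "Res \<S> = psh_restriction \<S> (CHaus \<S>) (betaSets \<S>)"
    by (simp add: Res_def psh_restriction_def)
  show ?thesis
    unfolding Res CSets_def NCSets_def betaSets_def
    by (intro conjI is_functor_psh_restriction equivalence_restriction) (rule subset_closed)
qed

end
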